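(* Let $T$ be a stable theory, and work in $T^{\mathrm{eq}}$. Let $p(\bar x)$ be a stationary type. If $(\bar a_i)_{i<\omega}$ is a Morley sequence for $p(\bar x)$, then $$\operatorname{cb}(p)=\ker(\bar a_i)_{i<\omega}.$$
   Context: $T$ is a complete consistent first-order theory. Everything ($\operatorname{dcl}$, types, $\ker$) is computed in a big saturated model of $T^{\mathrm{eq}}$. Stability, forking and stationarity are understood in the standard sense. The canonical base $\operatorname{cb}(p)$ of a stationary type $p$, which is determined up to interdefinability, is regarded as a definably closed set of imaginaries (the smallest definably closed subset $C$ of the definable closure of the domain of $p$ such that $p$ does not fork over $C$ and the restriction of $p$ to $C$ is stationary). A Morley sequence for a complete type $p$ over $B$ is a sequence of $B$-indiscernibles $(\bar a_i)_{i<\omega}$, each realising $p$, such that $(\bar a_i)_{i<n}$ is (forking-)independent from $\bar a_n$ over $B$ for every $n<\omega$. The kernel of a sequence of indiscernibles is $\ker(\bar a_i)_{i<\omega}=\{d\mid d\in\operatorname{dcl}(\{\bar a_i\mid i<\omega\})\text{ and }(\bar a_i)_{i<\omega}\text{ is indiscernible over }d\}$. *)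

theory Defs
  imports Main
begin

unbundle cardinal_syntax

section \<open>Many-sorted first-order logic\<close>

record ('s, 'f, 'r) lang =
  Sorts :: "'s set"
  Funs :: "'f set"
  Rels :: "'r set"
  fdom :: "'f \<Rightarrow> 's list"
  fcod :: "'f \<Rightarrow> 's"
  rdom :: "'r \<Rightarrow> 's list"

text \<open>Variables are de Bruijn indices into a context, i.e. a list of sorts. Below a
  quantifier the bound variable is 0.\<close>

datatype 'f tm = Var nat | Fn 'f "'f tm list"

datatype ('s, 'f, 'r) fm =
    Eq "'f tm" "'f tm"
  | Rel 'r "'f tm list"
  | Neg "('s, 'f, 'r) fm"
  | Conj "('s, 'f, 'r) fm" "('s, 'f, 'r) fm"
  | Exists 's "('s, 'f, 'r) fm"

definition Forall :: "'s \<Rightarrow> ('s, 'f, 'r) fm \<Rightarrow> ('s, 'f, 'r) fm" where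
  "Forall s \<phi> = Neg (Exists s (Neg \<phi>))"

definition Iff :: "('s, 'f, 'r) fm \<Rightarrow> ('s, 'f, 'r) fm \<Rightarrow> ('s, 'f, 'r) fm" where
  "Iff \<phi> \<psi> = Conj (Neg (Conj \<phi> (Neg \<psi>))) (Neg (Conj \<psi> (Neg \<phi>)))"

definition wf_lang :: "('s, 'f, 'r) lang \<Rightarrow> bool" where
  "wf_lang L \<longleftrightarrow>
     (\<forall>f\<in>Funs L. set (fdom L f) \<subseteq> Sorts L \<and> fcod L f \<in> Sorts L) \<and>
     (\<forall>r\<in>Rels L. set (rdom L r) \<subseteq> Sorts L)"

primrec tm_sort :: "('s, 'f, 'r) lang \<Rightarrow> 's list \<Rightarrow> 'f tm \<Rightarrow> 's" where
  "tm_sort L \<Gamma> (Var i) = \<Gamma> ! i"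
| "tm_sort L \<Gamma> (Fn f ts) = fcod L f"

primrec wf_tm :: "('s, 'f, 'r) lang \<Rightarrow> 's list \<Rightarrow> 'f tm \<Rightarrow> bool" where
  "wf_tm L \<Gamma> (Var i) \<longleftrightarrow> i < length \<Gamma>"
| "wf_tm L \<Gamma> (Fn f ts) \<longleftrightarrow>
     f \<in> Funs L \<and> list_all (wf_tm L \<Gamma>) ts \<and> map (tm_sort L \<Gamma>) ts = fdom L f"

primrec wf_fm :: "('s, 'f, 'r) lang \<Rightarrow> 's list \<Rightarrow> ('s, 'f, 'r) fm \<Rightarrow> bool" where
  "wf_fm L \<Gamma> (Eq t u) \<longleftrightarrow> wf_tm L \<Gamma> t \<and> wf_tm L \<Gamma> u \<and> tm_sort L \<Gamma> t = tm_sort L \<Gamma> u"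
| "wf_fm L \<Gamma> (Rel r ts) \<longleftrightarrow>
     r \<in> Rels L \<and> list_all (wf_tm L \<Gamma>) ts \<and> map (tm_sort L \<Gamma>) ts = rdom L r"
| "wf_fm L \<Gamma> (Neg \<phi>) \<longleftrightarrow> wf_fm L \<Gamma> \<phi>"
| "wf_fm L \<Gamma> (Conj \<phi> \<psi>) \<longleftrightarrow> wf_fm L \<Gamma> \<phi> \<and> wf_fm L \<Gamma> \<psi>"
| "wf_fm L \<Gamma> (Exists s \<phi>) \<longleftrightarrow> s \<in> Sorts L \<and> wf_fm L (s # \<Gamma>) \<phi>"

record ('a, 's, 'f, 'r) struc =
  univ :: "'a set"
  sort_of :: "'a \<Rightarrow> 's"
  fint :: "'f \<Rightarrow> 'a list \<Rightarrow> 'a"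
  rint :: "'r \<Rightarrow> 'a list \<Rightarrow> bool"

definition tuples :: "('a, 's, 'f, 'r) struc \<Rightarrow> 's list \<Rightarrow> 'a list set" where
  "tuples M ss = {a. set a \<subseteq> univ M \<and> map (sort_of M) a = ss}"

definition is_struc :: "('s, 'f, 'r) lang \<Rightarrow> ('a, 's, 'f, 'r) struc \<Rightarrow> bool" where
  "is_struc L M \<longleftrightarrow>
     sort_of M ` univ M = Sorts L \<and>
     (\<forall>f\<in>Funs L. \<forall>a\<in>tuples M (fdom L f).
        fint M f a \<in> univ M \<and> sort_of M (fint M f a) = fcod L f)"

primrec eval :: "('a, 's, 'f, 'r) struc \<Rightarrow> 'a list \<Rightarrow> 'f tm \<Rightarrow> 'a" where
  "eval M e (Var i) = e ! i"
| "eval M e (Fn f ts) = fint M f (map (eval M e) ts)"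

primrec sat :: "('a, 's, 'f, 'r) struc \<Rightarrow> ('s, 'f, 'r) fm \<Rightarrow> 'a list \<Rightarrow> bool" where
  "sat M (Eq t u) e \<longleftrightarrow> eval M e t = eval M e u"
| "sat M (Rel r ts) e \<longleftrightarrow> rint M r (map (eval M e) ts)"
| "sat M (Neg \<phi>) e \<longleftrightarrow> \<not> sat M \<phi> e"
| "sat M (Conj \<phi> \<psi>) e \<longleftrightarrow> sat M \<phi> e \<and> sat M \<psi> e"
| "sat M (Exists s \<phi>) e \<longleftrightarrow> (\<exists>d\<in>univ M. sort_of M d = s \<and> sat M \<phi> (d # e))"

section \<open>Theories\<close>

definition is_theory :: "('s, 'f, 'r) lang \<Rightarrow> ('s, 'f, 'r) fm set \<Rightarrow> bool" where
  "is_theory L T \<longleftrightarrow> (\<forall>\<phi>\<in>T. wf_fm L [] \<phi>)"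

definition Mod :: "('s, 'f, 'r) lang \<Rightarrow> ('s, 'f, 'r) fm set \<Rightarrow> ('a, 's, 'f, 'r) struc set" where
  "Mod L T = {M. is_struc L M \<and> (\<forall>\<phi>\<in>T. sat M \<phi> [])}"

text \<open>HOL cannot quantify over the models of a theory in all types at once, so the next
  notions refer to models whose elements are taken from a given type. By the
  Loewenheim-Skolem theorem this is no restriction once that type has at least
  $|L| + \aleph_0$ elements. The element type of a model of the theory of imaginaries
  defined below always does, because that model has a nonempty sort for every formula
  that provably is an equivalence relation.\<close>

definition consistent ::
    "'a itself \<Rightarrow> ('s, 'f, 'r) lang \<Rightarrow> ('s, 'f, 'r) fm set \<Rightarrow> bool" where
  "consistent (_ :: 'a itself) L T \<longleftrightarrow> (Mod L T :: ('a, 's, 'f, 'r) struc set) \<noteq> {}"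

definition complete ::
    "'a itself \<Rightarrow> ('s, 'f, 'r) lang \<Rightarrow> ('s, 'f, 'r) fm set \<Rightarrow> bool" where
  "complete (_ :: 'a itself) L T \<longleftrightarrow>
     (\<forall>\<phi>. wf_fm L [] \<phi> \<longrightarrow>
        (\<forall>M \<in> (Mod L T :: ('a, 's, 'f, 'r) struc set). sat M \<phi> []) \<or>
        (\<forall>M \<in> (Mod L T :: ('a, 's, 'f, 'r) struc set). sat M (Neg \<phi>) []))"

text \<open>In \<open>order_property L M xs ys \<phi>\<close> the free variables of \<open>\<phi>\<close> are split into a first
  block of sorts \<open>xs\<close> and a second block of sorts \<open>ys\<close>.\<close>

definition order_property ::
    "('a, 's, 'f, 'r) struc \<Rightarrow> 's list \<Rightarrow> 's list \<Rightarrow> ('s, 'f, 'r) fm \<Rightarrow> bool" where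
  "order_property M xs ys \<phi> \<longleftrightarrow>
     (\<exists>a b. (\<forall>i::nat. a i \<in> tuples M xs \<and> b i \<in> tuples M ys) \<and>
        (\<forall>i j. sat M \<phi> (a i @ b j) \<longleftrightarrow> i < j))"

definition stable ::
    "'a itself \<Rightarrow> ('s, 'f, 'r) lang \<Rightarrow> ('s, 'f, 'r) fm set \<Rightarrow> bool" where
  "stable (_ :: 'a itself) L T \<longleftrightarrow>
     (\<forall>M \<in> (Mod L T :: ('a, 's, 'f, 'r) struc set). \<forall>xs ys \<phi>.
        wf_fm L (xs @ ys) \<phi> \<longrightarrow> \<not> order_property M xs ys \<phi>)"

section \<open>Imaginaries\<close>

datatype ('s, 'f, 'r) eqsort = Home 's | Quot "'s list" "('s, 'f, 'r) fm"

datatype ('s, 'f, 'r) eqfun = Orig 'f | Proj "'s list" "('s, 'f, 'r) fm"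

definition def_equivs ::
    "'a itself \<Rightarrow> ('s, 'f, 'r) lang \<Rightarrow> ('s, 'f, 'r) fm set \<Rightarrow> ('s list \<times> ('s, 'f, 'r) fm) set" where
  "def_equivs (_ :: 'a itself) L T =
     {(ss, E). set ss \<subseteq> Sorts L \<and> wf_fm L (ss @ ss) E \<and>
        (\<forall>M \<in> (Mod L T :: ('a, 's, 'f, 'r) struc set).
           equiv (tuples M ss)
             {(x, y). x \<in> tuples M ss \<and> y \<in> tuples M ss \<and> sat M E (x @ y)})}"

definition lang_eq ::
    "'a itself \<Rightarrow> ('s, 'f, 'r) lang \<Rightarrow> ('s, 'f, 'r) fm set \<Rightarrow>
     (('s, 'f, 'r) eqsort, ('s, 'f, 'r) eqfun, 'r) lang" where
  "lang_eq TA L T =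
     \<lparr>Sorts = Home ` Sorts L \<union> (\<lambda>(ss, E). Quot ss E) ` def_equivs TA L T,
      Funs = Orig ` Funs L \<union> (\<lambda>(ss, E). Proj ss E) ` def_equivs TA L T,
      Rels = Rels L,
      fdom = (\<lambda>g. case g of Orig f \<Rightarrow> map Home (fdom L f) | Proj ss E \<Rightarrow> map Home ss),
      fcod = (\<lambda>g. case g of Orig f \<Rightarrow> Home (fcod L f) | Proj ss E \<Rightarrow> Quot ss E),
      rdom = (\<lambda>r. map Home (rdom L r))\<rparr>"

abbreviation home_fm ::
    "('s, 'f, 'r) fm \<Rightarrow> (('s, 'f, 'r) eqsort, ('s, 'f, 'r) eqfun, 'r) fm" where
  "home_fm \<equiv> map_fm Home Orig id"

text \<open>The two axioms for an equivalence relation \<open>E\<close>: two tuples have the same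
  projection iff they are \<open>E\<close>-equivalent, and the projection is onto. Note that
  \<open>fold Exists ss \<phi>\<close> closes off a formula whose context begins with \<open>ss\<close>.\<close>

definition proj_kernel ::
    "'s list \<Rightarrow> ('s, 'f, 'r) fm \<Rightarrow> (('s, 'f, 'r) eqsort, ('s, 'f, 'r) eqfun, 'r) fm" where
  "proj_kernel ss E = (let n = length ss in
     fold Forall (map Home (ss @ ss))
       (Iff (Eq (Fn (Proj ss E) (map Var [0..<n])) (Fn (Proj ss E) (map Var [n..<2 * n])))
            (home_fm E)))"

definition proj_onto ::
    "'s list \<Rightarrow> ('s, 'f, 'r) fm \<Rightarrow> (('s, 'f, 'r) eqsort, ('s, 'f, 'r) eqfun, 'r) fm" where
  "proj_onto ss E = (let n = length ss in
     Forall (Quot ss E)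
       (fold Exists (map Home ss) (Eq (Fn (Proj ss E) (map Var [0..<n])) (Var n))))"

definition theory_eq ::
    "'a itself \<Rightarrow> ('s, 'f, 'r) lang \<Rightarrow> ('s, 'f, 'r) fm set \<Rightarrow>
     (('s, 'f, 'r) eqsort, ('s, 'f, 'r) eqfun, 'r) fm set" where
  "theory_eq TA L T = home_fm ` T \<union>
     (\<lambda>(ss, E). proj_kernel ss E) ` def_equivs TA L T \<union>
     (\<lambda>(ss, E). proj_onto ss E) ` def_equivs TA L T"

section \<open>Types and saturation\<close>

text \<open>A formula with parameters is a pair \<open>(\<phi>, b)\<close>, where the context of \<open>\<phi>\<close> consists of
  the variables proper, of sorts \<open>ss\<close>, followed by places for the parameters \<open>b\<close>.\<close>

type_synonym ('a, 's, 'f, 'r) pfm = "('s, 'f, 'r) fm \<times> 'a list"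

definition pfms ::
    "('s, 'f, 'r) lang \<Rightarrow> ('a, 's, 'f, 'r) struc \<Rightarrow> 's list \<Rightarrow> 'a set \<Rightarrow> ('a, 's, 'f, 'r) pfm set" where
  "pfms L M ss A = {(\<phi>, b). set b \<subseteq> A \<and> wf_fm L (ss @ map (sort_of M) b) \<phi>}"

definition holds :: "('a, 's, 'f, 'r) struc \<Rightarrow> ('a, 's, 'f, 'r) pfm \<Rightarrow> 'a list \<Rightarrow> bool" where
  "holds M \<psi> a \<longleftrightarrow> sat M (fst \<psi>) (a @ snd \<psi>)"

definition realises ::
    "('a, 's, 'f, 'r) struc \<Rightarrow> 's list \<Rightarrow> 'a list \<Rightarrow> ('a, 's, 'f, 'r) pfm set \<Rightarrow> bool" where
  "realises M ss a p \<longleftrightarrow> a \<in> tuples M ss \<and> (\<forall>\<psi>\<in>p. holds M \<psi> a)"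

definition fin_sat ::
    "('a, 's, 'f, 'r) struc \<Rightarrow> 's list \<Rightarrow> ('a, 's, 'f, 'r) pfm set \<Rightarrow> bool" where
  "fin_sat M ss p \<longleftrightarrow> (\<forall>q. finite q \<and> q \<subseteq> p \<longrightarrow> (\<exists>a. realises M ss a q))"

definition complete_types ::
    "('s, 'f, 'r) lang \<Rightarrow> ('a, 's, 'f, 'r) struc \<Rightarrow> 's list \<Rightarrow> 'a set \<Rightarrow>
     ('a, 's, 'f, 'r) pfm set set" where
  "complete_types L M ss A =
     {p. p \<subseteq> pfms L M ss A \<and> fin_sat M ss p \<and>
        (\<forall>(\<phi>, b)\<in>pfms L M ss A. (\<phi>, b) \<in> p \<or> (Neg \<phi>, b) \<in> p)}"

definition tp ::
    "('s, 'f, 'r) lang \<Rightarrow> ('a, 's, 'f, 'r) struc \<Rightarrow> 'a list \<Rightarrow> 'a set \<Rightarrow> ('a, 's, 'f, 'r) pfm set" where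
  "tp L M a A = {\<psi> \<in> pfms L M (map (sort_of M) a) A. holds M \<psi> a}"

definition small :: "'k rel \<Rightarrow> 'b set \<Rightarrow> bool" where
  "small \<kappa> A \<longleftrightarrow> |A| <o \<kappa>"

definition saturated ::
    "('s, 'f, 'r) lang \<Rightarrow> ('a, 's, 'f, 'r) struc \<Rightarrow> 'k rel \<Rightarrow> bool" where
  "saturated L M \<kappa> \<longleftrightarrow>
     (\<forall>ss A p. A \<subseteq> univ M \<and> small \<kappa> A \<and> p \<subseteq> pfms L M ss A \<and> fin_sat M ss p \<longrightarrow>
        (\<exists>a. realises M ss a p))"

definition dcl :: "('s, 'f, 'r) lang \<Rightarrow> ('a, 's, 'f, 'r) struc \<Rightarrow> 'a set \<Rightarrow> 'a set" where
  "dcl L M A = {d \<in> univ M. \<exists>\<psi>\<in>pfms L M [sort_of M d] A.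
     \<forall>x\<in>univ M. sort_of M x = sort_of M d \<longrightarrow> (holds M \<psi> [x] \<longleftrightarrow> x = d)}"

section \<open>Forking, stationarity and canonical bases\<close>

text \<open>The formula \<open>\<phi>(x, c)\<close> divides over \<open>A\<close>.\<close>

definition divides ::
    "('s, 'f, 'r) lang \<Rightarrow> ('a, 's, 'f, 'r) struc \<Rightarrow> 's list \<Rightarrow> ('a, 's, 'f, 'r) pfm \<Rightarrow> 'a set \<Rightarrow> bool" where
  "divides L M ss \<psi> A \<longleftrightarrow> (case \<psi> of (\<phi>, c) \<Rightarrow>
     \<exists>k (c' :: nat \<Rightarrow> 'a list).
       (\<forall>i. c' i \<in> tuples M (map (sort_of M) c) \<and> tp L M (c' i) A = tp L M c A) \<and>
       (\<forall>I. finite I \<and> card I = k \<longrightarrow> \<not> (\<exists>a\<in>tuples M ss. \<forall>i\<in>I. holds M (\<phi>, c' i) a)))"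

definition forks ::
    "('s, 'f, 'r) lang \<Rightarrow> ('a, 's, 'f, 'r) struc \<Rightarrow> 's list \<Rightarrow> ('a, 's, 'f, 'r) pfm set \<Rightarrow> 'a set \<Rightarrow> bool" where
  "forks L M ss p A \<longleftrightarrow>
     (\<exists>\<Psi>. finite \<Psi> \<and> \<Psi> \<subseteq> pfms L M ss (univ M) \<and> (\<forall>\<psi>\<in>\<Psi>. divides L M ss \<psi> A) \<and>
        (\<forall>a. realises M ss a p \<longrightarrow> (\<exists>\<psi>\<in>\<Psi>. holds M \<psi> a)))"

definition independent ::
    "('s, 'f, 'r) lang \<Rightarrow> ('a, 's, 'f, 'r) struc \<Rightarrow> 'a list \<Rightarrow> 'a list \<Rightarrow> 'a set \<Rightarrow> bool" where
  "independent L M a c B \<longleftrightarrow> \<not> forks L M (map (sort_of M) a) (tp L M a (B \<union> set c)) B"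

definition stationary ::
    "('s, 'f, 'r) lang \<Rightarrow> ('a, 's, 'f, 'r) struc \<Rightarrow> 'k rel \<Rightarrow> 's list \<Rightarrow> 'a set \<Rightarrow>
     ('a, 's, 'f, 'r) pfm set \<Rightarrow> bool" where
  "stationary L M \<kappa> ss B p \<longleftrightarrow> p \<in> complete_types L M ss B \<and>
     (\<forall>D. B \<subseteq> D \<and> D \<subseteq> univ M \<and> small \<kappa> D \<longrightarrow>
        (\<exists>!q. q \<in> complete_types L M ss D \<and> p \<subseteq> q \<and> \<not> forks L M ss q B))"

text \<open>For \<open>C\<close> inside the definable closure of the domain of \<open>p\<close>, but not necessarily inside
  the domain itself, the restriction of \<open>p\<close> to \<open>C\<close> consists of the formulas over \<open>C\<close> which
  \<open>p\<close> implies.\<close>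

definition restriction ::
    "('s, 'f, 'r) lang \<Rightarrow> ('a, 's, 'f, 'r) struc \<Rightarrow> 's list \<Rightarrow> ('a, 's, 'f, 'r) pfm set \<Rightarrow> 'a set \<Rightarrow>
     ('a, 's, 'f, 'r) pfm set" where
  "restriction L M ss p C = {\<psi> \<in> pfms L M ss C. \<forall>a. realises M ss a p \<longrightarrow> holds M \<psi> a}"

definition base ::
    "('s, 'f, 'r) lang \<Rightarrow> ('a, 's, 'f, 'r) struc \<Rightarrow> 'k rel \<Rightarrow> 's list \<Rightarrow> 'a set \<Rightarrow>
     ('a, 's, 'f, 'r) pfm set \<Rightarrow> 'a set \<Rightarrow> bool" where
  "base L M \<kappa> ss B p C \<longleftrightarrow>
     C \<subseteq> dcl L M B \<and> dcl L M C = C \<and> \<not> forks L M ss p C \<and>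
     stationary L M \<kappa> ss C (restriction L M ss p C)"

definition is_canonical_base ::
    "('s, 'f, 'r) lang \<Rightarrow> ('a, 's, 'f, 'r) struc \<Rightarrow> 'k rel \<Rightarrow> 's list \<Rightarrow> 'a set \<Rightarrow>
     ('a, 's, 'f, 'r) pfm set \<Rightarrow> 'a set \<Rightarrow> bool" where
  "is_canonical_base L M \<kappa> ss B p C \<longleftrightarrow>
     base L M \<kappa> ss B p C \<and> (\<forall>C'. base L M \<kappa> ss B p C' \<longrightarrow> C \<subseteq> C')"

definition cb ::
    "('s, 'f, 'r) lang \<Rightarrow> ('a, 's, 'f, 'r) struc \<Rightarrow> 'k rel \<Rightarrow> 's list \<Rightarrow> 'a set \<Rightarrow>
     ('a, 's, 'f, 'r) pfm set \<Rightarrow> 'a set" where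
  "cb L M \<kappa> ss B p = (THE C. is_canonical_base L M \<kappa> ss B p C)"

section \<open>Indiscernible sequences\<close>

definition indiscernible ::
    "('s, 'f, 'r) lang \<Rightarrow> ('a, 's, 'f, 'r) struc \<Rightarrow> 'a set \<Rightarrow> (nat \<Rightarrow> 'a list) \<Rightarrow> bool" where
  "indiscernible L M A a \<longleftrightarrow>
     (\<forall>is js. sorted_wrt (<) is \<and> sorted_wrt (<) js \<and> length is = length js \<longrightarrow>
        tp L M (concat (map a is)) A = tp L M (concat (map a js)) A)"

definition morley_sequence ::
    "('s, 'f, 'r) lang \<Rightarrow> ('a, 's, 'f, 'r) struc \<Rightarrow> 's list \<Rightarrow> 'a set \<Rightarrow>
     ('a, 's, 'f, 'r) pfm set \<Rightarrow> (nat \<Rightarrow> 'a list) \<Rightarrow> bool" where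
  "morley_sequence L M ss B p a \<longleftrightarrow>
     indiscernible L M B a \<and> (\<forall>i. realises M ss (a i) p) \<and>
     (\<forall>n. independent L M (concat (map a [0..<n])) (a n) B)"

definition kernel ::
    "('s, 'f, 'r) lang \<Rightarrow> ('a, 's, 'f, 'r) struc \<Rightarrow> (nat \<Rightarrow> 'a list) \<Rightarrow> 'a set" where
  "kernel L M a = {d \<in> dcl L M (\<Union>i. set (a i)). indiscernible L M {d} a}"

end

theory Submission
  imports Defs
begin

text \<open>
  By stationarity the nonforking extensions of \<open>p\<close> form a global type \<open>P\<close> which is invariant over \<open>B\<close>.
  As there is no order property, along a Morley sequence of \<open>P\<close> the truth value of each formula changes
  only boundedly often, so \<open>P\<close> is definable by majority vote over finitely many members of
  the sequence, and, because the vote can be held among members arbitrarily far out, the canonical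
  parameters of its definitions lie in the kernel \<open>K\<close>. Hence \<open>P\<close> is invariant over \<open>K\<close>. A global type
  invariant over a set \<open>C\<close> does not fork over \<open>C\<close> and is the only nonforking extension of its restriction
  to \<open>C\<close>, so \<open>K\<close> is a base of \<open>p\<close>. Conversely \<open>P\<close> is invariant over every base \<open>C\<close>, so the given
  sequence is a Morley sequence over \<open>C\<close>; an element \<open>d\<close> of the kernel is definable from
  any of its blocks in the same way, and comparison with an independent block shows that \<open>d\<close> is the only
  realisation of its type over \<open>C\<close>, that is, \<open>d\<close> belongs to \<open>C\<close>. Neither ranks nor the finite
  equivalence relation theorem are needed.
\<close>

section \<open>Substitution\<close>

text \<open>The definition of a Morley sequence only makes each initial segment independent from the
  next member, whereas the argument wants the next member to realise \<open>P\<close> over the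
  segment. Passing from one to the other is an instance of symmetry of forking; it is drawn from the
  definability of \<open>P\<close>, not from a general theory of forking. The bound on alternations
  is thus used three times: to define \<open>P\<close>, for this symmetry, and to show that formulas
  outside \<open>P\<close> divide. The model is saturated, but nothing provides automorphisms, so
  conjugacy means equality of types and is extended by one finite tuple at a time. Formulas are
  handled through the sets they define, which allows parameters and the order of variables to be
  changed without touching syntax. Imaginaries enter where the definitions of \<open>P\<close> must
  be named by single elements. Quotient sorts come from formulas over the home sorts only, while
  those definitions may have imaginary parameters; hence formulas about imaginaries are translated
  into formulas about representatives. The same translation carries stability over to the theory of
  imaginaries.\<close>

primrec subst_tm :: "(nat \<Rightarrow> 'f tm) \<Rightarrow> 'f tm \<Rightarrow> 'f tm" where
  "subst_tm \<sigma> (Var i) = \<sigma> i"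
| "subst_tm \<sigma> (Fn f ts) = Fn f (map (subst_tm \<sigma>) ts)"

definition lift_subst :: "(nat \<Rightarrow> 'f tm) \<Rightarrow> nat \<Rightarrow> 'f tm" where
  "lift_subst \<sigma> = case_nat (Var 0) (\<lambda>i. subst_tm (\<lambda>k. Var (Suc k)) (\<sigma> i))"

primrec subst_fm :: "(nat \<Rightarrow> 'f tm) \<Rightarrow> ('s, 'f, 'r) fm \<Rightarrow> ('s, 'f, 'r) fm" where
  "subst_fm \<sigma> (Eq t u) = Eq (subst_tm \<sigma> t) (subst_tm \<sigma> u)"
| "subst_fm \<sigma> (Rel r ts) = Rel r (map (subst_tm \<sigma>) ts)"
| "subst_fm \<sigma> (Neg \<phi>) = Neg (subst_fm \<sigma> \<phi>)"
| "subst_fm \<sigma> (Conj \<phi> \<psi>) = Conj (subst_fm \<sigma> \<phi>) (subst_fm \<sigma> \<psi>)"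
| "subst_fm \<sigma> (Exists s \<phi>) = Exists s (subst_fm (lift_subst \<sigma>) \<phi>)"

definition wf_subst ::
    "('s, 'f, 'r) lang \<Rightarrow> 's list \<Rightarrow> 's list \<Rightarrow> (nat \<Rightarrow> 'f tm) \<Rightarrow> bool" where
  "wf_subst L \<Gamma> \<Delta> \<sigma> \<longleftrightarrow>
     (\<forall>i<length \<Gamma>. wf_tm L \<Delta> (\<sigma> i) \<and> tm_sort L \<Delta> (\<sigma> i) = \<Gamma> ! i)"

lemma wf_subst_tm:
  assumes "wf_subst L \<Gamma> \<Delta> \<sigma>" "wf_tm L \<Gamma> t"
  shows "wf_tm L \<Delta> (subst_tm \<sigma> t) \<and> tm_sort L \<Delta> (subst_tm \<sigma> t) = tm_sort L \<Gamma> t"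
  using assms
proof (induction t)
  case (Fn f ts)
  then have *: "\<And>t. t \<in> set ts \<Longrightarrow>
      wf_tm L \<Delta> (subst_tm \<sigma> t) \<and> tm_sort L \<Delta> (subst_tm \<sigma> t) = tm_sort L \<Gamma> t"
    by (auto simp: list_all_iff)
  then have "map (tm_sort L \<Delta> \<circ> subst_tm \<sigma>) ts = map (tm_sort L \<Gamma>) ts" by simp
  with * Fn.prems show ?case by (auto simp: list_all_iff)
qed (auto simp: wf_subst_def)

lemma wf_lift_subst: "wf_subst L \<Gamma> \<Delta> \<sigma> \<Longrightarrow> wf_subst L (s # \<Gamma>) (s # \<Delta>) (lift_subst \<sigma>)"
proof -
  assume a: "wf_subst L \<Gamma> \<Delta> \<sigma>"
  have "wf_subst L \<Delta> (s # \<Delta>) (\<lambda>k. Var (Suc k))" by (auto simp: wf_subst_def)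
  from wf_subst_tm[OF this] a show ?thesis
    by (auto simp: wf_subst_def lift_subst_def nth_Cons split: nat.split)
qed

lemma wf_subst_fm: "wf_subst L \<Gamma> \<Delta> \<sigma> \<Longrightarrow> wf_fm L \<Gamma> \<phi> \<Longrightarrow> wf_fm L \<Delta> (subst_fm \<sigma> \<phi>)"
proof (induction \<phi> arbitrary: \<Gamma> \<Delta> \<sigma>)
  case (Rel r ts)
  then have *: "\<And>t. t \<in> set ts \<Longrightarrow>
      wf_tm L \<Delta> (subst_tm \<sigma> t) \<and> tm_sort L \<Delta> (subst_tm \<sigma> t) = tm_sort L \<Gamma> t"
    by (auto simp: list_all_iff wf_subst_tm)
  then have "map (tm_sort L \<Delta> \<circ> subst_tm \<sigma>) ts = map (tm_sort L \<Gamma>) ts" by simp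
  with * Rel.prems show ?case by (auto simp: list_all_iff)
next
  case (Exists s \<phi>)
  then show ?case using wf_lift_subst by fastforce
qed (auto simp: wf_subst_tm)

definition subst_env ::
    "('a, 's, 'f, 'r) struc \<Rightarrow> nat \<Rightarrow> (nat \<Rightarrow> 'f tm) \<Rightarrow> 'a list \<Rightarrow> 'a list" where
  "subst_env M n \<sigma> e = map (\<lambda>i. eval M e (\<sigma> i)) [0..<n]"

lemma eval_subst_tm:
  assumes "wf_tm L \<Gamma> t"
  shows "eval M e (subst_tm \<sigma> t) = eval M (subst_env M (length \<Gamma>) \<sigma> e) t"
  using assms
proof (induction t)
  case (Fn f ts)
  then have "map (eval M e \<circ> subst_tm \<sigma>) ts = map (eval M (subst_env M (length \<Gamma>) \<sigma> e)) ts"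
    by (auto simp: list_all_iff)
  then show ?case by (simp del: map_eq_conv)
qed (auto simp: subst_env_def)

lemma eval_shift: "eval M (d # e) (subst_tm (\<lambda>k. Var (Suc k)) t) = eval M e t"
proof (induction t)
  case (Fn f ts)
  then have "map (eval M (d # e) \<circ> subst_tm (\<lambda>k. Var (Suc k))) ts = map (eval M e) ts" by simp
  then show ?case by (simp del: map_eq_conv)
qed simp

lemma subst_env_lift: "subst_env M (Suc n) (lift_subst \<sigma>) (d # e) = d # subst_env M n \<sigma> e"
proof -
  have "subst_env M (Suc n) (lift_subst \<sigma>) (d # e) =
      map (\<lambda>i. eval M (d # e) (lift_subst \<sigma> i)) (0 # map Suc [0..<n])"
    by (simp add: subst_env_def map_Suc_upt upt_conv_Cons del: upt_Suc)
  then show ?thesis by (simp add: subst_env_def lift_subst_def eval_shift)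
qed

lemma sat_subst_fm:
  "wf_fm L \<Gamma> \<phi> \<Longrightarrow> sat M (subst_fm \<sigma> \<phi>) e \<longleftrightarrow> sat M \<phi> (subst_env M (length \<Gamma>) \<sigma> e)"
proof (induction \<phi> arbitrary: \<Gamma> \<sigma> e)
  case (Rel r ts)
  then have "map (eval M e \<circ> subst_tm \<sigma>) ts = map (eval M (subst_env M (length \<Gamma>) \<sigma> e)) ts"
    by (auto simp: list_all_iff eval_subst_tm)
  then show ?case by (simp del: map_eq_conv)
next
  case (Exists s \<phi>)
  then have "wf_fm L (s # \<Gamma>) \<phi>" by simp
  from Exists.IH[OF this] show ?case by (simp add: subst_env_lift)
qed (auto simp: eval_subst_tm)

lemma sat_Forall [simp]:
  "sat M (Forall s \<phi>) e \<longleftrightarrow> (\<forall>d\<in>univ M. sort_of M d = s \<longrightarrow> sat M \<phi> (d # e))"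
  by (auto simp: Forall_def)

lemma sat_Iff [simp]: "sat M (Iff \<phi> \<psi>) e \<longleftrightarrow> (sat M \<phi> e \<longleftrightarrow> sat M \<psi> e)"
  by (auto simp: Iff_def)

lemma tuples_Nil [simp]: "tuples M [] = {[]}"
  by (auto simp: tuples_def)

lemma tuples_Cons: "x \<in> tuples M (s # ss) \<longleftrightarrow>
    (\<exists>d y. x = d # y \<and> d \<in> univ M \<and> sort_of M d = s \<and> y \<in> tuples M ss)"
  by (cases x) (auto simp: tuples_def)

lemma tuples_length: "x \<in> tuples M ss \<Longrightarrow> length x = length ss"
  by (auto simp: tuples_def)

lemma tuples_set: "x \<in> tuples M ss \<Longrightarrow> set x \<subseteq> univ M"
  by (auto simp: tuples_def)

lemma tuples_sorts: "x \<in> tuples M ss \<Longrightarrow> map (sort_of M) x = ss"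
  by (auto simp: tuples_def)

lemma tuplesI: "set x \<subseteq> univ M \<Longrightarrow> x \<in> tuples M (map (sort_of M) x)"
  by (auto simp: tuples_def)

lemma tuples_append: "x \<in> tuples M ss \<Longrightarrow> y \<in> tuples M ts \<Longrightarrow> x @ y \<in> tuples M (ss @ ts)"
  by (auto simp: tuples_def)

lemma tuples_append_iff:
  "length x = length ss \<Longrightarrow>
     x @ y \<in> tuples M (ss @ ts) \<longleftrightarrow> x \<in> tuples M ss \<and> y \<in> tuples M ts"
  by (auto simp: tuples_def)

lemma tuples_appendE:
  assumes "z \<in> tuples M (ss @ ts)"
  obtains x y where "z = x @ y" "x \<in> tuples M ss" "y \<in> tuples M ts"
proof -
  have "z = take (length ss) z @ drop (length ss) z" by simp
  moreover have "take (length ss) z \<in> tuples M ss" "drop (length ss) z \<in> tuples M ts"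
    using assms by (auto simp: tuples_def dest: in_set_takeD in_set_dropD simp flip: take_map drop_map)
  ultimately show ?thesis using that by blast
qed

lemma sat_fold_Exists:
  "sat M (fold Exists ss \<phi>) e \<longleftrightarrow> (\<exists>x\<in>tuples M ss. sat M \<phi> (x @ e))"
  by (induction ss arbitrary: \<phi>) (force simp: tuples_Cons Bex_def)+

lemma sat_fold_Forall:
  "sat M (fold Forall ss \<phi>) e \<longleftrightarrow> (\<forall>x\<in>tuples M ss. sat M \<phi> (x @ e))"
  by (induction ss arbitrary: \<phi>) (force simp: tuples_Cons Ball_def)+

lemma wf_fold_Exists:
  "set ss \<subseteq> Sorts L \<Longrightarrow> wf_fm L (ss @ \<Gamma>) \<phi> \<Longrightarrow> wf_fm L \<Gamma> (fold Exists ss \<phi>)"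
proof (induction ss arbitrary: \<phi>)
  case (Cons s ss)
  then show ?case by (cases ss) auto
qed simp

section \<open>Definable sets of tuples\<close>

definition rename :: "(nat \<Rightarrow> nat) \<Rightarrow> ('s, 'f, 'r) fm \<Rightarrow> ('s, 'f, 'r) fm" where
  "rename f = subst_fm (\<lambda>i. Var (f i))"

lemma wf_rename:
  "wf_fm L \<Gamma> \<phi> \<Longrightarrow> (\<And>i. i < length \<Gamma> \<Longrightarrow> f i < length \<Delta> \<and> \<Delta> ! f i = \<Gamma> ! i) \<Longrightarrow>
     wf_fm L \<Delta> (rename f \<phi>)"
  unfolding rename_def by (rule wf_subst_fm) (auto simp: wf_subst_def)

lemma sat_rename:
  assumes "wf_fm L \<Gamma> \<phi>" "length e' = length \<Gamma>" "\<And>i. i < length \<Gamma> \<Longrightarrow> e ! f i = e' ! i"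
  shows "sat M (rename f \<phi>) e \<longleftrightarrow> sat M \<phi> e'"
proof -
  have "subst_env M (length \<Gamma>) (\<lambda>i. Var (f i)) e = e'"
    using assms by (intro nth_equalityI) (auto simp: subst_env_def)
  then show ?thesis using sat_subst_fm[OF assms(1)] unfolding rename_def by metis
qed

text \<open>The assumption \<open>sorts_ne\<close> ensures that some formula is well formed: without
  sorts there may be none, and then not even the set of all tuples would be definable.\<close>

locale mstruc =
  fixes L :: "('s, 'f, 'r) lang" and M :: "('a, 's, 'f, 'r) struc"
  assumes struc: "is_struc L M" and sorts_ne: "Sorts L \<noteq> {}"
begin

abbreviation "tup \<equiv> tuples M"

definition dset :: "'s list \<Rightarrow> ('a, 's, 'f, 'r) pfm \<Rightarrow> 'a list set" where
  "dset ss \<psi> = {x \<in> tup ss. holds M \<psi> x}"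

text \<open>Definability over \<open>A\<close>, as a property of sets. Different formulas with
  different parameter lists may define one set, and the later arguments depend on the set
  alone.\<close>

definition dfb :: "'a set \<Rightarrow> 's list \<Rightarrow> 'a list set \<Rightarrow> bool" where
  "dfb A ss S \<longleftrightarrow> (\<exists>\<psi>\<in>pfms L M ss A. S = dset ss \<psi>)"

lemma sort_in: "d \<in> univ M \<Longrightarrow> sort_of M d \<in> Sorts L"
  using struc by (auto simp: is_struc_def)

lemma sort_ex: "s \<in> Sorts L \<Longrightarrow> \<exists>d\<in>univ M. sort_of M d = s"
  using struc unfolding is_struc_def by (metis imageE)

lemma tup_sorts: "x \<in> tup ss \<Longrightarrow> set ss \<subseteq> Sorts L"
  using sort_in unfolding tuples_def by fastforce

lemma dfbI: "S = {x \<in> tup ss. sat M \<phi> (x @ b)} \<Longrightarrow> (\<phi>, b) \<in> pfms L M ss A \<Longrightarrow> dfb A ss S"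
  by (force simp: dfb_def dset_def holds_def)

lemma dfbE:
  assumes "dfb A ss S"
  obtains \<phi> b where "(\<phi>, b) \<in> pfms L M ss A" "set b \<subseteq> A" "wf_fm L (ss @ map (sort_of M) b) \<phi>"
    "S = {x \<in> tup ss. sat M \<phi> (x @ b)}"
  using assms by (force simp: dfb_def dset_def holds_def pfms_def)

lemma dfb_sub: "dfb A ss S \<Longrightarrow> S \<subseteq> tup ss"
  by (auto simp: dfb_def dset_def)

lemma dfb_mono: "dfb A ss S \<Longrightarrow> A \<subseteq> A' \<Longrightarrow> dfb A' ss S"
  by (force simp: dfb_def pfms_def)

lemma dfb_dset: "\<psi> \<in> pfms L M ss A \<Longrightarrow> dfb A ss (dset ss \<psi>)"
  by (auto simp: dfb_def)

lemma dset_Neg: "dset ss (Neg \<phi>, b) = tup ss - dset ss (\<phi>, b)"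
  by (auto simp: dset_def holds_def)

lemma pfms_Neg: "(\<phi>, b) \<in> pfms L M ss A \<Longrightarrow> (Neg \<phi>, b) \<in> pfms L M ss A"
  by (auto simp: pfms_def)

section \<open>Boolean combinations of definable sets\<close>

lemma dfb_tup: "dfb A ss (tup ss)"
proof -
  obtain s where s: "s \<in> Sorts L" using sorts_ne by auto
  then obtain d where "d \<in> univ M" "sort_of M d = s" using sort_ex by blast
  \<comment> \<open>A sentence is used because \<open>ss\<close> may be empty; it is true because
    every sort of the structure is inhabited.\<close>
  then have "tup ss = {x \<in> tup ss. sat M (Exists s (Eq (Var 0) (Var 0))) (x @ [])}" by auto
  then show ?thesis by (rule dfbI) (use s in \<open>auto simp: pfms_def\<close>)
qed

lemma dfb_Compl: "dfb A ss S \<Longrightarrow> dfb A ss (tup ss - S)"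
  by (metis dfb_def dset_Neg pfms_Neg surj_pair)

lemma dfb_Int:
  assumes "dfb A ss S" "dfb A ss S'" shows "dfb A ss (S \<inter> S')"
proof -
  from assms(1) obtain \<phi> b where 1: "set b \<subseteq> A" "wf_fm L (ss @ map (sort_of M) b) \<phi>"
    "S = {x \<in> tup ss. sat M \<phi> (x @ b)}" by (rule dfbE)
  from assms(2) obtain \<psi> c where 2: "set c \<subseteq> A" "wf_fm L (ss @ map (sort_of M) c) \<psi>"
    "S' = {x \<in> tup ss. sat M \<psi> (x @ c)}" by (rule dfbE)
  let ?\<Delta> = "ss @ map (sort_of M) (b @ c)"
  let ?f = "\<lambda>i. if i < length ss then i else i + length b"
  have 3: "wf_fm L ?\<Delta> (rename (\<lambda>i. i) \<phi>)"
    by (rule wf_rename[OF 1(2)]) (auto simp: nth_append)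
  have 4: "wf_fm L ?\<Delta> (rename ?f \<psi>)"
    by (rule wf_rename[OF 2(2)]) (auto simp: nth_append)
  have "sat M (rename (\<lambda>i. i) \<phi>) (x @ b @ c) \<longleftrightarrow> sat M \<phi> (x @ b)" if "x \<in> tup ss" for x
    using tuples_length[OF that] by (intro sat_rename[OF 1(2)]) (auto simp: nth_append)
  moreover have "sat M (rename ?f \<psi>) (x @ b @ c) \<longleftrightarrow> sat M \<psi> (x @ c)" if "x \<in> tup ss" for x
    using tuples_length[OF that] by (intro sat_rename[OF 2(2)]) (auto simp: nth_append)
  ultimately have "S \<inter> S' = {x \<in> tup ss. sat M (Conj (rename (\<lambda>i. i) \<phi>) (rename ?f \<psi>)) (x @ b @ c)}"
    using 1(3) 2(3) by auto
  then show ?thesis by (rule dfbI) (use 1 2 3 4 in \<open>auto simp: pfms_def\<close>)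
qed

lemma dfb_Diff: "dfb A ss S \<Longrightarrow> dfb A ss S' \<Longrightarrow> dfb A ss (S - S')"
proof -
  assume a: "dfb A ss S" "dfb A ss S'"
  then have "S - S' = S \<inter> (tup ss - S')" using dfb_sub by blast
  then show ?thesis using a dfb_Int dfb_Compl by metis
qed

lemma dfb_empty: "dfb A ss {}"
  using dfb_Diff[OF dfb_tup dfb_tup] by simp

lemma dfb_Un: "dfb A ss S \<Longrightarrow> dfb A ss S' \<Longrightarrow> dfb A ss (S \<union> S')"
proof -
  assume a: "dfb A ss S" "dfb A ss S'"
  then have "S \<union> S' = tup ss - ((tup ss - S) \<inter> (tup ss - S'))" using dfb_sub by blast
  then show ?thesis using a dfb_Int dfb_Compl by metis
qed

lemma dfb_INT:
  "finite F \<Longrightarrow> (\<And>S. S \<in> F \<Longrightarrow> dfb A ss S) \<Longrightarrow> dfb A ss {x \<in> tup ss. \<forall>S\<in>F. x \<in> S}"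
proof (induction F rule: finite_induct)
  case empty
  then show ?case using dfb_tup by simp
next
  case (insert S F)
  have "{x \<in> tup ss. \<forall>S\<in>insert S F. x \<in> S} = S \<inter> {x \<in> tup ss. \<forall>S\<in>F. x \<in> S}"
    using insert.prems[of S] dfb_sub by auto
  then show ?case using insert dfb_Int by simp
qed

lemma dfb_UN: "finite F \<Longrightarrow> (\<And>S. S \<in> F \<Longrightarrow> dfb A ss S) \<Longrightarrow> dfb A ss (\<Union>F)"
proof (induction F rule: finite_induct)
  case empty
  then show ?case using dfb_empty by simp
next
  case (insert S F)
  then show ?case using dfb_Un by simp
qed

text \<open>Permuting, repeating and adding variables are all of this form: \<open>idx\<close> says
  which coordinates of the long tuple are passed to \<open>S\<close>, and in which order.\<close>

lemma dfb_reindex: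
  assumes "dfb A \<Gamma> S" "\<And>i. i \<in> set idx \<Longrightarrow> i < length \<Delta>" "map ((!) \<Delta>) idx = \<Gamma>"
  shows "dfb A \<Delta> {x \<in> tup \<Delta>. map ((!) x) idx \<in> S}"
proof -
  from assms(1) obtain \<phi> b where 1: "set b \<subseteq> A" "wf_fm L (\<Gamma> @ map (sort_of M) b) \<phi>"
    "S = {x \<in> tup \<Gamma>. sat M \<phi> (x @ b)}" by (rule dfbE)
  have len: "length \<Gamma> = length idx" using assms(3) by auto
  have nth: "idx ! i < length \<Delta> \<and> \<Delta> ! (idx ! i) = \<Gamma> ! i" if "i < length idx" for i
    using that assms(2,3) by (metis nth_map nth_mem)
  let ?f = "\<lambda>i. if i < length idx then idx ! i else i - length idx + length \<Delta>"
  let ?\<phi> = "rename ?f \<phi>"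
  have 2: "wf_fm L (\<Delta> @ map (sort_of M) b) ?\<phi>"
    by (rule wf_rename[OF 1(2)]) (use nth len in \<open>fastforce simp: nth_append\<close>)
  have "sat M ?\<phi> (x @ b) \<longleftrightarrow> sat M \<phi> (map ((!) x) idx @ b)" if "x \<in> tup \<Delta>" for x
    using tuples_length[OF that] len nth by (intro sat_rename[OF 1(2)]) (auto simp: nth_append)
  moreover have "map ((!) x) idx \<in> tup \<Gamma>" if "x \<in> tup \<Delta>" for x
  proof -
    have "length x = length \<Delta>" using that tuples_length by auto
    moreover have "map (sort_of M) x = \<Delta>" "set x \<subseteq> univ M" using that by (auto simp: tuples_def)
    ultimately show ?thesis using assms(2,3) unfolding tuples_def by fastforce
  qed
  ultimately have "{x \<in> tup \<Delta>. map ((!) x) idx \<in> S} = {x \<in> tup \<Delta>. sat M ?\<phi> (x @ b)}"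
    using 1(3) by auto
  then show ?thesis by (rule dfbI) (use 1 2 in \<open>auto simp: pfms_def\<close>)
qed

section \<open>Projections and exchange of variables\<close>

lemma dfb_Ex_Cons:
  assumes "dfb A (s # ss) S"
  shows "dfb A ss {x \<in> tup ss. \<exists>d. d # x \<in> S}"
proof (cases "s \<in> Sorts L")
  case True
  from assms obtain \<phi> b where 1: "set b \<subseteq> A" "wf_fm L ((s # ss) @ map (sort_of M) b) \<phi>"
    "S = {x \<in> tup (s # ss). sat M \<phi> (x @ b)}" by (rule dfbE)
  have "{x \<in> tup ss. \<exists>d. d # x \<in> S} = {x \<in> tup ss. sat M (Exists s \<phi>) (x @ b)}"
    using 1(3) by (auto simp: tuples_Cons)
  then show ?thesis by (rule dfbI) (use 1 True in \<open>auto simp: pfms_def\<close>)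
next
  case False
  then have "S = {}" using dfb_sub[OF assms] tup_sorts by fastforce
  then show ?thesis using dfb_empty by simp
qed

lemma dfb_Ex_prefix: "dfb A (ts @ ss) S \<Longrightarrow> dfb A ss {x \<in> tup ss. \<exists>y. y @ x \<in> S}"
proof (induction ts arbitrary: S)
  case Nil
  then have *: "S \<subseteq> tup ss" using dfb_sub by auto
  have nil: "y = []" if "y @ x \<in> S" "x \<in> tup ss" for x y
    using that * tuples_length[of "y @ x" M ss] tuples_length[of x M ss] by auto
  have "x \<in> S \<longleftrightarrow> x \<in> {x \<in> tup ss. \<exists>y. y @ x \<in> S}" for x
  proof
    assume "x \<in> S"
    then have "[] @ x \<in> S" "x \<in> tup ss" using * by auto
    then show "x \<in> {x \<in> tup ss. \<exists>y. y @ x \<in> S}" by blast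
  next
    assume "x \<in> {x \<in> tup ss. \<exists>y. y @ x \<in> S}"
    then obtain y where "y @ x \<in> S" "x \<in> tup ss" by blast
    with nil[OF this] show "x \<in> S" by simp
  qed
  then have "S = {x \<in> tup ss. \<exists>y. y @ x \<in> S}" by blast
  then show ?case using Nil by simp
next
  case (Cons t ts)
  let ?S = "{x \<in> tup (ts @ ss). \<exists>d. d # x \<in> S}"
  have "dfb A (ts @ ss) ?S" using dfb_Ex_Cons[of A t "ts @ ss"] Cons.prems by simp
  from Cons.IH[OF this] have "dfb A ss {x \<in> tup ss. \<exists>y. y @ x \<in> ?S}" .
  moreover have "{x \<in> tup ss. \<exists>y. y @ x \<in> ?S} = {x \<in> tup ss. \<exists>y. y @ x \<in> S}"
  proof -
    have "\<exists>y. y @ x \<in> ?S" if "y @ x \<in> S" "x \<in> tup ss" for x y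
    proof -
      have "y @ x \<in> tup (t # ts @ ss)" using that dfb_sub[OF Cons.prems] by auto
      then obtain d z where z: "y @ x = d # z" "z \<in> tup (ts @ ss)" by (auto simp: tuples_Cons)
      moreover have "length x = length ss" using tuples_length that by auto
      moreover have "length z = length ts + length ss" using tuples_length[OF z(2)] by simp
      ultimately obtain y' where y': "y = d # y'" "z = y' @ x" by (cases y) auto
      then have "d # (y' @ x) \<in> S" using that by simp
      then have "y' @ x \<in> ?S" using y'(2) z(2) by blast
      then show ?thesis by (rule exI)
    qed
    moreover have "\<exists>y. y @ x \<in> S" if "y @ x \<in> ?S" for x y
    proof -
      from that obtain d where "(d # y) @ x \<in> S" by auto
      then show ?thesis by (rule exI)
    qed
    ultimately show ?thesis by (intro Collect_cong) blast
  qed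
  ultimately show ?case by simp
qed

lemma nth_swap: "map ((!) (x @ y)) ([length x..<length x + length y] @ [0..<length x]) = y @ x"
  by (rule nth_equalityI) (auto simp: nth_append)

definition swapset :: "'s list \<Rightarrow> 's list \<Rightarrow> 'a list set \<Rightarrow> 'a list set" where
  "swapset ss ts S = {y @ x | x y. x \<in> tup ss \<and> y \<in> tup ts \<and> x @ y \<in> S}"

lemma swapset_iff:
  "length x = length ss \<Longrightarrow> y @ x \<in> swapset ss ts S \<longleftrightarrow> x \<in> tup ss \<and> y \<in> tup ts \<and> x @ y \<in> S"
  unfolding swapset_def using tuples_length by fastforce

lemma dfb_swap:
  assumes "dfb A (ss @ ts) S"
  shows "dfb A (ts @ ss) (swapset ss ts S)"
proof -
  let ?idx = "[length ts..<length ts + length ss] @ [0..<length ts]"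
  have *: "map ((!) (y @ x)) ?idx = x @ y" if "x \<in> tup ss" "y \<in> tup ts" for x y
    using nth_swap[of y x] that[THEN tuples_length] by simp
  have "dfb A (ts @ ss) {z \<in> tup (ts @ ss). map ((!) z) ?idx \<in> S}"
    by (rule dfb_reindex[OF assms]) (auto simp only: nth_swap[of ts ss], auto)
  moreover have "{z \<in> tup (ts @ ss). map ((!) z) ?idx \<in> S} = swapset ss ts S"
  proof (intro set_eqI iffI)
    fix z assume z: "z \<in> {z \<in> tup (ts @ ss). map ((!) z) ?idx \<in> S}"
    then obtain y x where "z = y @ x" "y \<in> tup ts" "x \<in> tup ss" by (blast elim: tuples_appendE)
    then show "z \<in> swapset ss ts S" using z * unfolding swapset_def by auto
  next
    fix z assume "z \<in> swapset ss ts S"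
    then show "z \<in> {z \<in> tup (ts @ ss). map ((!) z) ?idx \<in> S}"
      using * by (auto simp: swapset_def tuples_append)
  qed
  ultimately show ?thesis by simp
qed

lemma dfb_Ex_suffix:
  assumes "dfb A (ss @ ts) S"
  shows "dfb A ss {x \<in> tup ss. \<exists>y\<in>tup ts. x @ y \<in> S}"
proof -
  have "{x \<in> tup ss. \<exists>z. z @ x \<in> swapset ss ts S} =
      {x \<in> tup ss. \<exists>y\<in>tup ts. x @ y \<in> S}"
    using swapset_iff[OF tuples_length] by blast
  then show ?thesis using dfb_Ex_prefix[OF dfb_swap[OF assms]] by simp
qed

section \<open>Parameters turned into variables and back\<close>

lemma dfb_inst:
  assumes "dfb A (ss @ ts) S" "c \<in> tup ts"
  shows "dfb (A \<union> set c) ss {x \<in> tup ss. x @ c \<in> S}"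
proof -
  from assms(1) obtain \<phi> b where 1: "set b \<subseteq> A" "wf_fm L ((ss @ ts) @ map (sort_of M) b) \<phi>"
    "S = {x \<in> tup (ss @ ts). sat M \<phi> (x @ b)}" by (rule dfbE)
  have "{x \<in> tup ss. x @ c \<in> S} = {x \<in> tup ss. sat M \<phi> (x @ c @ b)}"
    using 1(3) assms(2) by (auto simp: tuples_append)
  then show ?thesis by (rule dfbI) (use 1 tuples_sorts[OF assms(2)] in \<open>auto simp: pfms_def\<close>)
qed

lemma dfb_inst_prefix:
  assumes "dfb A (ts @ ss) S" "c \<in> tup ts"
  shows "dfb (A \<union> set c) ss {x \<in> tup ss. c @ x \<in> S}"
proof -
  have "{x \<in> tup ss. x @ c \<in> swapset ts ss S} =
      {x \<in> tup ss. c @ x \<in> S}"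
    using assms(2) swapset_iff[OF tuples_length] by blast
  then show ?thesis using dfb_inst[OF dfb_swap[OF assms(1)] assms(2)] by simp
qed

text \<open>All of \<open>c\<close> is turned into variables at once, whether or not an entry occurs
  in the formula, so that other tuples of the same sorts can later be put in its place.\<close>

lemma dfb_abs:
  assumes "dfb (A \<union> set c) ss S" "c \<in> tup ts"
  obtains R where "dfb A (ss @ ts) R" "S = {x \<in> tup ss. x @ c \<in> R}"
proof -
  from assms(1) obtain \<phi> b where 1: "set b \<subseteq> A \<union> set c" "wf_fm L (ss @ map (sort_of M) b) \<phi>"
    "S = {x \<in> tup ss. sat M \<phi> (x @ b)}" by (rule dfbE)
  define b' where "b' = filter (\<lambda>y. y \<in> A) b"
  have "set b \<subseteq> set (c @ b')" using 1(1) by (auto simp: b'_def)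
  then have "\<forall>i<length b. \<exists>j<length (c @ b'). (c @ b') ! j = b ! i"
    by (metis in_set_conv_nth subsetD)
  \<comment> \<open>A parameter that lies both in \<open>A\<close> and in \<open>c\<close> could be
    read at either place; \<open>g\<close> picks one occurrence.\<close>
  then obtain g where g: "\<And>i. i < length b \<Longrightarrow> g i < length (c @ b') \<and> (c @ b') ! g i = b ! i"
    by metis
  let ?f = "\<lambda>i. if i < length ss then i else length ss + g (i - length ss)"
  have ts: "ts = map (sort_of M) c" using tuples_sorts[OF assms(2)] by simp
  let ?\<phi> = "rename ?f \<phi>"
  have 2: "wf_fm L (ss @ map (sort_of M) (c @ b')) ?\<phi>"
  proof (rule wf_rename[OF 1(2)])
    fix i assume i: "i < length (ss @ map (sort_of M) b)"
    show "?f i < length (ss @ map (sort_of M) (c @ b')) \<and>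
        (ss @ map (sort_of M) (c @ b')) ! ?f i = (ss @ map (sort_of M) b) ! i"
    proof (cases "i < length ss")
      case False
      then have "i - length ss < length b" using i by auto
      with g[OF this] False show ?thesis by (simp add: nth_append del: map_append flip: map_append)
    qed (auto simp: nth_append)
  qed
  have *: "sat M ?\<phi> (x @ c @ b') \<longleftrightarrow> sat M \<phi> (x @ b)" if "x \<in> tup ss" for x
    using tuples_length[OF that] g by (intro sat_rename[OF 1(2)]) (auto simp: nth_append)
  let ?R = "{z \<in> tup (ss @ ts). sat M ?\<phi> (z @ b')}"
  have "dfb A (ss @ ts) ?R" by (rule dfbI[OF refl]) (use 2 ts in \<open>auto simp: pfms_def b'_def\<close>)
  moreover have "S = {x \<in> tup ss. x @ c \<in> ?R}"
    using 1(3) * assms(2) by (auto simp: tuples_append)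
  ultimately show ?thesis using that by blast
qed

lemma dfb_abs_prefix:
  assumes "dfb (A \<union> set c) ss S" "c \<in> tup ts"
  obtains R where "dfb A (ts @ ss) R" "S = {x \<in> tup ss. c @ x \<in> R}"
proof -
  obtain R where R: "dfb A (ss @ ts) R" "S = {x \<in> tup ss. x @ c \<in> R}" using dfb_abs[OF assms] .
  have "S = {x \<in> tup ss. c @ x \<in> swapset ss ts R}"
    unfolding R(2) using assms(2) swapset_iff[OF tuples_length] by blast
  then show ?thesis using that dfb_swap[OF R(1)] by blast
qed

lemma dfb_finite:
  assumes "dfb A ss S" obtains c where "set c \<subseteq> A" "dfb (set c) ss S"
  using assms by (force simp: dfb_def pfms_def)

lemma tuples_one: "tuples M [s] = {[d] | d. d \<in> univ M \<and> sort_of M d = s}"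
  by (intro set_eqI) (simp add: tuples_Cons)

lemma dfb_singleton: "d \<in> univ M \<Longrightarrow> dfb {d} [sort_of M d] {[d]}"
proof -
  assume d: "d \<in> univ M"
  have "{[d]} = {x \<in> tup [sort_of M d]. sat M (Eq (Var 0) (Var 1)) (x @ [d])}"
    using d by (auto simp: tuples_one)
  then show ?thesis by (rule dfbI) (simp add: pfms_def)
qed

section \<open>Definable closure\<close>

lemma dcl_iff: "d \<in> dcl L M A \<longleftrightarrow> d \<in> univ M \<and> dfb A [sort_of M d] {[d]}"
proof -
  have "(\<forall>x\<in>univ M. sort_of M x = sort_of M d \<longrightarrow> (holds M \<psi> [x] \<longleftrightarrow> x = d)) \<longleftrightarrow>
      {[d]} = dset [sort_of M d] \<psi>" if "d \<in> univ M" for \<psi>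
  proof -
    have "dset [sort_of M d] \<psi> =
        (\<lambda>x. [x]) ` {x \<in> univ M. sort_of M x = sort_of M d \<and> holds M \<psi> [x]}"
      by (auto simp: dset_def tuples_one)
    also have "{[d]} = \<dots> \<longleftrightarrow>
        {d} = {x \<in> univ M. sort_of M x = sort_of M d \<and> holds M \<psi> [x]}"
      using inj_image_eq_iff[of "\<lambda>x. [x]" "{d}"] by (simp add: inj_def)
    finally show ?thesis using that by (auto simp: set_eq_iff)
  qed
  then show ?thesis unfolding dcl_def dfb_def by auto
qed

lemma dcl_univ: "dcl L M A \<subseteq> univ M"
  by (auto simp: dcl_iff)

lemma dcl_mono: "A \<subseteq> A' \<Longrightarrow> dcl L M A \<subseteq> dcl L M A'"
  by (auto simp: dcl_iff dfb_mono)

lemma dcl_incl: "A \<subseteq> univ M \<Longrightarrow> A \<subseteq> dcl L M A"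
  using dfb_mono[OF dfb_singleton] by (fastforce simp: dcl_iff)

text \<open>The parameter \<open>d\<close> is replaced by a quantified variable confined to
  \<open>{[d]}\<close>, which is definable over \<open>A\<close>.\<close>

lemma dfb_dcl_one:
  assumes "dfb (insert d A) ss S" "d \<in> dcl L M A" shows "dfb A ss S"
proof -
  have d: "d \<in> univ M" "dfb A [sort_of M d] {[d]}" using assms(2) dcl_iff by auto
  then have dt: "[d] \<in> tup [sort_of M d]" by (auto simp: tuples_Cons)
  have "dfb (A \<union> set [d]) ss S" using assms(1) by simp
  then obtain R where R: "dfb A ([sort_of M d] @ ss) R" "S = {x \<in> tup ss. [d] @ x \<in> R}"
    using dt by (rule dfb_abs_prefix)
  have "dfb A ([sort_of M d] @ ss) {x \<in> tup ([sort_of M d] @ ss). map ((!) x) [0] \<in> {[d]}}"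
    by (rule dfb_reindex[OF d(2)]) auto
  from dfb_Ex_prefix[OF dfb_Int[OF this R(1)]]
  have "dfb A ss {x \<in> tup ss. \<exists>y. y @ x \<in> {x \<in> tup ([sort_of M d] @ ss). map ((!) x) [0] \<in> {[d]}} \<inter> R}" .
  moreover have "{x \<in> tup ss. \<exists>y. y @ x \<in> {x \<in> tup ([sort_of M d] @ ss). map ((!) x) [0] \<in> {[d]}} \<inter> R} = S"
  proof (intro set_eqI iffI)
    fix x assume "x \<in> {x \<in> tup ss. \<exists>y. y @ x \<in> {x \<in> tup ([sort_of M d] @ ss). map ((!) x) [0] \<in> {[d]}} \<inter> R}"
    then obtain y where y: "x \<in> tup ss" "y @ x \<in> tup (sort_of M d # ss)" "(y @ x) ! 0 = d" "y @ x \<in> R"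
      by auto
    then have "length y = 1"
      using tuples_length[of "y @ x" M "sort_of M d # ss"] tuples_length[of x M ss] by simp
    then have "y = [d]" using y by (auto simp: length_Suc_conv)
    then show "x \<in> S" using y R by auto
  next
    fix x assume "x \<in> S"
    then show "x \<in> {x \<in> tup ss. \<exists>y. y @ x \<in> {x \<in> tup ([sort_of M d] @ ss). map ((!) x) [0] \<in> {[d]}} \<inter> R}"
      using R d by (auto simp: tuples_Cons intro!: exI[of _ "[d]"])
  qed
  ultimately show ?thesis by simp
qed

lemma dfb_dcl: 
  assumes "dfb (dcl L M A) ss S" shows "dfb A ss S"
proof -
  obtain c where c: "set c \<subseteq> dcl L M A" "dfb (set c) ss S" using dfb_finite[OF assms] .
  have "dfb (set c' \<union> A) ss S \<Longrightarrow> set c' \<subseteq> dcl L M A \<Longrightarrow> dfb A ss S" for c'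
  proof (induction c')
    case (Cons d c')
    have "d \<in> dcl L M (set c' \<union> A)" using Cons dcl_mono[of A "set c' \<union> A"] by auto
    then have "dfb (set c' \<union> A) ss S" using dfb_dcl_one[of d "set c' \<union> A"] Cons by simp
    then show ?case using Cons by simp
  qed simp
  then show ?thesis using c dfb_mono[OF c(2)] by blast
qed

lemma dcl_dcl: "A \<subseteq> univ M \<Longrightarrow> dcl L M (dcl L M A) = dcl L M A"
  using dfb_dcl dfb_mono[OF _ dcl_incl] unfolding set_eq_iff dcl_iff by blast

section \<open>Equality of types\<close>

definition eqt :: "'a set \<Rightarrow> 's list \<Rightarrow> 'a list \<Rightarrow> 'a list \<Rightarrow> bool" where
  "eqt A ss a b \<longleftrightarrow> a \<in> tup ss \<and> b \<in> tup ss \<and> (\<forall>S. dfb A ss S \<longrightarrow> (a \<in> S \<longleftrightarrow> b \<in> S))"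

lemma eqt_iff_tp:
  assumes "a \<in> tup ss" "b \<in> tup ss"
  shows "eqt A ss a b \<longleftrightarrow> tp L M a A = tp L M b A"
proof -
  have *: "map (sort_of M) a = ss" "map (sort_of M) b = ss" using assms tuples_sorts by auto
  have "tp L M a A = tp L M b A \<longleftrightarrow> (\<forall>\<psi>\<in>pfms L M ss A. holds M \<psi> a \<longleftrightarrow> holds M \<psi> b)"
    unfolding tp_def * by auto
  also have "\<dots> \<longleftrightarrow> (\<forall>\<psi>\<in>pfms L M ss A. a \<in> dset ss \<psi> \<longleftrightarrow> b \<in> dset ss \<psi>)"
    using assms by (auto simp: dset_def)
  finally show ?thesis using assms by (auto simp: eqt_def dfb_def)
qed

lemma eqtD: "eqt A ss a b \<Longrightarrow> dfb A ss S \<Longrightarrow> a \<in> S \<longleftrightarrow> b \<in> S"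
  by (auto simp: eqt_def)

lemma eqtI:
  assumes "a \<in> tup ss" "b \<in> tup ss" "\<And>S. dfb A ss S \<Longrightarrow> a \<in> S \<Longrightarrow> b \<in> S"
  shows "eqt A ss a b"
proof -
  have "a \<in> S" if "dfb A ss S" "b \<in> S" for S
    using assms(3)[OF dfb_Compl[OF that(1)]] that(2) assms(1) by auto
  then show ?thesis using assms by (auto simp: eqt_def)
qed

lemma eqt_tup: "eqt A ss a b \<Longrightarrow> a \<in> tup ss" "eqt A ss a b \<Longrightarrow> b \<in> tup ss"
  by (auto simp: eqt_def)

lemma eqt_refl: "a \<in> tup ss \<Longrightarrow> eqt A ss a a"
  by (auto simp: eqt_def)

lemma eqt_sym: "eqt A ss a b \<Longrightarrow> eqt A ss b a"
  by (auto simp: eqt_def)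

lemma eqt_trans: "eqt A ss a b \<Longrightarrow> eqt A ss b c \<Longrightarrow> eqt A ss a c"
  by (auto simp: eqt_def)

lemma eqt_mono: "eqt A ss a b \<Longrightarrow> A' \<subseteq> A \<Longrightarrow> eqt A' ss a b"
  by (auto simp: eqt_def dest: dfb_mono)

lemma eqt_dcl: "eqt A ss a b \<Longrightarrow> A' \<subseteq> dcl L M A \<Longrightarrow> eqt A' ss a b"
  by (meson dfb_dcl dfb_mono eqt_def)

lemma eqt_inst:
  assumes "eqt A (ss @ ts) (a @ c) (b @ c)" "length a = length ss" "length b = length ss"
  shows "eqt (A \<union> set c) ss a b"
proof -
  have c: "c \<in> tup ts" "a \<in> tup ss" "b \<in> tup ss"
    using assms tuples_append_iff eqt_tup by (metis)+
  then show ?thesis unfolding eqt_def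
  proof (intro conjI allI impI)
    fix S assume "dfb (A \<union> set c) ss S"
    then obtain R where "dfb A (ss @ ts) R" "S = {x \<in> tup ss. x @ c \<in> R}"
      using c(1) by (rule dfb_abs)
    then show "a \<in> S \<longleftrightarrow> b \<in> S" using eqtD[OF assms(1)] c by auto
  qed
qed

lemma eqt_abs:
  assumes "eqt (A \<union> set c) ss a b" "c \<in> tup ts"
  shows "eqt A (ss @ ts) (a @ c) (b @ c)"
  unfolding eqt_def
proof (intro conjI allI impI)
  fix S assume "dfb A (ss @ ts) S"
  from eqtD[OF assms(1) dfb_inst[OF this assms(2)]] show "a @ c \<in> S \<longleftrightarrow> b @ c \<in> S"
    using eqt_tup[OF assms(1)] by auto
qed (use eqt_tup[OF assms(1)] assms(2) tuples_append in blast)+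

lemma eqt_reindex:
  assumes "eqt A \<Delta> a b" "\<And>i. i \<in> set idx \<Longrightarrow> i < length \<Delta>" "map ((!) \<Delta>) idx = \<Gamma>"
  shows "eqt A \<Gamma> (map ((!) a) idx) (map ((!) b) idx)"
proof -
  have t: "map ((!) x) idx \<in> tup \<Gamma>" if "x \<in> tup \<Delta>" for x
  proof -
    have "length x = length \<Delta>" using that tuples_length by auto
    moreover have "map (sort_of M) x = \<Delta>" "set x \<subseteq> univ M" using that by (auto simp: tuples_def)
    ultimately show ?thesis using assms(2,3) unfolding tuples_def by fastforce
  qed
  show ?thesis unfolding eqt_def
  proof (intro conjI allI impI)
    fix S assume "dfb A \<Gamma> S"
    from eqtD[OF assms(1) dfb_reindex[OF this assms(2,3)]]
    show "map ((!) a) idx \<in> S \<longleftrightarrow> map ((!) b) idx \<in> S" using eqt_tup[OF assms(1)] by auto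
  qed (use t eqt_tup[OF assms(1)] in auto)
qed

lemma eqt_swap:
  assumes "eqt A (ss @ ts) (a @ c) (b @ d)" "length a = length ss" "length b = length ss"
  shows "eqt A (ts @ ss) (c @ a) (d @ b)"
proof -
  have l: "length c = length ts" "length d = length ts"
    using eqt_tup[OF assms(1)] assms(2,3) tuples_length by fastforce+
  have "eqt A (ts @ ss)
     (map ((!) (a @ c)) ([length ss..<length ss + length ts] @ [0..<length ss]))
     (map ((!) (b @ d)) ([length ss..<length ss + length ts] @ [0..<length ss]))"
    using nth_swap[of ss ts] by (intro eqt_reindex[OF assms(1)]) auto
  then show ?thesis using nth_swap[of a c] nth_swap[of b d] l assms by simp
qed

lemma nth_prefix: "map ((!) (x @ y)) [0..<length x] = x"
  by (rule nth_equalityI) (auto simp: nth_append)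

lemma eqt_prefix:
  assumes "eqt A (ss @ ts) (a @ c) (b @ d)" "length a = length ss" "length b = length ss"
  shows "eqt A ss a b"
proof -
  have "eqt A ss (map ((!) (a @ c)) [0..<length ss]) (map ((!) (b @ d)) [0..<length ss])"
    using nth_prefix[of ss ts] by (intro eqt_reindex[OF assms(1)]) auto
  then show ?thesis using nth_prefix[of a c] nth_prefix[of b d] assms by simp
qed

lemma eqt_suffix:
  assumes "eqt A (ss @ ts) (a @ c) (b @ d)" "length a = length ss" "length b = length ss"
  shows "eqt A ts c d"
proof -
  have "length c = length ts" "length d = length ts"
    using eqt_tup[OF assms(1)] assms(2,3) tuples_length by fastforce+
  then show ?thesis using eqt_prefix[OF eqt_swap[OF assms]] by simp
qed

end

section \<open>Saturation\<close>

text \<open>The inequality in \<open>small_nat\<close> is strict, so \<kappa> is uncountable. Hence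
  the entries of an entire \<open>nat\<close>-indexed sequence of tuples form a small set and may
  serve as parameters of a realised type.\<close>

locale big_card =
  fixes \<kappa> :: "'k rel"
  assumes card: "Card_order \<kappa>" and small_nat: "small \<kappa> (UNIV :: nat set)"
begin

lemma infinite_Field: "infinite (Field \<kappa>)"
proof
  assume "finite (Field \<kappa>)"
  moreover have "|UNIV :: nat set| \<le>o |Field \<kappa>|"
    using small_nat card card_of_Field_ordIso ordIso_symmetric ordLess_imp_ordLeq ordLeq_ordIso_trans
    unfolding small_def by blast
  ultimately show False using card_of_ordLeq_finite infinite_UNIV_nat by blast
qed

lemma small_subset: "small \<kappa> A \<Longrightarrow> A' \<subseteq> A \<Longrightarrow> small \<kappa> A'"
  unfolding small_def using card_of_mono1 ordLeq_ordLess_trans by blast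

lemma small_Un: "small \<kappa> A \<Longrightarrow> small \<kappa> A' \<Longrightarrow> small \<kappa> (A \<union> A')"
  unfolding small_def using card_of_Un_ordLess_infinite_Field[OF infinite_Field card] by blast

lemma small_image: "small \<kappa> A \<Longrightarrow> small \<kappa> (f ` A)"
  unfolding small_def using card_of_image ordLeq_ordLess_trans by blast

lemma small_nat_UN: "small \<kappa> (\<Union>n::nat. set (a n))"
proof -
  have "|UNIV :: (nat \<times> nat) set| \<le>o |UNIV :: nat set|"
    using card_of_Times_same_infinite[OF infinite_UNIV_nat]
    by (simp add: ordIso_imp_ordLeq)
  then have "small \<kappa> (UNIV :: (nat \<times> nat) set)"
    using small_nat ordLeq_ordLess_trans unfolding small_def by blast
  from small_image[OF this, of "\<lambda>(n, i). a n ! i"]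
  show ?thesis
  proof (rule small_subset, intro subsetI)
    fix x assume "x \<in> (\<Union>n. set (a n))"
    then obtain n i where "x = a n ! i" by (auto simp: in_set_conv_nth)
    then show "x \<in> range (\<lambda>(n, i). a n ! i)" by (intro image_eqI[of _ _ "(n, i)"]) auto
  qed
qed

lemma small_set: "small \<kappa> (set c)"
  using small_subset[OF small_nat_UN[of "\<lambda>n. c"]] by auto

end

locale sstruc = mstruc L M + big_card \<kappa>
  for L :: "('s, 'f, 'r) lang" and M :: "('a, 's, 'f, 'r) struc" and \<kappa> :: "'k rel" +
  assumes sat: "saturated L M \<kappa>"
begin

text \<open>Saturation restated for families of definable sets. The type to be realised consists of
  all formulas over \<open>A\<close> that define a member of \<open>F\<close>, which avoids choosing
  a formula for each member.\<close>

lemma sat_fip: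
  assumes "A \<subseteq> univ M" "small \<kappa> A" "\<And>S. S \<in> F \<Longrightarrow> dfb A ss S"
    "\<And>G. finite G \<Longrightarrow> G \<subseteq> F \<Longrightarrow> \<exists>x\<in>tup ss. \<forall>S\<in>G. x \<in> S"
  shows "\<exists>x\<in>tup ss. \<forall>S\<in>F. x \<in> S"
proof -
  let ?p = "{\<psi> \<in> pfms L M ss A. dset ss \<psi> \<in> F}"
  have "fin_sat M ss ?p" unfolding fin_sat_def
  proof (intro allI impI)
    fix q assume "finite q \<and> q \<subseteq> ?p"
    then have "finite (dset ss ` q)" "dset ss ` q \<subseteq> F" by auto
    from assms(4)[OF this] show "\<exists>a. realises M ss a q"
      by (auto simp: realises_def dset_def)
  qed
  then obtain x where "realises M ss x ?p"
    using sat assms(1,2) unfolding saturated_def by (metis (no_types, lifting) mem_Collect_eq subsetI)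
  then have x: "x \<in> tup ss" "\<And>\<psi>. \<psi> \<in> pfms L M ss A \<Longrightarrow> dset ss \<psi> \<in> F \<Longrightarrow> x \<in> dset ss \<psi>"
    by (auto simp: realises_def dset_def)
  then have "x \<in> S" if "S \<in> F" for S
    using assms(3)[OF that] that unfolding dfb_def by blast
  then show ?thesis using x(1) by blast
qed

text \<open>The type of \<open>c\<close> over \<open>A\<close> and \<open>a\<close> is transported
  to \<open>b\<close>. A finite part of it is a single definable set of pairs; its projection
  contains \<open>a\<close>, hence also \<open>b\<close>.\<close>

lemma homog:
  assumes A: "A \<subseteq> univ M" "small \<kappa> A" and ab: "eqt A ss a b" and c: "c \<in> tup ts"
  obtains d where "d \<in> tup ts" "eqt A (ss @ ts) (a @ c) (b @ d)"
proof -
  let ?F = "{{y \<in> tup ts. b @ y \<in> S} | S. dfb A (ss @ ts) S \<and> a @ c \<in> S}"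
  have b: "b \<in> tup ss" "a \<in> tup ss" using ab eqt_tup by auto
  have "\<exists>x\<in>tup ts. \<forall>S\<in>?F. x \<in> S"
  proof (rule sat_fip)
    show "A \<union> set b \<subseteq> univ M" "small \<kappa> (A \<union> set b)"
      using A b small_Un small_set tuples_set by blast+
    show "dfb (A \<union> set b) ts S" if "S \<in> ?F" for S
      using that dfb_inst_prefix[OF _ b(1)] by blast
    fix G assume G: "finite G" "G \<subseteq> ?F"
    then have "\<forall>V\<in>G. \<exists>S. dfb A (ss @ ts) S \<and> a @ c \<in> S \<and> V = {y \<in> tup ts. b @ y \<in> S}" by blast
    then obtain h where h: "\<And>V. V \<in> G \<Longrightarrow>
        dfb A (ss @ ts) (h V) \<and> a @ c \<in> h V \<and> V = {y \<in> tup ts. b @ y \<in> h V}"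
      by metis
    let ?S = "{x \<in> tup (ss @ ts). \<forall>S\<in>h ` G. x \<in> S}"
    have S: "dfb A (ss @ ts) ?S" using G h by (intro dfb_INT) auto
    have "a @ c \<in> ?S" using h b c tuples_append by auto
    then have "a \<in> {x \<in> tup ss. \<exists>y\<in>tup ts. x @ y \<in> ?S}" using b c by blast
    then have "b \<in> {x \<in> tup ss. \<exists>y\<in>tup ts. x @ y \<in> ?S}" using eqtD[OF ab dfb_Ex_suffix[OF S]] by blast
    then obtain y where "y \<in> tup ts" "b @ y \<in> ?S" by blast
    then have "\<forall>V\<in>G. y \<in> V" using h by fastforce
    then show "\<exists>x\<in>tup ts. \<forall>S\<in>G. x \<in> S" using \<open>y \<in> tup ts\<close> by blast
  qed
  then obtain d where d0: "d \<in> tup ts" "\<forall>S\<in>?F. d \<in> S" by (elim bexE)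
  have d: "d \<in> tup ts" "b @ d \<in> S" if "dfb A (ss @ ts) S" "a @ c \<in> S" for S
  proof -
    have "{y \<in> tup ts. b @ y \<in> S} \<in> ?F" using that by blast
    with d0(2) have "d \<in> {y \<in> tup ts. b @ y \<in> S}" by (rule bspec)
    then show "b @ d \<in> S" by simp
  qed (rule d0(1))
  have "a @ c \<in> tup (ss @ ts)" "b @ d \<in> tup (ss @ ts)" using b c d0 tuples_append by auto
  then have "eqt A (ss @ ts) (a @ c) (b @ d)"
    by (intro eqtI) (use d in auto)
  then show ?thesis using d0(1) that by blast
qed

lemma compactness:
  assumes "A \<subseteq> univ M" "small \<kappa> A" "\<And>S. S \<in> F \<Longrightarrow> dfb A ss S"
    "\<And>x. x \<in> tup ss \<Longrightarrow> \<exists>S\<in>F. x \<notin> S"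
  obtains G where "finite G" "G \<subseteq> F" "{x \<in> tup ss. \<forall>S\<in>G. x \<in> S} = {}"
proof -
  have "\<not> (\<exists>x\<in>tup ss. \<forall>S\<in>F. x \<in> S)" using assms(4) by fast
  then have "\<exists>G. finite G \<and> G \<subseteq> F \<and> \<not> (\<exists>x\<in>tup ss. \<forall>S\<in>G. x \<in> S)"
  proof (rule contrapos_np)
    assume none: "\<not> (\<exists>G. finite G \<and> G \<subseteq> F \<and> \<not> (\<exists>x\<in>tup ss. \<forall>S\<in>G. x \<in> S))"
    show "\<exists>x\<in>tup ss. \<forall>S\<in>F. x \<in> S"
    proof (rule sat_fip[OF assms(1,2,3)])
      fix G assume "finite G" "G \<subseteq> F"
      then show "\<exists>x\<in>tup ss. \<forall>S\<in>G. x \<in> S" using none by metis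
    qed
  qed
  then obtain G where "finite G" "G \<subseteq> F" "\<not> (\<exists>x\<in>tup ss. \<forall>S\<in>G. x \<in> S)" by (elim exE conjE)
  then show ?thesis by (intro that[of G]) auto
qed

text \<open>\<open>M\<close> is not assumed to be homogeneous, so invariance under automorphisms is expressed
  through equality of types.\<close>

lemma dfb_invariant:
  assumes S: "dfb (univ M) ss S" and A: "A \<subseteq> univ M" "small \<kappa> A"
    and inv: "\<And>x y. eqt A ss x y \<Longrightarrow> x \<in> S \<Longrightarrow> y \<in> S"
  shows "dfb A ss S"
proof -
  obtain c where c: "set c \<subseteq> univ M" "dfb (set c) ss S" using dfb_finite[OF S] .
  have B: "A \<union> set c \<subseteq> univ M" "small \<kappa> (A \<union> set c)"
    using A c by (auto intro: small_Un small_set)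
  have Sd: "dfb (A \<union> set c) ss S" using dfb_mono[OF c(2)] by auto
  \<comment> \<open>Otherwise the type of \<open>y\<close> over \<open>A\<close> would be realised
    outside \<open>S\<close>, against invariance. So each point of \<open>S\<close> has a
    neighbourhood inside \<open>S\<close> that is definable over \<open>A\<close>.\<close>
  have nb: "\<exists>V. dfb A ss V \<and> y \<in> V \<and> V \<subseteq> S" if y: "y \<in> S" for y
  proof (rule ccontr)
    assume none: "\<not> ?thesis"
    let ?F = "insert (tup ss - S) {V. dfb A ss V \<and> y \<in> V}"
    have yt: "y \<in> tup ss" using y dfb_sub[OF S] by auto
    have "\<exists>x\<in>tup ss. \<forall>V\<in>?F. x \<in> V"
    proof (rule sat_fip[OF B])
      show "dfb (A \<union> set c) ss V" if "V \<in> ?F" for V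
        using that dfb_Compl[OF Sd] dfb_mono[of A ss V "A \<union> set c"] by auto
      fix G assume G: "finite G" "G \<subseteq> ?F"
      define V where "V = {x \<in> tup ss. \<forall>V\<in>G - {tup ss - S}. x \<in> V}"
      have "dfb A ss V" unfolding V_def using G by (intro dfb_INT) auto
      moreover have "y \<in> V" using G yt by (auto simp: V_def)
      ultimately obtain x where "x \<in> V" "x \<notin> S" using none by blast
      then show "\<exists>x\<in>tup ss. \<forall>S\<in>G. x \<in> S" unfolding V_def by (intro bexI[of _ x]) auto
    qed
    then obtain z where z0: "z \<in> tup ss" "\<forall>V\<in>?F. z \<in> V" by (elim bexE)
    have z: "z \<notin> S" using z0(2) by simp
    have "z \<in> V" if "dfb A ss V" "y \<in> V" for V
      using z0(2) that by simp
    then have "eqt A ss y z" using yt z0(1) by (intro eqtI)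
    then show False using inv y z by blast
  qed
  \<comment> \<open>A second use of compactness: finitely many of these neighbourhoods cover
    \<open>S\<close>.\<close>
  let ?F = "insert S {tup ss - V | V. dfb A ss V \<and> V \<subseteq> S}"
  obtain G where G: "finite G" "G \<subseteq> ?F" "{x \<in> tup ss. \<forall>S\<in>G. x \<in> S} = {}"
  proof (rule compactness[OF B, of ?F ss])
    show "dfb (A \<union> set c) ss V" if "V \<in> ?F" for V
      using that Sd dfb_Compl dfb_mono[of A ss _ "A \<union> set c"] by auto
    show "\<exists>V\<in>?F. x \<notin> V" if "x \<in> tup ss" for x
    proof (cases "x \<in> S")
      case True
      then obtain V where V: "dfb A ss V" "x \<in> V" "V \<subseteq> S" using nb by metis
      then have "tup ss - V \<in> ?F" "x \<notin> tup ss - V" by auto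
      then show ?thesis by (intro bexI[of _ "tup ss - V"])
    qed simp
  qed simp
  let ?W = "{V \<in> (\<lambda>X. tup ss - X) ` G. dfb A ss V \<and> V \<subseteq> S}"
  have "x \<in> \<Union>?W" if x: "x \<in> S" for x
  proof (rule ccontr)
    assume no: "x \<notin> \<Union>?W"
    have xt: "x \<in> tup ss" using x dfb_sub[OF S] by auto
    have "x \<in> X" if X: "X \<in> G" for X
    proof (cases "X = S")
      case False
      then obtain V where V: "X = tup ss - V" "dfb A ss V" "V \<subseteq> S" using G X by auto
      then have "tup ss - X = V" using dfb_sub by blast
      then have "V \<in> ?W" using V X by auto
      then show ?thesis using no V xt by auto
    qed (use x in auto)
    then show False using G(3) xt by blast
  qed
  then have "S = \<Union>?W" by auto
  moreover have "dfb A ss (\<Union>?W)" using G(1) by (intro dfb_UN) auto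
  ultimately show ?thesis by simp
qed

end

section \<open>Global types and Morley sequences\<close>

locale stab = sstruc L M \<kappa>
  for L :: "('s, 'f, 'r) lang" and M :: "('a, 's, 'f, 'r) struc" and \<kappa> :: "'k rel" +
  assumes stable: "wf_fm L (xs @ ys) \<phi> \<Longrightarrow> \<not> order_property M xs ys \<phi>"
begin

text \<open>Stability speaks of formulas without parameters. The parameters of \<open>R\<close> are
  appended to every \<open>b j\<close> and so become part of the second block of variables.\<close>

lemma no_order:
  assumes "dfb A (xs @ ys) R" "A \<subseteq> univ M"
    and ab: "\<And>i::nat. a i \<in> tup xs" "\<And>i::nat. b i \<in> tup ys"
    and ord: "\<And>i j. a i @ b j \<in> R \<longleftrightarrow> i < j"
  shows False
proof -
  obtain \<phi> c where 1: "set c \<subseteq> A" "wf_fm L ((xs @ ys) @ map (sort_of M) c) \<phi>"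
    "R = {x \<in> tup (xs @ ys). sat M \<phi> (x @ c)}" using assms(1) by (rule dfbE)
  have c: "c \<in> tup (map (sort_of M) c)" using 1(1) assms(2) by (intro tuplesI) auto
  have "sat M \<phi> (a i @ b j @ c) \<longleftrightarrow> i < j" for i j
    using ord[of i j] 1(3) tuples_append[OF ab(1)[of i] ab(2)[of j]] by auto
  then have "order_property M xs (ys @ map (sort_of M) c) \<phi>"
    unfolding order_property_def using ab c
    by (intro exI[of _ a] exI[of _ "\<lambda>j. b j @ c"]) (simp add: tuples_append)
  then show False using stable 1(2) by simp
qed

end

section \<open>Segments and blocks of sequences of tuples\<close>

definition seg :: "(nat \<Rightarrow> 'a list) \<Rightarrow> nat \<Rightarrow> nat \<Rightarrow> 'a list" where
  "seg a i j = concat (map a [i..<j])"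

text \<open>Cutting a Morley sequence of \<open>P\<close> into blocks of \<open>m\<close> members
  gives in effect a Morley sequence of the \<open>m\<close>-th power of \<open>P\<close>. For
  \<open>m = 0\<close> every block is empty.\<close>

definition blk :: "nat \<Rightarrow> (nat \<Rightarrow> 'a list) \<Rightarrow> nat \<Rightarrow> 'a list" where
  "blk m a j = seg a (j * m) (j * m + m)"

definition rep :: "'s list \<Rightarrow> nat \<Rightarrow> 's list" where
  "rep ss n = concat (replicate n ss)"

lemma seg_append: "i \<le> j \<Longrightarrow> j \<le> k \<Longrightarrow> seg a i k = seg a i j @ seg a j k"
  unfolding seg_def using upt_add_eq_append[of i j "k - j"] by simp

lemma seg_Suc: "i \<le> j \<Longrightarrow> seg a i (Suc j) = seg a i j @ a j"
  by (simp add: seg_def)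

lemma seg_self [simp]: "seg a i i = []"
  by (simp add: seg_def)

lemma set_seg: "set (seg a i j) = (\<Union>k\<in>{i..<j}. set (a k))"
  by (auto simp: seg_def)

lemma seg_cong: "(\<And>r. r < n \<Longrightarrow> a (i + r) = b (j + r)) \<Longrightarrow> seg a i (i + n) = seg b j (j + n)"
  unfolding seg_def by (rule arg_cong[where f = concat], rule nth_equalityI) auto

lemma rep_0 [simp]: "rep ss 0 = []"
  by (simp add: rep_def)

lemma rep_Suc: "rep ss (Suc n) = rep ss n @ ss"
  by (simp add: rep_def flip: replicate_append_same)

lemma rep_Suc': "rep ss (Suc n) = ss @ rep ss n"
  by (simp add: rep_def)

lemma rep_add: "rep ss (n + m) = rep ss n @ rep ss m"
  by (simp add: rep_def replicate_add)

context mstruc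
begin

lemma tup_seg: "(\<And>k. i \<le> k \<Longrightarrow> k < i + n \<Longrightarrow> a k \<in> tup ss) \<Longrightarrow> seg a i (i + n) \<in> tup (rep ss n)"
  by (induction n) (auto simp: seg_Suc rep_Suc tuples_append)

lemma eqt_drop_middle:
  assumes "eqt A (xs @ ys @ zs) (x @ y @ z) (x' @ y' @ z')"
    "length x = length xs" "length x' = length xs" "length y = length ys" "length y' = length ys"
  shows "eqt A (xs @ zs) (x @ z) (x' @ z')"
proof -
  have "eqt A ((ys @ zs) @ xs) ((y @ z) @ x) ((y' @ z') @ x')"
    using eqt_swap[OF assms(1)] assms by simp
  then have "eqt A (ys @ zs @ xs) (y @ z @ x) (y' @ z' @ x')" by simp
  then have *: "eqt A (zs @ xs) (z @ x) (z' @ x')" using eqt_suffix assms by blast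
  have "length (z @ x) = length (zs @ xs)" "length (z' @ x') = length (zs @ xs)"
    using eqt_tup[OF *] tuples_length by blast+
  then show ?thesis using eqt_swap[OF *] assms by simp
qed

end

text \<open>A global type is represented by the set \<open>P\<close> of all definable sets which it contains;
  \<open>rz A x\<close> says that \<open>x\<close> realises its restriction to \<open>A\<close>, and \<open>mor A n a\<close> that \<open>a 0, \<dots>, a (n - 1)\<close> is
  a Morley sequence of it over \<open>A\<close>.\<close>

definition (in mstruc) gtype :: "'s list \<Rightarrow> 'a list set set \<Rightarrow> bool" where
  "gtype ss P \<longleftrightarrow> (\<forall>S\<in>P. dfb (univ M) ss S) \<and> {} \<notin> P \<and> (\<forall>S\<in>P. \<forall>S'\<in>P. S \<inter> S' \<in> P) \<and>
     (\<forall>S. dfb (univ M) ss S \<longrightarrow> S \<in> P \<or> tup ss - S \<in> P)"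

locale gty = stab L M \<kappa>
  for L :: "('s, 'f, 'r) lang" and M :: "('a, 's, 'f, 'r) struc" and \<kappa> :: "'k rel" +
  fixes ss :: "'s list" and P :: "'a list set set"
  assumes gt: "gtype ss P"
begin

text \<open>The usual invariance of a global type over \<open>A\<close>, with parameters of equal
  type instead of automorphisms. The variables of \<open>P\<close> come last here;
  \<open>invD'\<close> is the version in which they come first.\<close>

definition inv :: "'a set \<Rightarrow> bool" where
  "inv A \<longleftrightarrow> (\<forall>ts R c c'. dfb A (ts @ ss) R \<longrightarrow> eqt A ts c c' \<longrightarrow>
     ({x \<in> tup ss. c @ x \<in> R} \<in> P \<longleftrightarrow> {x \<in> tup ss. c' @ x \<in> R} \<in> P))"

definition rz :: "'a set \<Rightarrow> 'a list \<Rightarrow> bool" where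
  "rz A x \<longleftrightarrow> x \<in> tup ss \<and> (\<forall>S\<in>P. dfb A ss S \<longrightarrow> x \<in> S)"

definition mor :: "'a set \<Rightarrow> nat \<Rightarrow> (nat \<Rightarrow> 'a list) \<Rightarrow> bool" where
  "mor A n a \<longleftrightarrow> (\<forall>i<n. rz (A \<union> set (seg a 0 i)) (a i))"

section \<open>A global type as an ultrafilter of definable sets\<close>

lemma P_dfb: "S \<in> P \<Longrightarrow> dfb (univ M) ss S"
  using gt by (auto simp: gtype_def)

lemma P_sub: "S \<in> P \<Longrightarrow> S \<subseteq> tup ss"
  using P_dfb dfb_sub by blast

lemma P_ne: "S \<in> P \<Longrightarrow> S \<noteq> {}"
  using gt by (auto simp: gtype_def)

lemma P_Int: "S \<in> P \<Longrightarrow> S' \<in> P \<Longrightarrow> S \<inter> S' \<in> P"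
  using gt by (auto simp: gtype_def)

lemma P_Compl: "dfb A ss S \<Longrightarrow> A \<subseteq> univ M \<Longrightarrow> tup ss - S \<in> P \<longleftrightarrow> S \<notin> P"
proof -
  assume "dfb A ss S" "A \<subseteq> univ M"
  then have "S \<in> P \<or> tup ss - S \<in> P" using gt dfb_mono by (auto simp: gtype_def)
  moreover have "\<not> (S \<in> P \<and> tup ss - S \<in> P)"
  proof
    assume "S \<in> P \<and> tup ss - S \<in> P"
    then have "S \<inter> (tup ss - S) \<in> P" using P_Int by blast
    then show False using P_ne by auto
  qed
  ultimately show ?thesis by blast
qed

lemma P_tup: "tup ss \<in> P"
  using P_Compl[OF dfb_empty[of "{}" ss]] P_ne by auto

lemma P_INT: "finite G \<Longrightarrow> G \<subseteq> P \<Longrightarrow> {x \<in> tup ss. \<forall>S\<in>G. x \<in> S} \<in> P"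
proof (induction G rule: finite_induct)
  case empty
  then show ?case using P_tup by simp
next
  case (insert S F)
  have "{x \<in> tup ss. \<forall>S\<in>insert S F. x \<in> S} = S \<inter> {x \<in> tup ss. \<forall>S\<in>F. x \<in> S}"
    using insert.prems P_sub by auto
  then show ?case using insert P_Int by simp
qed

lemma rz_tup: "rz A x \<Longrightarrow> x \<in> tup ss"
  by (auto simp: rz_def)

lemma rz_mono: "rz A x \<Longrightarrow> A' \<subseteq> A \<Longrightarrow> rz A' x"
  by (auto simp: rz_def dest: dfb_mono)

lemma rz_dcl: "rz A x \<Longrightarrow> A' \<subseteq> dcl L M A \<Longrightarrow> rz A' x"
  unfolding rz_def using dfb_dcl dfb_mono by blast

lemma rz_iff: "rz A x \<Longrightarrow> dfb A ss S \<Longrightarrow> A \<subseteq> univ M \<Longrightarrow> x \<in> S \<longleftrightarrow> S \<in> P"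
  using P_Compl dfb_Compl unfolding rz_def by blast

lemma rz_ex:
  assumes "A \<subseteq> univ M" "small \<kappa> A" obtains x where "rz A x"
proof -
  have "\<exists>x\<in>tup ss. \<forall>S\<in>{S \<in> P. dfb A ss S}. x \<in> S"
  proof (rule sat_fip[OF assms])
    fix G assume G: "finite G" "G \<subseteq> {S \<in> P. dfb A ss S}"
    have "{x \<in> tup ss. \<forall>S\<in>G. x \<in> S} \<in> P" using G by (intro P_INT) auto
    from P_ne[OF this] show "\<exists>x\<in>tup ss. \<forall>S\<in>G. x \<in> S" by blast
  qed auto
  then show ?thesis using that unfolding rz_def by blast
qed

lemma invD:
  "inv A \<Longrightarrow> dfb A (ts @ ss) R \<Longrightarrow> eqt A ts c c' \<Longrightarrow>
     {x \<in> tup ss. c @ x \<in> R} \<in> P \<longleftrightarrow> {x \<in> tup ss. c' @ x \<in> R} \<in> P"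
  unfolding inv_def by blast

lemma invD':
  assumes "inv A" "dfb A (ss @ ts) R" "eqt A ts c c'"
  shows "{x \<in> tup ss. x @ c \<in> R} \<in> P \<longleftrightarrow> {x \<in> tup ss. x @ c' \<in> R} \<in> P"
proof -
  have "{x \<in> tup ss. x @ d \<in> R} = {x \<in> tup ss. d @ x \<in> swapset ss ts R}" if "d \<in> tup ts" for d
    using that swapset_iff[OF tuples_length] by blast
  then show ?thesis using invD[OF assms(1) dfb_swap[OF assms(2)] assms(3)] eqt_tup[OF assms(3)] by simp
qed

text \<open>The parameters of \<open>R\<close> come from \<open>A'\<close> and may lie outside
  \<open>A\<close>. They are prefixed to \<open>c\<close> and \<open>c'\<close>; the longer tuples
  still have the same type over \<open>A'\<close>, hence over \<open>A\<close>, because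
  \<open>A\<close> lies in the definable closure of \<open>A'\<close>.\<close>

lemma inv_mono:
  assumes "inv A" "A \<subseteq> dcl L M A'" "A' \<subseteq> univ M" shows "inv A'"
  unfolding inv_def
proof (intro allI impI)
  fix ts R c c' assume R: "dfb A' (ts @ ss) R" and c: "eqt A' ts c c'"
  obtain k where k: "set k \<subseteq> A'" "dfb (set k) (ts @ ss) R" using dfb_finite[OF R] .
  have kt: "k \<in> tup (map (sort_of M) k)" using k assms(3) by (intro tuplesI) auto
  have "dfb ({} \<union> set k) (ts @ ss) R" using k by simp
  then obtain R0 where R0: "dfb {} (map (sort_of M) k @ ts @ ss) R0"
    "R = {x \<in> tup (ts @ ss). k @ x \<in> R0}" using kt by (rule dfb_abs_prefix)
  have "eqt (A' \<union> set k) ts c c'" using c k by (simp add: Un_absorb2)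
  from eqt_abs[OF this kt] have "eqt A' (map (sort_of M) k @ ts) (k @ c) (k @ c')"
    using eqt_swap tuples_length eqt_tup[OF c] by blast
  then have "eqt A (map (sort_of M) k @ ts) (k @ c) (k @ c')" using eqt_dcl assms by blast
  moreover have "dfb A ((map (sort_of M) k @ ts) @ ss) R0" using dfb_mono[OF R0(1)] by simp
  moreover have "{x \<in> tup ss. d @ x \<in> R} = {x \<in> tup ss. (k @ d) @ x \<in> R0}" if "d \<in> tup ts" for d
    using that by (auto simp: R0(2) tuples_append)
  ultimately show "{x \<in> tup ss. c @ x \<in> R} \<in> P \<longleftrightarrow> {x \<in> tup ss. c' @ x \<in> R} \<in> P"
    using invD[OF assms(1), of "map (sort_of M) k @ ts" R0 "k @ c" "k @ c'"] eqt_tup[OF c] by simp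
qed

section \<open>Morley sequences of a global type\<close>

lemma mor_tup: "mor A n a \<Longrightarrow> i + k \<le> n \<Longrightarrow> seg a i (i + k) \<in> tup (rep ss k)"
  by (rule tup_seg) (meson mor_def rz_tup order_less_le_trans)

lemma mor_set: "mor A n a \<Longrightarrow> j \<le> n \<Longrightarrow> set (seg a i j) \<subseteq> univ M"
proof -
  assume "mor A n a" "j \<le> n"
  then have "set (a k) \<subseteq> univ M" if "k < j" for k
    using that tuples_set rz_tup unfolding mor_def by (metis order_less_le_trans)
  then show ?thesis by (force simp: set_seg)
qed

lemma mor_mono: "mor A n a \<Longrightarrow> A' \<subseteq> A \<Longrightarrow> n' \<le> n \<Longrightarrow> mor A' n' a"
  unfolding mor_def by (meson Un_mono order_less_le_trans rz_mono subset_refl)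

lemma mor_dcl:
  assumes "mor A n a" "A' \<subseteq> dcl L M A" "A \<subseteq> univ M" shows "mor A' n a"
  unfolding mor_def
proof (intro allI impI)
  fix i assume i: "i < n"
  then have 1: "rz (A \<union> set (seg a 0 i)) (a i)" using assms(1) by (auto simp: mor_def)
  have "A \<union> set (seg a 0 i) \<subseteq> univ M" using mor_set[OF assms(1), of i] i assms(3) by auto
  then have "A' \<union> set (seg a 0 i) \<subseteq> dcl L M (A \<union> set (seg a 0 i))"
    using assms(2) dcl_incl[of "A \<union> set (seg a 0 i)"] dcl_mono[of A "A \<union> set (seg a 0 i)"] by auto
  then show "rz (A' \<union> set (seg a 0 i)) (a i)" using rz_dcl[OF 1] by blast
qed

lemma mor_ex:
  assumes "A \<subseteq> univ M" "small \<kappa> A" obtains a where "\<And>n. mor A n a"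
proof -
  \<comment> \<open>The recursion carries the list of all earlier choices, because the next member
    has to realise \<open>P\<close> over all of them.\<close>
  define F where "F = rec_nat [] (\<lambda>_ xs. xs @ [SOME x. rz (A \<union> set (concat xs)) x])"
  have F: "F 0 = []" "\<And>n. F (Suc n) = F n @ [SOME x. rz (A \<union> set (concat (F n))) x]"
    by (simp_all add: F_def)
  define a where "a = (\<lambda>n. SOME x. rz (A \<union> set (concat (F n))) x)"
  have a: "a n = (SOME x. rz (A \<union> set (concat (F n))) x)" for n by (simp add: a_def)
  have Fa: "F n = map a [0..<n]" for n by (induction n) (auto simp: F a_def)
  have "mor A n a" for n
  proof (induction n)
    case (Suc n)
    have "A \<union> set (seg a 0 n) \<subseteq> univ M" using assms mor_set[OF Suc] by auto
    moreover have "small \<kappa> (A \<union> set (seg a 0 n))" using assms by (auto intro: small_Un small_set)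
    ultimately obtain x where "rz (A \<union> set (seg a 0 n)) x" by (rule rz_ex)
    then have "rz (A \<union> set (seg a 0 n)) (a n)" 
      unfolding a[of n] Fa seg_def by (rule someI)
    then show ?case using Suc by (auto simp: mor_def less_Suc_eq)
  qed (simp add: mor_def)
  then show ?thesis by (rule that)
qed

text \<open>Since \<open>b n\<close> realises \<open>P\<close> over everything before it,
  \<open>R\<close> holds at \<open>b n\<close> exactly if the corresponding instance lies in
  \<open>P\<close>. By invariance this depends only on the type of what precedes, which the
  induction hypothesis controls.\<close>

lemma mor_eqt:
  assumes "inv A" "A \<subseteq> univ M" "eqt A ts c c'"
  shows "mor (A \<union> set c) n b \<Longrightarrow> mor (A \<union> set c') n b' \<Longrightarrow>
    eqt A (ts @ rep ss n) (c @ seg b 0 n) (c' @ seg b' 0 n)"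
proof (induction n)
  case 0
  then show ?case using assms by simp
next
  case (Suc n)
  have IH: "eqt A (ts @ rep ss n) (c @ seg b 0 n) (c' @ seg b' 0 n)"
    using Suc mor_mono by (metis le_SucI order_refl)
  note t = eqt_tup[OF IH]
  have r: "rz ((A \<union> set c) \<union> set (seg b 0 n)) (b n)" "rz ((A \<union> set c') \<union> set (seg b' 0 n)) (b' n)"
    using Suc.prems by (auto simp: mor_def)
  then have r: "rz (A \<union> set (c @ seg b 0 n)) (b n)" "rz (A \<union> set (c' @ seg b' 0 n)) (b' n)"
    by (simp_all add: Un_assoc)
  note u = assms(2) t[THEN tuples_set]
  have "eqt A ((ts @ rep ss n) @ ss) ((c @ seg b 0 n) @ b n) ((c' @ seg b' 0 n) @ b' n)"
    unfolding eqt_def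
  proof (intro conjI allI impI)
    fix R assume R: "dfb A ((ts @ rep ss n) @ ss) R"
    have "(c @ seg b 0 n) @ b n \<in> R \<longleftrightarrow> {x \<in> tup ss. (c @ seg b 0 n) @ x \<in> R} \<in> P"
      using rz_iff[OF r(1) dfb_inst_prefix[OF R t(1)]] u rz_tup[OF r(1)] by simp
    also have "\<dots> \<longleftrightarrow> {x \<in> tup ss. (c' @ seg b' 0 n) @ x \<in> R} \<in> P"
      by (rule invD[OF assms(1) R IH])
    also have "\<dots> \<longleftrightarrow> (c' @ seg b' 0 n) @ b' n \<in> R"
      using rz_iff[OF r(2) dfb_inst_prefix[OF R t(2)]] u rz_tup[OF r(2)] by simp
    finally show "(c @ seg b 0 n) @ b n \<in> R \<longleftrightarrow> (c' @ seg b' 0 n) @ b' n \<in> R" .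
  qed (use t r rz_tup tuples_append in blast)+
  then show ?case by (simp add: rep_Suc seg_Suc)
qed

lemma mor_eqt0:
  assumes "inv A" "A \<subseteq> univ M" "mor A n b" "mor A n b'"
  shows "eqt A (rep ss n) (seg b 0 n) (seg b' 0 n)"
  using mor_eqt[OF assms(1,2), of "[]" "[]" "[]" n b b'] assms(3,4) by (simp add: eqt_refl)

lemma mor_sub:
  assumes "mor A N a" "\<And>i. i < n \<Longrightarrow> f i < N" "\<And>i j. i < j \<Longrightarrow> j < n \<Longrightarrow> f i < f j"
  shows "mor A n (\<lambda>i. a (f i))"
  unfolding mor_def
proof (intro allI impI)
  fix i assume i: "i < n"
  then have "rz (A \<union> set (seg a 0 (f i))) (a (f i))" using assms(1,2) by (auto simp: mor_def)
  moreover have "set (seg (\<lambda>i. a (f i)) 0 i) \<subseteq> set (seg a 0 (f i))"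
    using assms(3) i by (fastforce simp: set_seg)
  ultimately show "rz (A \<union> set (seg (\<lambda>i. a (f i)) 0 i)) (a (f i))"
    using rz_mono by (meson Un_mono subset_refl)
qed

lemma mor_shift:
  assumes "mor A (k + n) a"
  shows "mor (A \<union> set (seg a 0 k)) n (\<lambda>i. a (k + i))"
  unfolding mor_def
proof (intro allI impI)
  fix i assume i: "i < n"
  then have "rz (A \<union> set (seg a 0 (k + i))) (a (k + i))" using assms by (auto simp: mor_def)
  moreover have "set (seg a 0 (k + i)) = set (seg a 0 k) \<union> set (seg (\<lambda>i. a (k + i)) 0 i)"
    using seg_append[of 0 k "k + i" a] seg_cong[of i a k "\<lambda>i. a (k + i)" 0] by simp
  ultimately show "rz (A \<union> set (seg a 0 k) \<union> set (seg (\<lambda>i. a (k + i)) 0 i)) (a (k + i))"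
    by (simp add: Un_assoc)
qed

lemma mor_join:
  assumes "mor A n a" "mor (A \<union> set (seg a 0 n)) m b"
  shows "mor A (n + m) (\<lambda>i. if i < n then a i else b (i - n))" (is "mor A _ ?c")
  unfolding mor_def
proof (intro allI impI)
  fix i assume i: "i < n + m"
  show "rz (A \<union> set (seg ?c 0 i)) (?c i)"
  proof (cases "i < n")
    case True
    then have "seg ?c 0 i = seg a 0 i" using seg_cong[of i ?c 0 a 0] by simp
    then show ?thesis using True assms(1) by (auto simp: mor_def)
  next
    case False
    have "seg ?c 0 n = seg a 0 n" using seg_cong[of n ?c 0 a 0] by simp
    moreover have "seg ?c n i = seg b 0 (i - n)" 
      using False seg_cong[of "i - n" ?c n b 0] by simp
    ultimately have "seg ?c 0 i = seg a 0 n @ seg b 0 (i - n)"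
      using False seg_append[of 0 n i ?c] by simp
    then show ?thesis using False i assms(2) by (auto simp: mor_def Un_assoc)
  qed
qed

text \<open>Two Morley sequences of the same length have the same type over \<open>A\<close>, so a
  truth pattern that some \<open>y\<close> produces on the blocks of one is produced by some
  \<open>y'\<close> on the blocks of the other.\<close>

lemma mor_transfer:
  assumes "inv A" "A \<subseteq> univ M" "small \<kappa> A" "mor A (N * m) a" "mor A (N * m) a'" "y \<in> tup ts"
  obtains y' where "y' \<in> tup ts" "\<And>j. j < N \<Longrightarrow> eqt A (rep ss m @ ts) (blk m a j @ y) (blk m a' j @ y')"
proof -
  have "eqt A (rep ss (N * m)) (seg a 0 (N * m)) (seg a' 0 (N * m))"
    using mor_eqt0 assms by blast
  then obtain y' where y': "y' \<in> tup ts"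
    "eqt A (rep ss (N * m) @ ts) (seg a 0 (N * m) @ y) (seg a' 0 (N * m) @ y')"
    using homog[OF assms(2,3)] assms(6) by metis
  have "eqt A (rep ss m @ ts) (blk m a j @ y) (blk m a' j @ y')" if j: "j < N" for j
  proof -
    let ?k = "N * m - (j * m + m)"
    have le: "j * m + m \<le> N * m" using j by (metis Suc_leI mult_Suc mult_le_mono1 add.commute)
    have "N * m = j * m + (m + ?k)" using le by simp
    then have dec: "rep ss (N * m) = rep ss (j * m) @ rep ss m @ rep ss ?k"
      using rep_add by metis
    have dec': "seg x 0 (N * m) = seg x 0 (j * m) @ blk m x j @ seg x (j * m + m) (N * m)" for x :: "nat \<Rightarrow> 'a list"
    proof -
      have "j * m \<le> N * m" using le by linarith
      then show ?thesis using le seg_append[of 0 "j * m" "N * m" x]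
          seg_append[of "j * m" "j * m + m" "N * m" x] by (simp only: blk_def)
    qed
    have len: "length (seg x 0 (j * m)) = length (rep ss (j * m))" "length (blk m x j) = length (rep ss m)"
      "length (seg x (j * m + m) (N * m)) = length (rep ss ?k)" if x: "mor A (N * m) x" for x
    proof -
      have le': "0 + j * m \<le> N * m" "j * m + m + ?k \<le> N * m" "j * m + m + ?k = N * m"
        using le by linarith+
      show "length (seg x 0 (j * m)) = length (rep ss (j * m))"
        "length (blk m x j) = length (rep ss m)"
        "length (seg x (j * m + m) (N * m)) = length (rep ss ?k)"
        using mor_tup[OF x le'(1), THEN tuples_length] mor_tup[OF x le, THEN tuples_length]
          mor_tup[OF x le'(2), THEN tuples_length] by (simp_all add: blk_def le'(3))
    qed
    have "eqt A ((rep ss m @ rep ss ?k) @ ts) ((blk m a j @ seg a (j * m + m) (N * m)) @ y)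
      ((blk m a' j @ seg a' (j * m + m) (N * m)) @ y')"
      using y'(2) unfolding dec dec' append_assoc
      by (rule eqt_suffix) (use len assms in auto)
    then show ?thesis unfolding append_assoc
      by (rule eqt_drop_middle) (use len assms in auto)
  qed
  then show ?thesis using y'(1) that by blast
qed

section \<open>Bounded alternation along Morley sequences\<close>

lemma blk_shift: "blk m (\<lambda>i. a (k * m + i)) j = blk m a (k + j)"
  unfolding blk_def by (rule seg_cong) (simp add: algebra_simps)

text \<open>Otherwise there is, for every \<open>n\<close>, a pattern of \<open>n\<close> true
  blocks followed by \<open>n\<close> false ones. Windows of these patterns, moved to one fixed
  infinite Morley sequence, realise every cut \<open>j < i\<close>, and that is the order
  property.\<close>

lemma bounded_alternation:
  assumes inv: "inv A" and A: "A \<subseteq> univ M" "small \<kappa> A" and R: "dfb A (rep ss m @ ts) R"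
  shows "\<exists>n. \<not> (\<exists>a y. mor A (2 * n * m) a \<and> y \<in> tup ts \<and> (\<forall>j<n. blk m a j @ y \<in> R) \<and>
    (\<forall>j. n \<le> j \<longrightarrow> j < 2 * n \<longrightarrow> blk m a j @ y \<notin> R))"
proof (rule ccontr)
  assume "\<not> ?thesis"
  then have ex: "\<exists>a y. mor A (2 * n * m) a \<and> y \<in> tup ts \<and> (\<forall>j<n. blk m a j @ y \<in> R) \<and>
    (\<forall>j. n \<le> j \<longrightarrow> j < 2 * n \<longrightarrow> blk m a j @ y \<notin> R)" for n by blast
  obtain a where a: "\<And>n. mor A n a" using mor_ex[OF A] by blast
  have at: "blk m a j \<in> tup (rep ss m)" for j
    unfolding blk_def using mor_tup[OF a, of "j * m" m "j * m + m"] by simp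
  have fin: "\<exists>y\<in>tup ts. \<forall>j<N. blk m a j @ y \<in> R \<longleftrightarrow> j < i" if "i \<le> N" for i N
  proof -
    from ex[of N] obtain b z where b: "mor A (2 * N * m) b" "z \<in> tup ts"
      "\<And>j. j < N \<Longrightarrow> blk m b j @ z \<in> R" "\<And>j. N \<le> j \<Longrightarrow> j < 2 * N \<Longrightarrow> blk m b j @ z \<notin> R" by blast
    \<comment> \<open>Starting \<open>N - i\<close> blocks in, a window of \<open>N\<close> blocks
      meets exactly \<open>i\<close> true blocks and then \<open>N - i\<close> false ones.\<close>
    have "mor A (N * m) (\<lambda>r. b ((N - i) * m + r))"
    proof (rule mor_sub[OF b(1)])
      fix r assume "r < N * m"
      then have "(N - i) * m + r < (N - i) * m + N * m" by simp
      also have "\<dots> \<le> 2 * N * m" by (simp flip: add_mult_distrib)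
      finally show "(N - i) * m + r < 2 * N * m" .
    qed simp
    from mor_transfer[OF inv A this a b(2)] obtain y where y: "y \<in> tup ts"
      "\<And>j. j < N \<Longrightarrow> eqt A (rep ss m @ ts) (blk m b (N - i + j) @ z) (blk m a j @ y)"
      unfolding blk_shift by blast
    have "blk m a j @ y \<in> R \<longleftrightarrow> j < i" if j: "j < N" for j
    proof (cases "j < i")
      case True
      then have "N - i + j < N" using \<open>i \<le> N\<close> by linarith
      then show ?thesis using True eqtD[OF y(2)[OF j] R] b(3) by blast
    next
      case False
      then have "N \<le> N - i + j" "N - i + j < 2 * N" using \<open>i \<le> N\<close> j by linarith+
      then show ?thesis using False eqtD[OF y(2)[OF j] R] b(4) by blast
    qed
    then show ?thesis using y(1) by blast
  qed
  define V where "V = (\<lambda>j. {y \<in> tup ts. blk m a j @ y \<in> R})"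
  have Aa: "A \<union> (\<Union>n. set (a n)) \<subseteq> univ M" "small \<kappa> (A \<union> (\<Union>n. set (a n)))"
  proof -
    have "a n \<in> tup ss" for n using a[of "Suc n"] rz_tup by (auto simp: mor_def)
    then show "A \<union> (\<Union>n. set (a n)) \<subseteq> univ M" using A(1) tuples_set by blast
    show "small \<kappa> (A \<union> (\<Union>n. set (a n)))" using A(2) small_nat_UN by (rule small_Un)
  qed
  have Vd: "dfb (A \<union> (\<Union>n. set (a n))) ts (V j)" for j
  proof -
    have "dfb (A \<union> set (blk m a j)) ts (V j)" unfolding V_def using dfb_inst_prefix[OF R at] .
    moreover have "set (blk m a j) \<subseteq> (\<Union>n. set (a n))" by (auto simp: blk_def set_seg)
    ultimately show ?thesis using dfb_mono by (meson Un_mono subset_refl)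
  qed
  \<comment> \<open>So far only finite initial parts are controlled; saturation over the whole
    sequence realises the infinite cut.\<close>
  have "\<exists>y\<in>tup ts. \<forall>j. blk m a j @ y \<in> R \<longleftrightarrow> j < i" for i
  proof -
    let ?W = "\<lambda>j. if j < i then V j else tup ts - V j"
    have "\<exists>y\<in>tup ts. \<forall>S\<in>range ?W. y \<in> S"
    proof (rule sat_fip[OF Aa])
      show "dfb (A \<union> (\<Union>n. set (a n))) ts S" if "S \<in> range ?W" for S
        using that Vd dfb_Compl by auto
      fix G assume "finite G" "G \<subseteq> range ?W"
      then obtain J where J: "finite J" "G = ?W ` J" by (meson finite_subset_image)
      obtain N where N: "i \<le> N" "\<And>j. j \<in> J \<Longrightarrow> j < N"
        using finite_nat_set_iff_bounded[of "insert i J"] J(1) by (auto intro: less_imp_le)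
      from fin[OF N(1)] obtain y where "y \<in> tup ts" "\<forall>j<N. blk m a j @ y \<in> R \<longleftrightarrow> j < i" by blast
      then show "\<exists>y\<in>tup ts. \<forall>S\<in>G. y \<in> S" using J N by (intro bexI[of _ y]) (auto simp: V_def)
    qed
    then obtain y where y: "y \<in> tup ts" "\<And>j. y \<in> ?W j" by auto
    have "blk m a j @ y \<in> R \<longleftrightarrow> j < i" for j
      using y(1) y(2)[of j] by (cases "j < i") (simp_all add: V_def)
    then show ?thesis using y(1) by blast
  qed
  then obtain y where y: "\<And>i. y i \<in> tup ts" "\<And>i j. blk m a j @ y i \<in> R \<longleftrightarrow> j < i" by metis
  show False by (rule no_order[OF R A(1) at y])
qed

lemma mor_thin:
  assumes a: "mor A (N * m) a" and f: "\<And>i. i < n \<Longrightarrow> f i < N"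
    and f_less: "\<And>i j. i < j \<Longrightarrow> j < n \<Longrightarrow> f i < f j"
  obtains b where "mor A (n * m) b" "\<And>j. blk m b j = blk m a (f j)"
proof -
  \<comment> \<open>Position \<open>i\<close> of the new sequence is entry \<open>i mod m\<close> of
    its block \<open>i div m\<close>, which is copied from block \<open>f (i div m)\<close> of the
    old one.\<close>
  let ?g = "\<lambda>i. f (i div m) * m + i mod m"
  let ?b = "\<lambda>i. a (?g i)"
  have "mor A (n * m) ?b"
  proof (rule mor_sub[OF a])
    fix i assume i: "i < n * m"
    then have m: "m > 0" by (cases m) auto
    have "i div m < n" using i by (simp add: less_mult_imp_div_less)
    from f[OF this] have "Suc (f (i div m)) * m \<le> N * m" by (simp only: mult_le_mono1 Suc_le_eq)
    then show "?g i < N * m" using mod_less_divisor[OF m, of i] by simp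
  next
    fix i j assume ij: "i < j" "j < n * m"
    then have m: "m > 0" by (cases m) auto
    show "?g i < ?g j"
    proof (cases "i div m = j div m")
      case True
      then show ?thesis using ij by (metis add_less_cancel_left div_mult_mod_eq)
    next
      case False
      then have "i div m < j div m" using ij by (simp add: div_le_mono order_less_le)
      moreover have "j div m < n" using ij by (simp add: less_mult_imp_div_less)
      ultimately have "Suc (f (i div m)) * m \<le> f (j div m) * m"
        using f_less by (simp only: mult_le_mono1 Suc_le_eq)
      then show ?thesis using mod_less_divisor[OF m, of i] by simp
    qed
  qed
  moreover have "blk m ?b j = blk m a (f j)" for j
    unfolding blk_def
  proof (rule seg_cong)
    fix r assume "r < m"
    then show "a (f ((j * m + r) div m) * m + (j * m + r) mod m) = a (f j * m + r)" by simp
  qed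
  ultimately show ?thesis by (rule that)
qed

text \<open>If \<open>n\<close> blocks satisfied the condition on \<open>y\<close>, they could be
  selected and continued by \<open>n\<close> blocks that are generic over \<open>y\<close>, where
  \<open>R\<close> fails: the pattern excluded by \<open>bounded_alternation\<close>. The sequence
  \<open>a\<close> is Morley over \<open>A\<close> only, not over \<open>y\<close>, which is what
  makes the bound useful.\<close>

lemma bounded_exceptions:
  assumes inv: "inv A" and A: "A \<subseteq> univ M" "small \<kappa> A" and R: "dfb A (rep ss m @ ts) R"
  obtains n where "\<And>N a y. mor A (N * m) a \<Longrightarrow> y \<in> tup ts \<Longrightarrow>
    (\<And>b. mor (A \<union> set y) m b \<Longrightarrow> seg b 0 m @ y \<notin> R) \<Longrightarrow> card {j. j < N \<and> blk m a j @ y \<in> R} < n"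
proof -
  from bounded_alternation[OF assms] obtain n where
    n: "\<And>a y. mor A (2 * n * m) a \<Longrightarrow> y \<in> tup ts \<Longrightarrow> (\<And>j. j < n \<Longrightarrow> blk m a j @ y \<in> R) \<Longrightarrow>
      (\<And>j. n \<le> j \<Longrightarrow> j < 2 * n \<Longrightarrow> blk m a j @ y \<notin> R) \<Longrightarrow> False" by blast
  show ?thesis
  proof (rule that[of n], rule ccontr)
    fix N a y assume a: "mor A (N * m) a" and y: "y \<in> tup ts"
      and gen: "\<And>b. mor (A \<union> set y) m b \<Longrightarrow> seg b 0 m @ y \<notin> R"
      and "\<not> card {j. j < N \<and> blk m a j @ y \<in> R} < n"
    then have cn: "n \<le> card {j. j < N \<and> blk m a j @ y \<in> R}" by simp
    define fs where "fs = sorted_list_of_set {j. j < N \<and> blk m a j @ y \<in> R}"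
    have fs: "set fs = {j. j < N \<and> blk m a j @ y \<in> R}" "sorted_wrt (<) fs" "n \<le> length fs"
      using cn by (auto simp: fs_def)
    have f: "fs ! i < N" "blk m a (fs ! i) @ y \<in> R" if "i < n" for i
    proof -
      have "fs ! i \<in> set fs" using that fs(3) by simp
      then show "fs ! i < N" "blk m a (fs ! i) @ y \<in> R" using fs(1) by auto
    qed
    have f_less: "fs ! i < fs ! j" if "i < j" "j < n" for i j
      using fs(2,3) that sorted_wrt_nth_less by (metis order_less_le_trans)
    obtain b where b: "mor A (n * m) b" and bb: "\<And>j. blk m b j = blk m a (fs ! j)"
      using mor_thin[OF a, of n "\<lambda>i. fs ! i"] f(1) f_less by blast
    let ?A = "A \<union> set y \<union> set (seg b 0 (n * m))"
    have "?A \<subseteq> univ M" using A tuples_set[OF y] mor_set[OF b] by auto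
    moreover have "small \<kappa> ?A" using A by (intro small_Un small_set)
    ultimately obtain e where e: "\<And>k. mor ?A k e" using mor_ex by blast
    let ?c = "\<lambda>i. if i < n * m then b i else e (i - n * m)"
    have c: "mor A (n * m + n * m) ?c"
      by (rule mor_join[OF b mor_mono[OF e]]) auto
    show False
    proof (rule n[of ?c y])
      show "mor A (2 * n * m) ?c" using c by (simp add: mult_2 add_mult_distrib)
      show "y \<in> tup ts" by (rule y)
      show "blk m ?c j @ y \<in> R" if "j < n" for j
      proof -
        have "j * m + m \<le> n * m" using that by (metis Suc_leI mult_Suc mult_le_mono1 add.commute)
        then have "blk m ?c j = blk m b j" unfolding blk_def by (intro seg_cong) simp
        then show ?thesis using f(2)[OF that] bb by simp
      qed
      show "blk m ?c j @ y \<notin> R" if "n \<le> j" "j < 2 * n" for j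
      proof -
        have jm: "n * m \<le> j * m" using that by simp
        have "blk m ?c j = seg (\<lambda>i. e ((j - n) * m + i)) 0 (0 + m)" unfolding blk_def
        proof (rule seg_cong)
          fix r assume "r < m"
          have "\<not> j * m + r < n * m" using jm by linarith
          moreover have "j * m + r - n * m = (j - n) * m + r"
            using jm by (simp only: diff_mult_distrib)
          ultimately show "?c (j * m + r) = e ((j - n) * m + (0 + r))" by simp
        qed
        moreover have "mor (A \<union> set y) m (\<lambda>i. e ((j - n) * m + i))"
          by (rule mor_mono[OF mor_shift[OF e]]) auto
        ultimately show ?thesis using gen by simp
      qed
    qed
  qed
qed

text \<open>A Morley sequence in a stable theory is an indiscernible set; only this transposition of a
  single element and a block is needed.\<close>

lemma mor_commute:
  assumes inv: "inv A" and A: "A \<subseteq> univ M" and R: "dfb A (rep ss m @ ss) R" and a: "\<And>n. mor A n a"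
  shows "seg a 0 m @ a m \<in> R \<longleftrightarrow> seg a 1 (Suc m) @ a 0 \<in> R"
proof -
  have seg_first: "seg x 0 (Suc m) = x 0 @ seg x 1 (Suc m)" for x :: "nat \<Rightarrow> 'a list"
    using seg_append[of 0 1 "Suc m" x] seg_Suc[of 0 0 x] by simp
  \<comment> \<open>The sequence is cut into groups of \<open>m + 1\<close>: \<open>X j\<close> is
    made of the first \<open>m\<close> members of group \<open>j\<close>, and \<open>c i\<close> is
    the last member of group \<open>i\<close>. So \<open>X j\<close> stands before
    \<open>c i\<close> exactly if \<open>j \<le> i\<close>.\<close>
  define X where "X = (\<lambda>j. seg a (j * Suc m) (j * Suc m + m))"
  define c where "c = (\<lambda>i. a (i * Suc m + m))"
  have at: "a i \<in> tup ss" for i using a[of "Suc i"] rz_tup by (auto simp: mor_def)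
  have Xt: "X j \<in> tup (rep ss m)" for j unfolding X_def using tup_seg at by blast
  have ct: "c j \<in> tup ss" for j unfolding c_def by (rule at)
  have le: "X j @ c i \<in> R \<longleftrightarrow> seg a 0 m @ a m \<in> R" if "j \<le> i" for i j
  proof -
    let ?f = "\<lambda>r. if r < m then j * Suc m + r else i * Suc m + m"
    have "j * Suc m \<le> i * Suc m" using that by (rule mult_le_mono1)
    then have "mor A (Suc m) (\<lambda>r. a (?f r))"
      by (intro mor_sub[OF a[of "Suc (i * Suc m + m)"]]) auto
    from mor_eqt0[OF inv A this a[of "Suc m"]]
    have "eqt A (rep ss m @ ss) (seg (\<lambda>r. a (?f r)) 0 m @ a (?f m)) (seg a 0 m @ a m)"
      by (simp add: seg_Suc rep_Suc)
    moreover have "seg (\<lambda>r. a (?f r)) 0 m = X j"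
      unfolding X_def using seg_cong[of m "\<lambda>r. a (?f r)" 0 a "j * Suc m"] by simp
    ultimately show ?thesis using eqtD R by (simp add: c_def)
  qed
  have gt: "X j @ c i \<in> R \<longleftrightarrow> seg a 1 (Suc m) @ a 0 \<in> R" if "i < j" for i j
  proof -
    let ?f = "\<lambda>r. if r = 0 then i * Suc m + m else j * Suc m + (r - 1)"
    have "Suc i * Suc m \<le> j * Suc m" using that by (intro mult_le_mono1) simp
    then have "mor A (Suc m) (\<lambda>r. a (?f r))"
      by (intro mor_sub[OF a[of "j * Suc m + m"]]) auto
    from mor_eqt0[OF inv A this a[of "Suc m"]]
    have "eqt A (ss @ rep ss m) (a (?f 0) @ seg (\<lambda>r. a (?f r)) 1 (Suc m)) (a 0 @ seg a 1 (Suc m))"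
      unfolding rep_Suc' seg_first .
    moreover have "seg (\<lambda>r. a (?f r)) 1 (1 + m) = X j"
      unfolding X_def by (rule seg_cong) simp
    ultimately have "eqt A (ss @ rep ss m) (c i @ X j) (a 0 @ seg a 1 (Suc m))" by (simp add: c_def)
    from eqtD[OF eqt_swap[OF this] R] show ?thesis using ct at tuples_length by blast
  qed
  show ?thesis
  proof (rule ccontr)
    assume "\<not> ?thesis"
    then consider "seg a 0 m @ a m \<in> R" "seg a 1 (Suc m) @ a 0 \<notin> R"
      | "seg a 0 m @ a m \<notin> R" "seg a 1 (Suc m) @ a 0 \<in> R" by blast
    then show False
    proof cases
      case 1
      \<comment> \<open>Passing to \<open>X (Suc i)\<close> turns the weak inequality of
        \<open>le\<close> into the strict one of the order property.\<close>
      have "X (Suc i) @ c j \<in> R \<longleftrightarrow> i < j" for i j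
        using le[of "Suc i" j] gt[of j "Suc i"] 1 by (cases "i < j") simp_all
      then show False by (intro no_order[OF R A, of "\<lambda>j. X (Suc j)" c] Xt ct)
    next
      case 2
      have "X (Suc i) @ c j \<in> tup (rep ss m @ ss) - R \<longleftrightarrow> i < j" for i j
        using le[of "Suc i" j] gt[of j "Suc i"] 2 tuples_append[OF Xt ct] by (cases "i < j") simp_all
      then show False by (intro no_order[OF dfb_Compl[OF R] A, of "\<lambda>j. X (Suc j)" c] Xt ct)
    qed
  qed
qed

end

section \<open>Dividing and forking\<close>

context mstruc
begin

lemma dfb_cylinder:
  assumes "dfb A ts S" shows "dfb A (ts @ us) {y @ x | y x. y \<in> S \<and> x \<in> tup us}"
proof -
  have "dfb A (ts @ us) {z \<in> tup (ts @ us). map ((!) z) [0..<length ts] \<in> S}"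
    using nth_prefix[of ts us] by (intro dfb_reindex[OF assms]) auto
  moreover have "{z \<in> tup (ts @ us). map ((!) z) [0..<length ts] \<in> S} =
      {y @ x | y x. y \<in> S \<and> x \<in> tup us}"
  proof -
    have *: "map ((!) (y @ x)) [0..<length ts] = y" if "y \<in> tup ts" for x y
      using nth_prefix[of y x] tuples_length[OF that] by simp
    show ?thesis
    proof (intro set_eqI iffI)
      fix z assume z: "z \<in> {z \<in> tup (ts @ us). map ((!) z) [0..<length ts] \<in> S}"
      then obtain y x where "z = y @ x" "y \<in> tup ts" "x \<in> tup us" by (blast elim: tuples_appendE)
      then show "z \<in> {y @ x | y x. y \<in> S \<and> x \<in> tup us}" using z * by auto
    next
      fix z assume "z \<in> {y @ x | y x. y \<in> S \<and> x \<in> tup us}"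
      then obtain y x where z: "z = y @ x" "y \<in> S" "x \<in> tup us" by blast
      then have "y \<in> tup ts" using dfb_sub[OF assms] by blast
      then show "z \<in> {z \<in> tup (ts @ us). map ((!) z) [0..<length ts] \<in> S}"
        using z * tuples_append by auto
    qed
  qed
  ultimately show ?thesis by simp
qed

lemma cylinder_iff:
  assumes "S \<subseteq> tup ts" "length y = length ts"
  shows "y @ x \<in> {y @ x | y x. y \<in> S \<and> x \<in> tup us} \<longleftrightarrow> y \<in> S \<and> x \<in> tup us"
proof
  assume "y @ x \<in> {y @ x | y x. y \<in> S \<and> x \<in> tup us}"
  then obtain y' x' where *: "y @ x = y' @ x'" "y' \<in> S" "x' \<in> tup us" by blast
  then have "length y' = length y" using assms tuples_length by (metis subsetD)
  then show "y \<in> S \<and> x \<in> tup us" using * by auto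
qed blast

lemma realises_tp_iff:
  assumes "u \<in> tup ts"
  shows "realises M ts y (tp L M u A) \<longleftrightarrow> eqt A ts u y"
proof
  assume r: "realises M ts y (tp L M u A)"
  then have y: "y \<in> tup ts" by (simp add: realises_def)
  show "eqt A ts u y"
  proof (rule eqtI[OF assms y])
    fix S assume S: "dfb A ts S" "u \<in> S"
    then obtain \<psi> where psi: "\<psi> \<in> pfms L M ts A" "S = dset ts \<psi>" by (auto simp: dfb_def)
    then have "\<psi> \<in> tp L M u A" using S(2) tuples_sorts[OF assms] by (auto simp: tp_def dset_def)
    then show "y \<in> S" using psi r y by (auto simp: realises_def dset_def)
  qed
next
  assume e: "eqt A ts u y"
  then have y: "y \<in> tup ts" by (rule eqt_tup)
  have "tp L M u A = tp L M y A" using e eqt_iff_tp[OF assms y] by simp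
  then show "realises M ts y (tp L M u A)"
    using y by (auto simp: realises_def tp_def)
qed

text \<open>One dividing formula is enough. Its parameter tuple is \<open>c\<close> followed by the
  parameters \<open>b\<close> of \<open>R\<close>; as \<open>b\<close> lies in \<open>A\<close>,
  every \<open>c' i @ b\<close> has the type of \<open>c @ b\<close> over \<open>A\<close>.\<close>

lemma forksI:
  assumes R: "dfb A (ss @ ts) R" and A: "A \<subseteq> univ M" and c: "\<And>i::nat. eqt A ts c (c' i)"
    and inc: "\<And>I x. finite I \<Longrightarrow> card I = k \<Longrightarrow> x \<in> tup ss \<Longrightarrow> (\<And>i. i \<in> I \<Longrightarrow> x @ c' i \<in> R) \<Longrightarrow> False"
    and q: "\<And>x. realises M ss x q \<Longrightarrow> x @ c \<in> R"
  shows "forks L M ss q A"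
proof -
  obtain \<phi> b where 1: "set b \<subseteq> A" "wf_fm L ((ss @ ts) @ map (sort_of M) b) \<phi>"
    "R = {x \<in> tup (ss @ ts). sat M \<phi> (x @ b)}" using R by (rule dfbE)
  have ct: "c \<in> tup ts" "\<And>i. c' i \<in> tup ts" using c eqt_tup by blast+
  have bt: "b \<in> tup (map (sort_of M) b)" using 1 A by (intro tuplesI) auto
  have cb: "c @ b \<in> tup (ts @ map (sort_of M) b)" "\<And>i. c' i @ b \<in> tup (ts @ map (sort_of M) b)"
    using tuples_append[OF ct(1) bt] tuples_append[OF ct(2) bt] .
  have "A \<union> set b = A" using 1 by auto
  then have "eqt A (ts @ map (sort_of M) b) (c @ b) (c' i @ b)" for i
    using eqt_abs[of A b ts c "c' i"] c bt by simp
  then have tp: "tp L M (c' i @ b) A = tp L M (c @ b) A" for i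
    using eqt_iff_tp cb by metis
  have h: "holds M (\<phi>, d @ b) x \<longleftrightarrow> x @ d \<in> R" if "x \<in> tup ss" "d \<in> tup ts" for x d
    using tuples_append[OF that] 1(3) by (auto simp: holds_def)
  have "divides L M ss (\<phi>, c @ b) A"
    unfolding divides_def prod.case
  proof (intro exI conjI allI impI)
    show "c' i @ b \<in> tup (map (sort_of M) (c @ b))" for i
      using cb tuples_sorts by metis
    show "tp L M (c' i @ b) A = tp L M (c @ b) A" for i by (rule tp)
    fix I :: "nat set" assume "finite I \<and> card I = k"
    then show "\<not> (\<exists>a\<in>tup ss. \<forall>i\<in>I. holds M (\<phi>, c' i @ b) a)"
      using h[OF _ ct(2)] inc by blast
  qed
  moreover have "(\<phi>, c @ b) \<in> pfms L M ss (univ M)"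
    using 1 A tuples_set[OF ct(1)] tuples_sorts[OF ct(1)] by (auto simp: pfms_def)
  ultimately show ?thesis unfolding forks_def
    using q h[OF _ ct(1)] by (intro exI[of _ "{(\<phi>, c @ b)}"]) (auto simp: realises_def)
qed

end

context gty
begin

section \<open>Definability of an invariant global type\<close>

lemma P_disjoint: "S \<in> P \<Longrightarrow> S \<inter> S' = {} \<Longrightarrow> S' \<notin> P"
  using P_Int P_ne by blast

text \<open>The set given by the defining scheme of \<open>P\<close> at \<open>R\<close>, often
  written \<open>d_P x R(x, y)\<close>. That it is definable is shown below.\<close>

definition pdef :: "'s list \<Rightarrow> 'a list set \<Rightarrow> 'a list set" where
  "pdef ts R = {y \<in> tup ts. {x \<in> tup ss. x @ y \<in> R} \<in> P}"

lemma bounded_exceptions1: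
  assumes inv: "inv A" and A: "A \<subseteq> univ M" "small \<kappa> A" and R: "dfb A (ss @ ts) R"
  obtains n where "\<And>N a y. mor A N a \<Longrightarrow> y \<in> tup ts \<Longrightarrow> {x \<in> tup ss. x @ y \<in> R} \<notin> P \<Longrightarrow>
    card {j. j < N \<and> a j @ y \<in> R} < n"
proof -
  have blk: "blk (Suc 0) a j = a j" for a :: "nat \<Rightarrow> 'a list" and j
    by (simp add: blk_def seg_Suc)
  have R': "dfb A (rep ss (Suc 0) @ ts) R" using R by (simp add: rep_Suc)
  obtain n where n: "\<And>N a y. mor A (N * Suc 0) a \<Longrightarrow> y \<in> tup ts \<Longrightarrow>
    (\<And>b. mor (A \<union> set y) (Suc 0) b \<Longrightarrow> seg b 0 (Suc 0) @ y \<notin> R) \<Longrightarrow>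
    card {j. j < N \<and> blk (Suc 0) a j @ y \<in> R} < n"
    using bounded_exceptions[OF inv A R'] by blast
  show ?thesis
  proof (rule that)
    fix N a y assume a: "mor A N a" and y: "y \<in> tup ts" and no: "{x \<in> tup ss. x @ y \<in> R} \<notin> P"
    have Ay: "A \<union> set y \<subseteq> univ M" using A tuples_set[OF y] by auto
    have "seg b 0 (Suc 0) @ y \<notin> R" if "mor (A \<union> set y) (Suc 0) b" for b
    proof -
      have "rz (A \<union> set y) (b 0)" using that by (auto simp: mor_def)
      from rz_iff[OF this dfb_inst[OF R y] Ay] rz_tup[OF this] no show ?thesis
        by (simp add: seg_Suc)
    qed
    from n[of N a y, OF _ y this] a show "card {j. j < N \<and> a j @ y \<in> R} < n" by (simp add: blk)
  qed
qed

text \<open>The majority vote. \<open>A'\<close> is kept apart from \<open>A\<close>, so that the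
  definition mentions only the parameters of \<open>R\<close> and the voters, and the number of
  voters is the same for all Morley sequences. Both points matter when \<open>A'\<close> is the
  kernel and the voters come from a tail.\<close>

lemma pdef_mor:
  assumes inv: "inv A" and A: "A \<subseteq> univ M" "small \<kappa> A" and A': "A' \<subseteq> dcl L M A" and R': "dfb A' (ss @ ts) R"
  obtains n where "\<And>a. mor A n a \<Longrightarrow> dfb (A' \<union> set (seg a 0 n)) ts (pdef ts R)"
proof -
  have R: "dfb A (ss @ ts) R" using dfb_dcl dfb_mono[OF R' A'] by blast
  obtain n1 where n1: "\<And>N a y. mor A N a \<Longrightarrow> y \<in> tup ts \<Longrightarrow> {x \<in> tup ss. x @ y \<in> R} \<notin> P \<Longrightarrow>
    card {j. j < N \<and> a j @ y \<in> R} < n1" using bounded_exceptions1[OF inv A R] by blast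
  obtain n2 where n2: "\<And>N a y. mor A N a \<Longrightarrow> y \<in> tup ts \<Longrightarrow>
    {x \<in> tup ss. x @ y \<in> tup (ss @ ts) - R} \<notin> P \<Longrightarrow>
    card {j. j < N \<and> a j @ y \<in> tup (ss @ ts) - R} < n2"
    using bounded_exceptions1[OF inv A dfb_Compl[OF R]] by blast
  \<comment> \<open>Fewer than \<open>n1\<close> voters wrongly accept and fewer than
    \<open>n2\<close> wrongly reject, so among \<open>2 * (n1 + n2)\<close> voters the threshold
    \<open>n1 + n2\<close> decides correctly.\<close>
  let ?n = "n1 + n2"
  show ?thesis
  proof (rule that)
    fix a assume a: "mor A (2 * ?n) a"
    then have at: "a j \<in> tup ss" if "j < 2 * ?n" for j using that rz_tup by (auto simp: mor_def)
    let ?V = "\<lambda>j. {y \<in> tup ts. a j @ y \<in> R}"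
    have Vd: "dfb (A' \<union> set (seg a 0 (2 * ?n))) ts (?V j)" if "j < 2 * ?n" for j
    proof -
      have "dfb (A' \<union> set (a j)) ts (?V j)" using dfb_inst_prefix[OF R' at] that .
      moreover have "set (a j) \<subseteq> set (seg a 0 (2 * ?n))" using that by (auto simp: set_seg)
      ultimately show ?thesis using dfb_mono by (meson Un_mono subset_refl)
    qed
    let ?J = "{J. J \<subseteq> {..<2 * ?n} \<and> card J = ?n}"
    let ?W = "\<lambda>J. {y \<in> tup ts. \<forall>S\<in>?V ` J. y \<in> S}"
    have Wd: "dfb (A' \<union> set (seg a 0 (2 * ?n))) ts (\<Union>(?W ` ?J))"
    proof (rule dfb_UN)
      have "finite ?J" by (rule finite_subset[of _ "Pow {..<2 * ?n}"]) auto
      then show "finite (?W ` ?J)" by (rule finite_imageI)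
      fix S assume "S \<in> ?W ` ?J"
      then obtain J where J: "J \<subseteq> {..<2 * ?n}" "S = ?W J" by blast
      have "finite J" using J finite_subset by blast
      then have fi: "finite (?V ` J)" by (rule finite_imageI)
      show "dfb (A' \<union> set (seg a 0 (2 * ?n))) ts S" unfolding J(2)
        by (rule dfb_INT[OF fi]) (use J(1) Vd in blast)
    qed
    have "y \<in> pdef ts R \<longleftrightarrow> y \<in> \<Union>(?W ` ?J)" if y: "y \<in> tup ts" for y
    proof
      let ?K = "{j. j < 2 * ?n \<and> a j @ y \<in> R}" and ?K' = "{j. j < 2 * ?n \<and> a j @ y \<in> tup (ss @ ts) - R}"
      assume "y \<in> pdef ts R"
      then have "{x \<in> tup ss. x @ y \<in> R} \<in> P" by (simp add: pdef_def)
      then have "tup ss - {x \<in> tup ss. x @ y \<in> R} \<notin> P"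
        using P_Compl[OF dfb_inst[OF R y]] A(1) tuples_set[OF y] by simp
      moreover have "tup ss - {x \<in> tup ss. x @ y \<in> R} = {x \<in> tup ss. x @ y \<in> tup (ss @ ts) - R}"
        using y tuples_append by auto
      ultimately have "card ?K' < n2" using n2 a y by simp
      moreover have "?K \<union> ?K' = {..<2 * ?n}" using tuples_append[OF at y] by auto
      moreover have "card (?K \<union> ?K') \<le> card ?K + card ?K'" by (rule card_Un_le)
      ultimately have "?n \<le> card ?K" by simp
      then obtain J where J: "J \<subseteq> ?K" "card J = ?n" by (rule obtain_subset_with_card_n)
      then have "y \<in> ?W J" "J \<in> ?J" using y by auto
      then show "y \<in> \<Union>(?W ` ?J)" by blast
    next
      assume "y \<in> \<Union>(?W ` ?J)"
      then obtain J where J: "J \<subseteq> {..<2 * ?n}" "card J = ?n" "\<And>j. j \<in> J \<Longrightarrow> a j @ y \<in> R" by auto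
      have "card J \<le> card {j. j < 2 * ?n \<and> a j @ y \<in> R}" by (rule card_mono) (use J in auto)
      then have "\<not> card {j. j < 2 * ?n \<and> a j @ y \<in> R} < n1" using J(2) by simp
      then have "{x \<in> tup ss. x @ y \<in> R} \<in> P" using n1[OF a y] by blast
      then show "y \<in> pdef ts R" using y by (simp add: pdef_def)
    qed
    moreover have "pdef ts R \<subseteq> tup ts" "\<Union>(?W ` ?J) \<subseteq> tup ts" by (auto simp: pdef_def)
    ultimately have "pdef ts R = \<Union>(?W ` ?J)" by blast
    then show "dfb (A' \<union> set (seg a 0 (2 * ?n))) ts (pdef ts R)" using Wd by simp
  qed
qed

text \<open>The voters may lie outside \<open>A\<close>; since the set is invariant over
  \<open>A\<close>, \<open>dfb_invariant\<close> removes them from its definition.\<close>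

lemma pdef_dfb:
  assumes inv: "inv A" and A: "A \<subseteq> univ M" "small \<kappa> A" and R: "dfb A (ss @ ts) R"
  shows "dfb A ts (pdef ts R)"
proof -
  obtain n where n: "\<And>a. mor A n a \<Longrightarrow> dfb (A \<union> set (seg a 0 n)) ts (pdef ts R)"
    using pdef_mor[OF inv A dcl_incl[OF A(1)] R] by blast
  obtain a where a: "\<And>n. mor A n a" using mor_ex[OF A] by blast
  have "dfb (univ M) ts (pdef ts R)"
    by (rule dfb_mono[OF n[OF a]]) (use A mor_set[OF a order_refl] in blast)
  then show ?thesis
  proof (rule dfb_invariant[OF _ A])
    fix x y assume "eqt A ts x y" "x \<in> pdef ts R"
    then show "y \<in> pdef ts R" using invD'[OF inv R] eqt_tup by (auto simp: pdef_def)
  qed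
qed

text \<open>A formula of \<open>P\<close> cannot divide over \<open>A\<close>: by invariance all its
  conjugates lie in \<open>P\<close>, and finitely many members of \<open>P\<close> are always
  consistent.\<close>

lemma not_forks:
  assumes inv: "inv A" and A: "A \<subseteq> univ M" and D: "D \<subseteq> univ M" "small \<kappa> D"
    and q: "\<And>x. rz D x \<Longrightarrow> realises M ss x q"
  shows "\<not> forks L M ss q A"
proof
  assume "forks L M ss q A"
  then obtain \<Psi> where Psi: "finite \<Psi>" "\<Psi> \<subseteq> pfms L M ss (univ M)" "\<forall>\<psi>\<in>\<Psi>. divides L M ss \<psi> A"
    "\<And>a. realises M ss a q \<Longrightarrow> \<exists>\<psi>\<in>\<Psi>. holds M \<psi> a" unfolding forks_def by blast
  let ?E = "\<Union>\<psi>\<in>\<Psi>. set (snd \<psi>)"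
  have E: "?E \<subseteq> univ M" "finite ?E" using Psi by (fastforce simp: pfms_def, blast)
  obtain l where "set l = ?E" using finite_list[OF E(2)] by blast
  then have "small \<kappa> ?E" using small_set by metis
  \<comment> \<open>With the parameters of the finitely many dividing formulas added to the base, a
    formula that holds at \<open>x\<close> lies in \<open>P\<close>.\<close>
  then obtain x where x: "rz (D \<union> ?E) x" using rz_ex[of "D \<union> ?E"] D E small_Un by blast
  have "realises M ss x q" using q rz_mono[OF x] by blast
  then obtain \<psi> where psi: "\<psi> \<in> \<Psi>" "holds M \<psi> x" using Psi(4) by blast
  obtain \<phi> c where pc: "\<psi> = (\<phi>, c)" by (cases \<psi>)
  have pf: "wf_fm L (ss @ map (sort_of M) c) \<phi>" "set c \<subseteq> univ M"
    using psi Psi(2) pc by (auto simp: pfms_def)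
  then have ct: "c \<in> tup (map (sort_of M) c)" by (intro tuplesI)
  let ?R = "{z \<in> tup (ss @ map (sort_of M) c). sat M \<phi> (z @ [])}"
  have R: "dfb {} (ss @ map (sort_of M) c) ?R"
    by (rule dfbI[OF refl]) (use pf in \<open>simp add: pfms_def\<close>)
  have RA: "dfb A (ss @ map (sort_of M) c) ?R" using dfb_mono[OF R] by simp
  have ds: "dset ss (\<phi>, d) = {x \<in> tup ss. x @ d \<in> ?R}" if "d \<in> tup (map (sort_of M) c)" for d
    using that by (auto simp: dset_def holds_def tuples_append)
  have "dfb (set c) ss (dset ss (\<phi>, c))" using dfb_inst[OF R ct] ds[OF ct] by simp
  moreover have "set c \<subseteq> D \<union> ?E" using psi pc by force
  ultimately have "dfb (D \<union> ?E) ss (dset ss (\<phi>, c))" using dfb_mono by blast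
  from rz_iff[OF x this] have cP: "dset ss (\<phi>, c) \<in> P"
    using psi pc rz_tup[OF x] E D by (auto simp: dset_def)
  have "divides L M ss (\<phi>, c) A" using Psi(3) psi(1) pc by simp
  then obtain k and c' :: "nat \<Rightarrow> 'a list" where
    c'0: "\<forall>i. c' i \<in> tup (map (sort_of M) c) \<and> tp L M (c' i) A = tp L M c A"
    and inc: "\<forall>I. finite I \<and> card I = k \<longrightarrow> \<not> (\<exists>a\<in>tup ss. \<forall>i\<in>I. holds M (\<phi>, c' i) a)"
    unfolding divides_def prod.case by (elim exE conjE)
  then have c': "c' i \<in> tup (map (sort_of M) c)" "tp L M (c' i) A = tp L M c A" for i by auto
  have "dset ss (\<phi>, c' i) \<in> P" for i
  proof -
    have "eqt A (map (sort_of M) c) c (c' i)" using c' ct eqt_iff_tp by metis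
    from invD'[OF inv RA this] cP ds ct c'(1) show ?thesis by simp
  qed
  then have "{x \<in> tup ss. \<forall>S\<in>(\<lambda>i. dset ss (\<phi>, c' i)) ` {..<k}. x \<in> S} \<in> P"
    by (intro P_INT) auto
  then obtain z where "z \<in> tup ss" "\<forall>i<k. z \<in> dset ss (\<phi>, c' i)" using P_ne by fastforce
  then show False using inc[rule_format, of "{..<k}"] by (auto simp: dset_def)
qed

lemma rz_eqt:
  assumes "rz A x" "rz A y" "A \<subseteq> univ M" shows "eqt A ss x y"
  using assms rz_iff rz_tup unfolding eqt_def by blast

text \<open>One half of the symmetry of forking: the formula witnessing that \<open>a n\<close> does not realise \<open>P\<close>
  over the previous elements divides, because along a Morley sequence of \<open>P\<close> it holds only
  finitely often.\<close>

lemma mor_if_independent: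
  assumes inv: "inv A" and A: "A \<subseteq> univ M" "small \<kappa> A" and a: "\<And>i. rz A (a i)"
    and ind: "\<And>n. independent L M (seg a 0 n) (a n) A"
  shows "mor A n a"
proof (induction n)
  case (Suc n)
  let ?u = "seg a 0 n" and ?ts = "rep ss n"
  have u: "?u \<in> tup ?ts" using mor_tup[OF Suc, of 0 n] by simp
  have "rz (A \<union> set ?u) (a n)" unfolding rz_def
  proof (intro conjI ballI impI)
    show "a n \<in> tup ss" using a rz_tup by blast
    fix S assume SP: "S \<in> P" and Sd: "dfb (A \<union> set ?u) ss S"
    obtain R where R: "dfb A (?ts @ ss) R" "S = {x \<in> tup ss. ?u @ x \<in> R}"
      using dfb_abs_prefix[OF Sd u] .
    show "a n \<in> S"
    proof (rule ccontr)
      assume no: "a n \<notin> S"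
      let ?R1 = "swapset ?ts ss R"
      have R1: "dfb A (ss @ ?ts) ?R1" by (rule dfb_swap[OF R(1)])
      have R1i: "x @ y \<in> ?R1 \<longleftrightarrow> y @ x \<in> R" if "x \<in> tup ss" "y \<in> tup ?ts" for x y
        using that swapset_iff[OF tuples_length] by blast
      let ?\<rho> = "pdef ?ts ?R1"
      have rho: "dfb A ?ts ?\<rho>" by (rule pdef_dfb[OF inv A R1])
      have "{x \<in> tup ss. x @ ?u \<in> ?R1} = S" using R(2) R1i u by blast
      then have ur: "?u \<in> ?\<rho>" using u SP by (simp add: pdef_def)
      let ?C = "{y @ x | y x. y \<in> ?\<rho> \<and> x \<in> tup ss}"
      have C: "y @ x \<in> ?C \<longleftrightarrow> y \<in> ?\<rho>" if "y \<in> tup ?ts" "x \<in> tup ss" for x y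
        using cylinder_iff[OF dfb_sub[OF rho] tuples_length[OF that(1)]] that(2) by blast
      \<comment> \<open>This set says of \<open>y\<close> and \<open>x\<close> that the instance of
        \<open>R\<close> at \<open>y\<close> lies in \<open>P\<close> while \<open>x\<close>
        violates it. It contains the pair of \<open>?u\<close> and \<open>a n\<close>; with
        \<open>a n\<close> replaced by members of a Morley sequence, no \<open>y\<close> satisfies
        \<open>k\<close> of the instances.\<close>
      have R2: "dfb A (?ts @ ss) (?C - R)" by (rule dfb_Diff[OF dfb_cylinder[OF rho] R(1)])
      obtain b where b: "\<And>n. mor A n b" using mor_ex[OF A] by blast
      have bz: "rz A (b i)" for i using b[of "Suc i"] rz_mono unfolding mor_def by blast
      have bt: "b i \<in> tup ss" for i using bz rz_tup by blast
      obtain k where k: "\<And>N b y. mor A N b \<Longrightarrow> y \<in> tup ?ts \<Longrightarrow>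
        {x \<in> tup ss. x @ y \<in> tup (ss @ ?ts) - ?R1} \<notin> P \<Longrightarrow>
        card {j. j < N \<and> b j @ y \<in> tup (ss @ ?ts) - ?R1} < k"
        using bounded_exceptions1[OF inv A dfb_Compl[OF R1]] by blast
      have "forks L M ?ts (tp L M ?u (A \<union> set (a n))) A"
      proof (rule forksI[OF R2 A(1)])
        show "eqt A ss (a n) (b i)" for i by (rule rz_eqt[OF a bz A(1)])
        show "y @ a n \<in> ?C - R" if "realises M ?ts y (tp L M ?u (A \<union> set (a n)))" for y
        proof -
          have e: "eqt (A \<union> set (a n)) ?ts ?u y" using that realises_tp_iff[OF u] by simp
          have "?u @ a n \<in> ?C - R" using C u ur no R(2) rz_tup[OF a] by auto
          then show ?thesis using eqtD[OF eqt_abs[OF e rz_tup[OF a]] R2] by simp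
        qed
        fix I :: "nat set" and y assume I: "finite I" "card I = k" "y \<in> tup ?ts"
          "\<And>i. i \<in> I \<Longrightarrow> y @ b i \<in> ?C - R"
        show False
        proof (cases "I = {}")
          \<comment> \<open>The bound \<open>k\<close> cannot be \<open>0\<close>, as it strictly
            exceeds a cardinality.\<close>
          case True
          then have "k = 0" using I by simp
          have "{x \<in> tup ss. x @ ?u \<in> tup (ss @ ?ts) - ?R1} \<notin> P"
          proof -
            have "{x \<in> tup ss. x @ ?u \<in> tup (ss @ ?ts) - ?R1} \<inter> S = {}"
              using R(2) R1i u by auto
            then show ?thesis using P_disjoint[OF SP] by (simp add: Int_commute)
          qed
          from k[OF b[of 0] u this] show False using \<open>k = 0\<close> by simp
        next
          case False
          then obtain i where "i \<in> I" by blast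
          then have yr: "y \<in> ?\<rho>" using I C bt by blast
          then have "{x \<in> tup ss. x @ y \<in> ?R1} \<in> P" by (simp add: pdef_def)
          then have "{x \<in> tup ss. x @ y \<in> tup (ss @ ?ts) - ?R1} \<notin> P"
            by (rule P_disjoint) auto
          from k[OF b I(3) this]
          have "card {j. j < Suc (Max I) \<and> b j @ y \<in> tup (ss @ ?ts) - ?R1} < k" .
          moreover have "I \<subseteq> {j. j < Suc (Max I) \<and> b j @ y \<in> tup (ss @ ?ts) - ?R1}"
            using I R1i bt tuples_append[OF bt I(3)] by (auto simp: less_Suc_eq_le)
          then have "card I \<le> card {j. j < Suc (Max I) \<and> b j @ y \<in> tup (ss @ ?ts) - ?R1}"
            by (rule card_mono[rotated]) simp
          ultimately show False using I(2) by simp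
        qed
      qed
      then show False using ind[of n] tuples_sorts[OF u] by (simp add: independent_def)
    qed
  qed
  then show ?case using Suc by (auto simp: mor_def less_Suc_eq)
qed (simp add: mor_def)

text \<open>If \<open>q\<close> contains \<open>\<phi>(x, c)\<close> but \<open>P\<close> does not, choose a Morley sequence \<open>b\<close> of \<open>P\<close> over \<open>A\<close> of
  maximal length all of whose members satisfy \<open>\<phi>(x, c')\<close> for some \<open>c'\<close> of the type of \<open>c\<close> over \<open>A\<close>.
  By maximality \<open>\<phi>(x, c')\<close> is inconsistent with some formula \<open>\<chi>(x, b)\<close> of \<open>P\<close>. Along a sequence
  of copies \<open>(b\<^sub>j, c\<^sub>j)\<close> whose first parts form a Morley sequence, a realisation of \<open>P\<close>
  over \<open>A\<close> satisfies all but boundedly many of the \<open>\<chi>(x, b\<^sub>j)\<close>, so \<open>\<phi>(x, c)\<close> divides.\<close>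

lemma nonforking_unique:
  assumes inv: "inv A" and A: "A \<subseteq> univ M" "small \<kappa> A"
    and ext: "\<And>x. realises M ss x q \<Longrightarrow> rz A x"
    and R: "dfb A (ss @ ts) R" and c: "c \<in> tup ts"
    and q: "\<And>x. realises M ss x q \<Longrightarrow> x @ c \<in> R"
    and nf: "\<not> forks L M ss q A"
  shows "{x \<in> tup ss. x @ c \<in> R} \<in> P"
proof (rule ccontr)
  assume no: "\<not> ?thesis"
  obtain n0 where n0: "\<And>N a y. mor A N a \<Longrightarrow> y \<in> tup ts \<Longrightarrow> {x \<in> tup ss. x @ y \<in> R} \<notin> P \<Longrightarrow>
    card {j. j < N \<and> a j @ y \<in> R} < n0" using bounded_exceptions1[OF inv A R] by blast
  have noc: "{x \<in> tup ss. x @ c' \<in> R} \<notin> P" if "eqt A ts c c'" for c'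
    using invD'[OF inv R that] no by simp
  let ?Q = "\<lambda>m. \<exists>b c'. eqt A ts c c' \<and> mor A m b \<and> (\<forall>j<m. b j @ c' \<in> R)"
  have bnd: "m < n0" if Q: "?Q m" for m
  proof -
    obtain b c' where *: "eqt A ts c c'" "mor A m b" "\<forall>j<m. b j @ c' \<in> R" using Q by blast
    then have "{j. j < m \<and> b j @ c' \<in> R} = {..<m}" by auto
    then show ?thesis using n0[OF *(2) eqt_tup(2)[OF *(1)] noc[OF *(1)]] by simp
  qed
  define m where "m = (GREATEST m. ?Q m)"
  have "?Q 0" using eqt_refl[OF c] by (auto simp: mor_def)
  then have Qm: "?Q m"
    unfolding m_def using GreatestI_nat[of ?Q 0 n0] bnd less_imp_le by blast
  have max: "k \<le> m" if "?Q k" for k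
    unfolding m_def using Greatest_le_nat[of ?Q k n0] that bnd less_imp_le by blast
  obtain b c' where c': "eqt A ts c c'" and b: "mor A m b" and bc: "\<forall>j<m. b j @ c' \<in> R" using Qm by blast
  let ?u = "seg b 0 m" and ?us = "rep ss m"
  have u: "?u \<in> tup ?us" using mor_tup[OF b, of 0 m] by simp
  have c't: "c' \<in> tup ts" using eqt_tup[OF c'] by blast
  have Au: "A \<union> set ?u \<subseteq> univ M" "small \<kappa> (A \<union> set ?u)"
    using A tuples_set[OF u] by (auto intro: small_Un small_set)
  have nR: "x @ c' \<notin> R" if x: "rz (A \<union> set ?u) x" for x
  proof
    assume xR: "x @ c' \<in> R"
    let ?b = "\<lambda>i. if i < m then b i else x"
    have "mor A (Suc m) ?b"
    proof -
      have "mor (A \<union> set ?u) 1 (\<lambda>_. x)" using x by (simp add: mor_def)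
      from mor_join[OF b this] show ?thesis by simp
    qed
    moreover have "\<forall>j<Suc m. ?b j @ c' \<in> R" using bc xR by (auto simp: less_Suc_eq)
    ultimately have "?Q (Suc m)" using c' by blast
    then show False using max by fastforce
  qed
  obtain S where S: "S \<in> P" "dfb (A \<union> set ?u) ss S" "\<And>x. x \<in> S \<Longrightarrow> x @ c' \<notin> R"
  proof -
    let ?F = "insert {x \<in> tup ss. x @ c' \<in> R} {S \<in> P. dfb (A \<union> set ?u) ss S}"
    let ?A = "A \<union> set ?u \<union> set c'"
    have A': "?A \<subseteq> univ M" "small \<kappa> ?A"
      using Au tuples_set[OF c't] by (auto intro!: small_Un small_set)
    obtain G where G: "finite G" "G \<subseteq> ?F" "{x \<in> tup ss. \<forall>S\<in>G. x \<in> S} = {}"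
    proof (rule compactness[OF A', of ?F ss])
      fix S assume "S \<in> ?F"
      moreover have "dfb ?A ss {x \<in> tup ss. x @ c' \<in> R}"
        by (rule dfb_mono[OF dfb_inst[OF R c't]]) auto
      ultimately show "dfb ?A ss S" using dfb_mono[of "A \<union> set ?u" ss _ ?A] by auto
    next
      fix x assume x: "x \<in> tup ss"
      show "\<exists>S\<in>?F. x \<notin> S"
      proof (rule ccontr)
        assume "\<not> ?thesis"
        then have "rz (A \<union> set ?u) x" "x @ c' \<in> R" using x by (auto simp: rz_def)
        then show False using nR by blast
      qed
    qed simp
    let ?G = "G - {{x \<in> tup ss. x @ c' \<in> R}}"
    let ?S = "{x \<in> tup ss. \<forall>S\<in>?G. x \<in> S}"
    show ?thesis
    proof (rule that)
      show "?S \<in> P" using G by (intro P_INT) auto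
      show "dfb (A \<union> set ?u) ss ?S" using G by (intro dfb_INT) auto
      fix x assume x: "x \<in> ?S"
      show "x @ c' \<notin> R"
      proof
        assume "x @ c' \<in> R"
        then have "\<forall>S\<in>G. x \<in> S" using x by auto
        then show False using G(3) x by blast
      qed
    qed
  qed
  obtain X where X: "dfb A (?us @ ss) X" "S = {x \<in> tup ss. ?u @ x \<in> X}"
    using dfb_abs_prefix[OF S(2) u] .
  let ?Y = "tup (?us @ ss) - X"
  have Y: "dfb A (?us @ ss) ?Y" by (rule dfb_Compl[OF X(1)])
  obtain a where a: "\<And>n. mor A n a" using mor_ex[OF A] by blast
  have at: "a i \<in> tup ss" for i using a[of "Suc i"] rz_tup by (auto simp: mor_def)
  \<comment> \<open>\<open>S\<close> was found for an element generic over the tuple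
    \<open>?u\<close>, whereas here the tuple is generic over the element;
    \<open>mor_commute\<close> exchanges the two orders.\<close>
  have gen: "seg d 0 m @ x \<notin> ?Y" if x: "rz A x" and d: "mor (A \<union> set x) m d" for x d
  proof -
    have sp: "seg e 0 (1 + m) = seg e 0 1 @ seg e 1 (1 + m)" for e :: "nat \<Rightarrow> 'a list"
      by (rule seg_append) auto
    have "mor A 1 (\<lambda>_. x)" using x by (simp add: mor_def)
    moreover have "seg (\<lambda>_. x) 0 1 = x" by (simp add: seg_Suc)
    ultimately have "mor A (1 + m) (\<lambda>i. if i < 1 then x else d (i - 1))" (is "mor A _ ?d")
      using mor_join[of A 1 "\<lambda>_. x" m d] d by simp
    from mor_eqt0[OF inv A(1) this a[of "1 + m"]]
    have "eqt A (ss @ ?us) (seg ?d 0 1 @ seg ?d 1 (1 + m)) (seg a 0 1 @ seg a 1 (1 + m))"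
      unfolding sp by (simp add: rep_Suc')
    moreover have "seg ?d 1 (1 + m) = seg d 0 (0 + m)" by (rule seg_cong) simp
    moreover have "seg ?d 0 1 = x" "seg a 0 1 = a 0" by (simp_all add: seg_Suc)
    ultimately have "eqt A (ss @ ?us) (x @ seg d 0 m) (a 0 @ seg a 1 (Suc m))" by simp
    then have 1: "eqt A (?us @ ss) (seg d 0 m @ x) (seg a 1 (Suc m) @ a 0)"
      by (rule eqt_swap) (use rz_tup[OF x] at tuples_length in blast)+
    obtain z where z: "rz (A \<union> set ?u) z" using rz_ex[OF Au] .
    have "mor (A \<union> set ?u) 1 (\<lambda>_. z)" using z by (simp add: mor_def)
    from mor_join[OF b this] have "mor A (Suc m) (\<lambda>i. if i < m then b i else z)" (is "mor A _ ?b") by simp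
    from mor_eqt0[OF inv A(1) this a]
    have "eqt A (?us @ ss) (seg ?b 0 m @ z) (seg a 0 m @ a m)" by (simp add: seg_Suc rep_Suc)
    moreover have "seg ?b 0 (0 + m) = seg b 0 (0 + m)" by (rule seg_cong) simp
    ultimately have 2: "eqt A (?us @ ss) (?u @ z) (seg a 0 m @ a m)" by simp
    have "z \<in> S" using S z by (auto simp: rz_def)
    then have "?u @ z \<notin> ?Y" using X by auto
    then have "seg a 0 m @ a m \<notin> ?Y" using eqtD[OF 2 Y] by blast
    then have "seg a 1 (Suc m) @ a 0 \<notin> ?Y" using mor_commute[OF inv A(1) Y a] by blast
    then show ?thesis using eqtD[OF 1 Y] by blast
  qed
  obtain n1 where n1: "\<And>N a y. mor A (N * m) a \<Longrightarrow> y \<in> tup ss \<Longrightarrow>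
    (\<And>b. mor (A \<union> set y) m b \<Longrightarrow> seg b 0 m @ y \<notin> ?Y) \<Longrightarrow> card {j. j < N \<and> blk m a j @ y \<in> ?Y} < n1"
    using bounded_exceptions[OF inv A Y] by blast
  have blkt: "blk m a j \<in> tup ?us" for j unfolding blk_def by (rule tup_seg) (rule at)
  \<comment> \<open>The bound \<open>n1\<close> concerns realisations of \<open>P\<close> over
    \<open>A\<close>, that is, infinitely many conditions. \<open>V\<close> collects finitely many
    of them that already force one of the first \<open>n1\<close> blocks to fail
    \<open>?Y\<close>.\<close>
  obtain V where V: "V \<in> P" "dfb A ss V" "\<And>x. x \<in> V \<Longrightarrow> \<exists>j<n1. blk m a j @ x \<notin> ?Y"
  proof -
    let ?W = "\<lambda>j. {x \<in> tup ss. blk m a j @ x \<in> ?Y}"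
    let ?F = "?W ` {..<n1} \<union> {S \<in> P. dfb A ss S}"
    let ?A = "A \<union> set (seg a 0 (n1 * m))"
    have A': "?A \<subseteq> univ M" "small \<kappa> ?A"
      using A mor_set[OF a order_refl] by (auto intro!: small_Un small_set)
    have sub: "set (blk m a j) \<subseteq> set (seg a 0 (n1 * m))" if "j < n1" for j
    proof -
      have "j * m + m \<le> n1 * m" using that by (metis Suc_leI mult_Suc mult_le_mono1 add.commute)
      then show ?thesis unfolding blk_def set_seg by (intro UN_mono) auto
    qed
    obtain G where G: "finite G" "G \<subseteq> ?F" "{x \<in> tup ss. \<forall>S\<in>G. x \<in> S} = {}"
    proof (rule compactness[OF A', of ?F ss])
      fix S assume "S \<in> ?F"
      moreover have "dfb ?A ss (?W j)" if "j < n1" for j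
        by (rule dfb_mono[OF dfb_inst_prefix[OF Y blkt]]) (use sub[OF that] in auto)
      ultimately show "dfb ?A ss S" using dfb_mono[of A ss _ ?A] by auto
    next
      fix x assume x: "x \<in> tup ss"
      show "\<exists>S\<in>?F. x \<notin> S"
      proof (rule ccontr)
        assume none: "\<not> ?thesis"
        have all: "x \<in> S" if "S \<in> ?F" for S
        proof (rule ccontr)
          assume "x \<notin> S"
          then have "\<exists>S\<in>?F. x \<notin> S" using that by (rule bexI)
          with none show False by (rule notE)
        qed
        have "x \<in> S" if "S \<in> P" "dfb A ss S" for S by (rule all, rule UnI2) (simp add: that)
        then have xz: "rz A x" using x by (simp add: rz_def)
        have xW: "blk m a j @ x \<in> ?Y" if "j < n1" for j
        proof -
          have "x \<in> ?W j" by (rule all, rule UnI1, rule imageI) (simp add: that)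
          then show ?thesis by (simp only: mem_Collect_eq)
        qed
        have "{j. j < n1 \<and> blk m a j @ x \<in> ?Y} = {..<n1}" using xW by auto
        then show False using n1[OF a x, OF gen[OF xz], of n1] by simp
      qed
    qed simp
    let ?G = "G - ?W ` {..<n1}"
    let ?S = "{x \<in> tup ss. \<forall>S\<in>?G. x \<in> S}"
    show ?thesis
    proof (rule that)
      show "?S \<in> P" using G by (intro P_INT) auto
      show "dfb A ss ?S" using G by (intro dfb_INT) auto
      fix x assume x: "x \<in> ?S"
      show "\<exists>j<n1. blk m a j @ x \<notin> ?Y"
      proof (rule ccontr)
        assume "\<not> ?thesis"
        then have "\<forall>S\<in>G. x \<in> S" using x by auto
        then show False using G(3) x by blast
      qed
    qed
  qed
  have n1_pos: "0 < n1" using V(3) P_ne[OF V(1)] by fastforce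
  \<comment> \<open>The tuple \<open>d j\<close> is to block \<open>j\<close> as \<open>c'\<close>
    is to \<open>?u\<close>.\<close>
  have "\<exists>d. d \<in> tup ts \<and> eqt A (?us @ ts) (?u @ c') (blk m a j @ d)" for j
  proof -
    have "mor A m (\<lambda>i. a (j * m + i))" using mor_mono[OF mor_shift[OF a]] by blast
    from mor_eqt0[OF inv A(1) b this] have "eqt A ?us ?u (seg (\<lambda>i. a (j * m + i)) 0 (0 + m))" by simp
    also have "seg (\<lambda>i. a (j * m + i)) 0 (0 + m) = blk m a j" unfolding blk_def by (rule seg_cong) simp
    finally show ?thesis using homog[OF A _ c't] by metis
  qed
  then obtain d where d: "\<And>j. d j \<in> tup ts" "\<And>j. eqt A (?us @ ts) (?u @ c') (blk m a j @ d j)" by metis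
  have cd: "eqt A ts c (d j)" for j
  proof -
    have "eqt A ts c' (d j)" using eqt_suffix[OF d(2)] u blkt tuples_length by blast
    then show ?thesis using c' eqt_trans by blast
  qed
  \<comment> \<open>The incompatibility of \<open>S\<close> with the instance of \<open>R\<close> at
    \<open>c'\<close> is carried over to block \<open>j\<close> and \<open>d j\<close>.\<close>
  have dis: "blk m a j @ x \<in> ?Y" if x: "x \<in> tup ss" "x @ d j \<in> R" for x j
  proof (rule ccontr)
    assume "blk m a j @ x \<notin> ?Y"
    then have xX: "blk m a j @ x \<in> X" using tuples_append[OF blkt x(1)] by blast
    obtain x' where x': "x' \<in> tup ss" "eqt A ((?us @ ts) @ ss) ((blk m a j @ d j) @ x) ((?u @ c') @ x')"
      using homog[OF A eqt_sym[OF d(2)] x(1)] .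
    have l: "length (blk m a j) = length ?us" "length ?u = length ?us" "length (d j) = length ts"
      "length c' = length ts"
      using tuples_length[OF blkt] tuples_length[OF u] tuples_length[OF d(1)] tuples_length[OF c't] by auto
    have "eqt A (?us @ ss) (blk m a j @ x) (?u @ x')"
      by (rule eqt_drop_middle[of A ?us ts ss _ "d j" _ ?u c']) (use x'(2) l in auto)
    then have "?u @ x' \<in> X" using eqtD X(1) xX by blast
    then have "x' \<in> S" using X(2) x'(1) by blast
    moreover have "eqt A (ts @ ss) (d j @ x) (c' @ x')"
      by (rule eqt_suffix[of A ?us _ "blk m a j" _ ?u]) (use x'(2) l in auto)
    then have "eqt A (ss @ ts) (x @ d j) (x' @ c')" by (rule eqt_swap) (use l in auto)
    then have "x' @ c' \<in> R" using eqtD R x(2) by blast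
    ultimately show False using S(3) by blast
  qed
  \<comment> \<open>\<open>V\<close> was chosen for the first \<open>n1\<close> blocks. Any other
    \<open>n1\<close> blocks in increasing order form a sequence of the same type, and the element
    \<open>y\<close> to which \<open>x\<close> is moved has the type of \<open>x\<close> over
    \<open>A\<close>, so it remains in \<open>V\<close>.\<close>
  have blkV: "\<exists>j\<in>I. blk m a j @ x \<notin> ?Y" if I: "finite I" "card I = n1" and x: "x \<in> V" for I x
  proof (rule ccontr)
    assume "\<not> ?thesis"
    then have all: "blk m a j @ x \<in> ?Y" if "j \<in> I" for j using that by meson
    define fs where "fs = sorted_list_of_set I"
    have fs: "set fs = I" "sorted_wrt (<) fs" "length fs = n1" using I by (auto simp: fs_def)
    have f_less: "fs ! i < fs ! j" if "i < j" "j < n1" for i j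
      using fs(2,3) that sorted_wrt_nth_less by metis
    have xt: "x \<in> tup ss" using dfb_sub[OF V(2)] x by blast
    have fI: "fs ! i \<in> I" if "i < n1" for i using fs(1) nth_mem[of i fs] that fs(3) by simp
    then have fN: "fs ! i < Suc (Max (insert 0 I))" if "i < n1" for i
      using that I(1) by (simp add: less_Suc_eq_le)
    obtain b' where b': "mor A (n1 * m) b'" and bb: "\<And>j. blk m b' j = blk m a (fs ! j)"
      using mor_thin[of A "Suc (Max (insert 0 I))" m a n1 "(!) fs", OF a fN f_less] by metis
    from mor_transfer[OF inv A b' a xt] obtain y where y: "y \<in> tup ss"
      "\<And>j. j < n1 \<Longrightarrow> eqt A (?us @ ss) (blk m a (fs ! j) @ x) (blk m a j @ y)"
      unfolding bb by metis
    have "eqt A ss x y" using eqt_suffix[OF y(2)[OF n1_pos]] blkt tuples_length by blast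
    then have "y \<in> V" using eqtD V(2) x by blast
    then obtain j where j: "j < n1" "blk m a j @ y \<notin> ?Y" using V(3) by blast
    then show False using eqtD[OF y(2)[OF j(1)] Y] all fI by blast
  qed
  let ?C = "{x @ y | x y. x \<in> V \<and> y \<in> tup ts}"
  have C: "x @ y \<in> ?C \<longleftrightarrow> x \<in> V" if "x \<in> tup ss" "y \<in> tup ts" for x y
    using cylinder_iff[OF dfb_sub[OF V(2)] tuples_length[OF that(1)]] that(2) by blast
  have "forks L M ss q A"
  proof (rule forksI[OF dfb_Int[OF dfb_cylinder[OF V(2)] R] A(1) cd])
    fix I x assume I: "finite I" "card I = n1" "x \<in> tup ss" "\<And>i. i \<in> I \<Longrightarrow> x @ d i \<in> ?C \<inter> R"
    then obtain i where "i \<in> I" using n1_pos by fastforce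
    then have "x \<in> V" using I(4) C I(3) d(1) by blast
    then show False using blkV[OF I(1,2)] dis I(3,4) by blast
  next
    fix x assume x: "realises M ss x q"
    have "x \<in> V" "x \<in> tup ss" using ext[OF x] V by (auto simp: rz_def)
    then show "x @ c \<in> ?C \<inter> R" using C c q[OF x] by blast
  qed
  then show False using nf by blast
qed

end

section \<open>The global nonforking extension of a stationary type\<close>

context mstruc
begin

lemma tp_iff: "x \<in> tup ss \<Longrightarrow> \<psi> \<in> tp L M x D \<longleftrightarrow> \<psi> \<in> pfms L M ss D \<and> x \<in> dset ss \<psi>"
  by (auto simp: tp_def dset_def tuples_sorts)

lemma tp_complete:
  assumes "x \<in> tup ss" shows "tp L M x D \<in> complete_types L M ss D"
proof -
  have "fin_sat M ss (tp L M x D)"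
    unfolding fin_sat_def using assms
    by (intro allI impI exI[of _ x]) (auto simp: realises_def tp_def)
  moreover have "(\<phi>, b) \<in> tp L M x D \<or> (Neg \<phi>, b) \<in> tp L M x D"
    if "(\<phi>, b) \<in> pfms L M ss D" for \<phi> b
    using that pfms_Neg[OF that] assms dset_Neg[of ss \<phi> b] by (auto simp: tp_iff)
  ultimately show ?thesis using assms by (auto simp: complete_types_def tp_iff)
qed

lemma complete_type_eq_tp:
  assumes "q \<in> complete_types L M ss D" "realises M ss x q"
  shows "q = tp L M x D"
proof -
  have x: "x \<in> tup ss" using assms(2) by (simp add: realises_def)
  have "\<psi> \<in> q" if psi: "\<psi> \<in> pfms L M ss D" "x \<in> dset ss \<psi>" for \<psi>
  proof (rule ccontr)
    obtain \<phi> b where pb: "\<psi> = (\<phi>, b)" by (cases \<psi>)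
    assume "\<psi> \<notin> q"
    then have "(Neg \<phi>, b) \<in> q" using assms(1) psi pb by (auto simp: complete_types_def)
    then show False using assms(2) psi pb by (auto simp: realises_def dset_def holds_def)
  qed
  moreover have "\<psi> \<in> pfms L M ss D \<and> x \<in> dset ss \<psi>" if "\<psi> \<in> q" for \<psi>
    using that assms x by (auto simp: complete_types_def realises_def dset_def)
  ultimately show ?thesis using x by (auto simp: tp_iff)
qed

lemma tp_subset: "x \<in> tup ss \<Longrightarrow> D \<subseteq> D' \<Longrightarrow> tp L M x D \<subseteq> tp L M x D'"
  by (auto simp: tp_def pfms_def)

lemma forks_mono:
  "forks L M ss q A \<Longrightarrow> (\<And>x. realises M ss x q' \<Longrightarrow> realises M ss x q) \<Longrightarrow> forks L M ss q' A"
  unfolding forks_def by meson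

end

context sstruc
begin

lemma complete_type_realised:
  assumes "q \<in> complete_types L M ss D" "D \<subseteq> univ M" "small \<kappa> D"
  shows "\<exists>x. realises M ss x q"
  using sat assms unfolding saturated_def complete_types_def by blast

text \<open>Forking is preserved by conjugation. In the absence of automorphisms the parameters of
  the witnessing formulas have to be moved explicitly: they are collected in one tuple
  \<open>d\<close>, whose image \<open>d'\<close> supplies the new parameters.\<close>

lemma forks_transfer:
  assumes B: "B \<subseteq> univ M" "small \<kappa> B" and e: "eqt B (ts @ ss) (c @ x) (c' @ x')"
    and l: "length c = length ts" "length c' = length ts"
    and f: "forks L M ss (tp L M x' (B \<union> set c')) B"
  shows "forks L M ss (tp L M x (B \<union> set c)) B"
proof -
  have t: "c \<in> tup ts" "c' \<in> tup ts" "x \<in> tup ss" "x' \<in> tup ss"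
    using eqt_tup[OF e] l by (simp_all add: tuples_append_iff)
  obtain \<Psi> where Psi: "finite \<Psi>" "\<Psi> \<subseteq> pfms L M ss (univ M)" "\<forall>\<psi>\<in>\<Psi>. divides L M ss \<psi> B"
    "\<And>y. realises M ss y (tp L M x' (B \<union> set c')) \<Longrightarrow> \<exists>\<psi>\<in>\<Psi>. holds M \<psi> y"
    using f unfolding forks_def by blast
  have "finite (\<Union>\<psi>\<in>\<Psi>. set (snd \<psi>))" using Psi(1) by blast
  from finite_list[OF this] obtain d where d: "set d = (\<Union>\<psi>\<in>\<Psi>. set (snd \<psi>))" by (elim exE)
  let ?ds = "map (sort_of M) d"
  have "set d \<subseteq> univ M" unfolding d using Psi(2) by (force simp: pfms_def)
  then have dt: "d \<in> tup ?ds" by (rule tuplesI)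
  obtain d' where d': "d' \<in> tup ?ds" "eqt B ((ts @ ss) @ ?ds) ((c' @ x') @ d) ((c @ x) @ d')"
    using homog[OF B eqt_sym[OF e] dt] .
  \<comment> \<open>Each parameter list is addressed by positions in \<open>d\<close>, so that it
    can be read off \<open>d'\<close> as well.\<close>
  have "\<exists>ix. snd \<psi> = map ((!) d) ix \<and> set ix \<subseteq> {..<length d}" if "\<psi> \<in> \<Psi>" for \<psi>
  proof -
    have "\<forall>i<length (snd \<psi>). \<exists>j<length d. d ! j = snd \<psi> ! i"
      using that d by (metis UN_I in_set_conv_nth nth_mem)
    then obtain h where "\<And>i. i < length (snd \<psi>) \<Longrightarrow> h i < length d \<and> d ! h i = snd \<psi> ! i" by metis
    then have "snd \<psi> = map ((!) d) (map h [0..<length (snd \<psi>)])"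
      "set (map h [0..<length (snd \<psi>)]) \<subseteq> {..<length d}"
      by (auto intro: nth_equalityI)
    then show ?thesis by blast
  qed
  then obtain ix where ix: "\<And>\<psi>. \<psi> \<in> \<Psi> \<Longrightarrow> snd \<psi> = map ((!) d) (ix \<psi>) \<and> set (ix \<psi>) \<subseteq> {..<length d}"
    by metis
  let ?b' = "\<lambda>\<psi>. map ((!) d') (ix \<psi>)"
  have len: "length x = length ss" "length x' = length ss" "length d = length ?ds" "length d' = length ?ds"
    using t tuples_length[OF d'(1)] by (auto dest: tuples_length)
  have dd: "eqt B ?ds d d'" by (rule eqt_suffix[OF d'(2)]) (use l len in auto)
  have bb: "eqt B (map (sort_of M) (snd \<psi>)) (snd \<psi>) (?b' \<psi>)" if "\<psi> \<in> \<Psi>" for \<psi>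
  proof -
    have "map ((!) ?ds) (ix \<psi>) = map (sort_of M) (snd \<psi>)" using ix[OF that] by auto
    with eqt_reindex[OF dd, of "ix \<psi>"] ix[OF that] show ?thesis by auto
  qed
  let ?\<Psi> = "(\<lambda>\<psi>. (fst \<psi>, ?b' \<psi>)) ` \<Psi>"
  have "finite ?\<Psi>" using Psi(1) by simp
  moreover have "?\<Psi> \<subseteq> pfms L M ss (univ M)"
  proof
    fix \<theta> assume "\<theta> \<in> ?\<Psi>"
    then obtain \<psi> where psi: "\<psi> \<in> \<Psi>" "\<theta> = (fst \<psi>, ?b' \<psi>)" by blast
    have "?b' \<psi> \<in> tup (map (sort_of M) (snd \<psi>))" using eqt_tup(2)[OF bb[OF psi(1)]] .
    then show "\<theta> \<in> pfms L M ss (univ M)"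
      using psi Psi(2) tuples_set tuples_sorts unfolding pfms_def by fastforce
  qed
  moreover have "divides L M ss \<theta> B" if theta: "\<theta> \<in> ?\<Psi>" for \<theta>
  proof -
    obtain \<psi> where psi: "\<psi> \<in> \<Psi>" "\<theta> = (fst \<psi>, ?b' \<psi>)" using theta by blast
    have "tp L M (?b' \<psi>) B = tp L M (snd \<psi>) B" "map (sort_of M) (?b' \<psi>) = map (sort_of M) (snd \<psi>)"
      using bb[OF psi(1)] eqt_iff_tp[OF eqt_tup[OF bb[OF psi(1)]]]
        tuples_sorts[OF eqt_tup(2)[OF bb[OF psi(1)]]] by simp_all
    moreover have "divides L M ss (fst \<psi>, snd \<psi>) B" using Psi(3) psi by simp
    ultimately show ?thesis unfolding psi(2) divides_def prod.case by simp
  qed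
  \<comment> \<open>A realisation \<open>z\<close> of the type of \<open>x\<close> is carried back
    together with \<open>d'\<close>. Its image satisfies one of the original formulas, and so
    \<open>z\<close> satisfies the moved copy.\<close>
  moreover have "\<exists>\<theta>\<in>?\<Psi>. holds M \<theta> z" if z: "realises M ss z (tp L M x (B \<union> set c))" for z
  proof -
    have xz: "eqt (B \<union> set c) ss x z" using z realises_tp_iff[OF t(3)] by simp
    have zt: "z \<in> tup ss" using eqt_tup[OF xz] by blast
    have lz: "length z = length ss" using zt tuples_length by blast
    have "eqt B (ts @ ?ds) (c @ d') (c' @ d)"
      by (rule eqt_sym, rule eqt_drop_middle[of B ts ss ?ds c' x' d c x]) (use d'(2) l len in auto)
    then obtain z' where z': "z' \<in> tup ss" "eqt B ((ts @ ?ds) @ ss) ((c @ d') @ z) ((c' @ d) @ z')"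
      using homog[OF B _ zt] by blast
    have "eqt B (ts @ ss) (c @ z) (c' @ z')"
      by (rule eqt_drop_middle[of B ts ?ds ss c d' z c' d]) (use z'(2) l len in auto)
    moreover have "eqt B (ts @ ss) (c @ x) (c @ z)"
      by (rule eqt_swap[OF eqt_abs[OF xz t(1)]]) (use len lz in auto)
    ultimately have "eqt B (ts @ ss) (c' @ x') (c' @ z')" using e eqt_sym eqt_trans by blast
    then have "eqt B (ss @ ts) (x' @ c') (z' @ c')" by (rule eqt_swap) (use l in auto)
    then have "eqt (B \<union> set c') ss x' z'"
      by (rule eqt_inst) (use len tuples_length[OF z'(1)] in auto)
    then have "realises M ss z' (tp L M x' (B \<union> set c'))" using realises_tp_iff[OF t(4)] by simp
    then obtain \<psi> where psi: "\<psi> \<in> \<Psi>" "holds M \<psi> z'" using Psi(4) by blast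
    have "eqt B (?ds @ ss) (d' @ z) (d @ z')"
      by (rule eqt_suffix[of B ts _ c _ c']) (use z'(2) l in auto)
    then have dz: "eqt B (ss @ ?ds) (z @ d') (z' @ d)" by (rule eqt_swap) (use len in auto)
    let ?S = "{y \<in> tup (ss @ ?ds). map ((!) y) ([0..<length ss] @ map ((+) (length ss)) (ix \<psi>)) \<in>
      {y \<in> tup (ss @ map (sort_of M) (snd \<psi>)). sat M (fst \<psi>) (y @ [])}}"
    have "dfb B (ss @ ?ds) ?S"
    proof (rule dfb_reindex)
      have "(fst \<psi>, snd \<psi>) \<in> pfms L M ss (univ M)" using psi Psi(2) by auto
      then show "dfb B (ss @ map (sort_of M) (snd \<psi>))
          {y \<in> tup (ss @ map (sort_of M) (snd \<psi>)). sat M (fst \<psi>) (y @ [])}"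
        by (intro dfbI[OF refl]) (simp add: pfms_def split_beta)
      show "map ((!) (ss @ ?ds)) ([0..<length ss] @ map ((+) (length ss)) (ix \<psi>)) =
          ss @ map (sort_of M) (snd \<psi>)"
        using ix[OF psi(1)] nth_prefix[of ss ?ds] by (auto simp: nth_append)
      show "i < length (ss @ ?ds)" if "i \<in> set ([0..<length ss] @ map ((+) (length ss)) (ix \<psi>))" for i
        using that ix[OF psi(1)] by auto
    qed
    moreover have nth: "map ((!) (y @ f)) ([0..<length ss] @ map ((+) (length ss)) (ix \<psi>)) =
        y @ map ((!) f) (ix \<psi>)" if "length y = length ss" for y f :: "'a list"
      using nth_prefix[of y f] that by (auto simp: nth_append)
    have "z' @ d \<in> ?S"
      using psi(2) ix[OF psi(1)] tuples_append[OF z'(1) dt] nth[OF tuples_length[OF z'(1)], of d]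
        tuples_append[OF z'(1) eqt_tup(1)[OF bb[OF psi(1)]]]
      by (simp add: holds_def del: map_append)
    ultimately have "z @ d' \<in> ?S" using eqtD[OF dz] by blast
    then have "holds M (fst \<psi>, ?b' \<psi>) z" using nth[OF lz, of d'] by (simp add: holds_def del: map_append)
    then show ?thesis using psi(1) by blast
  qed
  ultimately show ?thesis unfolding forks_def by blast
qed

end

context stab
begin

text \<open>The restriction of a nonforking extension is again nonforking, so the unique extensions
  to small sets are coherent and glue together. Invariance over \<open>B\<close> holds because
  forking is preserved by conjugation.\<close>

lemma stationary_global_type:
  assumes B: "B \<subseteq> univ M" "small \<kappa> B" and st: "stationary L M \<kappa> ss B p"
  obtains P where "gty L M \<kappa> ss P" "gty.inv L M ss P B"
    "\<And>D x. B \<subseteq> D \<Longrightarrow> D \<subseteq> univ M \<Longrightarrow> small \<kappa> D \<Longrightarrow> gty.rz L M ss P D x \<longleftrightarrow>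
       x \<in> tup ss \<and> p \<subseteq> tp L M x D \<and> \<not> forks L M ss (tp L M x D) B"
proof -
  define nf where "nf = (\<lambda>D x. x \<in> tup ss \<and> p \<subseteq> tp L M x D \<and> \<not> forks L M ss (tp L M x D) B)"
  define V where "V = (\<lambda>D. B \<subseteq> D \<and> D \<subseteq> univ M \<and> small \<kappa> D)"
  have V_Un: "V (D \<union> D')" if "V D" "V D'" for D D' using that small_Un by (auto simp: V_def)
  have pB: "p \<subseteq> pfms L M ss B" using st by (auto simp: stationary_def complete_types_def)
  have st': "\<exists>!q. q \<in> complete_types L M ss D \<and> p \<subseteq> q \<and> \<not> forks L M ss q B" if "V D" for D
    using st that unfolding stationary_def V_def by blast
  have nf_ex: "\<exists>x. nf D x" if D: "V D" for D
  proof -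
    obtain q where q: "q \<in> complete_types L M ss D" "p \<subseteq> q" "\<not> forks L M ss q B" using st'[OF D] by blast
    obtain x where x: "realises M ss x q" using complete_type_realised[OF q(1)] D by (auto simp: V_def)
    then have "nf D x" using complete_type_eq_tp[OF q(1) x] q by (auto simp: nf_def realises_def)
    then show ?thesis by blast
  qed
  have nf_eq: "eqt D ss x y" if D: "V D" and xy: "nf D x" "nf D y" for D x y
  proof -
    have "x \<in> tup ss" "y \<in> tup ss" using xy by (auto simp: nf_def)
    moreover have "tp L M x D = tp L M y D"
      using st'[OF D] xy tp_complete[of x ss D] tp_complete[of y ss D] unfolding nf_def by blast
    ultimately show ?thesis using eqt_iff_tp by simp
  qed
  have nf_eqt: "nf D y" if "nf D x" "eqt D ss x y" for D x y
    using that eqt_iff_tp[OF eqt_tup[OF that(2)]] eqt_tup(2)[OF that(2)] by (simp add: nf_def)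
  have nf_mono: "nf D x" if D: "B \<subseteq> D" "D \<subseteq> D'" and x: "nf D' x" for D D' x
  proof -
    have xt: "x \<in> tup ss" using x by (simp add: nf_def)
    have "p \<subseteq> tp L M x D"
    proof
      fix \<psi> assume "\<psi> \<in> p"
      then have "\<psi> \<in> pfms L M ss B" "\<psi> \<in> tp L M x D'" using pB x by (auto simp: nf_def)
      then show "\<psi> \<in> tp L M x D" using D(1) by (auto simp: tp_iff[OF xt] pfms_def)
    qed
    moreover have "\<not> forks L M ss (tp L M x D) B"
    proof
      assume "forks L M ss (tp L M x D) B"
      then have "forks L M ss (tp L M x D') B"
        by (rule forks_mono) (use tp_subset[OF xt D(2)] in \<open>auto simp: realises_def\<close>)
      then show False using x by (simp add: nf_def)
    qed
    ultimately show ?thesis using xt by (simp add: nf_def)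
  qed
  define P where "P = {S. \<exists>D x. V D \<and> nf D x \<and> dfb D ss S \<and> x \<in> S}"
  have P_iff: "S \<in> P \<longleftrightarrow> x \<in> S" if D: "V D" "nf D x" "dfb D ss S" for D x S
  proof
    assume "S \<in> P"
    then obtain D' x' where D': "V D'" "nf D' x'" "dfb D' ss S" "x' \<in> S" by (auto simp: P_def)
    \<comment> \<open>Membership in \<open>P\<close> is independent of the domain: \<open>z\<close>
      realises the nonforking extension over a common larger one.\<close>
    obtain z where z: "nf (D \<union> D') z" using nf_ex V_Un D D' by blast
    have "nf D z" "nf D' z" using nf_mono[OF _ _ z] D(1) D'(1) by (auto simp: V_def)
    then have "eqt D ss z x" "eqt D' ss x' z" using nf_eq D D' by auto
    then show "x \<in> S" using D' D(3) eqtD by blast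
  qed (use D P_def in blast)
  have V_ex: "\<exists>D. V D \<and> dfb D ss S" if S: "dfb (univ M) ss S" for S
  proof -
    obtain c where c: "set c \<subseteq> univ M" "dfb (set c) ss S" using S by (rule dfb_finite)
    then have "V (B \<union> set c)" "dfb (B \<union> set c) ss S"
      using B dfb_mono[OF c(2)] by (auto simp: V_def intro: small_Un small_set)
    then show ?thesis by blast
  qed
  have P_ex: "\<exists>D x. V D \<and> nf D x \<and> dfb D ss S \<and> dfb D ss S'"
    if S: "dfb (univ M) ss S" "dfb (univ M) ss S'" for S S'
  proof -
    obtain D D' where D: "V D" "V D'" "dfb D ss S" "dfb D' ss S'" using V_ex S by metis
    then have "V (D \<union> D')" "dfb (D \<union> D') ss S" "dfb (D \<union> D') ss S'"
      using V_Un dfb_mono by (auto intro: dfb_mono)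
    then show ?thesis using nf_ex by blast
  qed
  have P_dfb: "dfb (univ M) ss S" if "S \<in> P" for S
    using that dfb_mono by (auto simp: P_def V_def)
  have "gtype ss P" unfolding gtype_def
  proof (intro conjI ballI allI impI)
    show "dfb (univ M) ss S" if "S \<in> P" for S using that P_dfb by blast
    show "{} \<notin> P" by (auto simp: P_def)
    show "S \<inter> S' \<in> P" if S: "S \<in> P" "S' \<in> P" for S S'
    proof -
      obtain D x where D: "V D" "nf D x" "dfb D ss S" "dfb D ss S'" using P_ex P_dfb S by metis
      then show ?thesis using P_iff[OF D(1,2)] S dfb_Int by (metis IntI)
    qed
    show "S \<in> P \<or> tup ss - S \<in> P" if S: "dfb (univ M) ss S" for S
    proof -
      obtain D x where D: "V D" "nf D x" "dfb D ss S" using P_ex[OF S S] by blast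
      then show ?thesis using P_iff[OF D(1,2)] dfb_Compl[OF D(3)] by (auto simp: nf_def)
    qed
  qed
  then interpret G: gty L M \<kappa> ss P by unfold_locales
  have rz: "G.rz D x \<longleftrightarrow> nf D x" if D: "V D" for D x
  proof
    assume x: "nf D x"
    then show "G.rz D x" unfolding G.rz_def using P_iff[OF D] by (auto simp: nf_def)
  next
    assume x: "G.rz D x"
    obtain y where y: "nf D y" using nf_ex[OF D] by blast
    then have "G.rz D y" unfolding G.rz_def using P_iff[OF D] by (auto simp: nf_def)
    then have "eqt D ss y x" using G.rz_eqt x D by (auto simp: V_def)
    then show "nf D x" using nf_eqt y by blast
  qed
  have "G.inv B" unfolding G.inv_def
  proof (intro allI impI)
    fix ts R c c' assume R: "dfb B (ts @ ss) R" and c: "eqt B ts c c'"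
    note t = eqt_tup[OF c]
    have VB: "V (B \<union> set c)" "V (B \<union> set c')"
      using B t[THEN tuples_set] by (auto simp: V_def intro: small_Un small_set)
    obtain x where x: "nf (B \<union> set c) x" using nf_ex[OF VB(1)] by blast
    then have xt: "x \<in> tup ss" by (simp add: nf_def)
    obtain x' where x': "x' \<in> tup ss" "eqt B (ts @ ss) (c @ x) (c' @ x')" using homog[OF B c xt] .
    have l: "length c = length ts" "length c' = length ts" using t tuples_length by auto
    have "\<not> forks L M ss (tp L M x' (B \<union> set c')) B"
      using forks_transfer[OF B x'(2) l] x by (auto simp: nf_def)
    moreover have "p \<subseteq> tp L M x' (B \<union> set c')"
    proof -
      have "eqt B ss x x'" by (rule eqt_suffix[OF x'(2) l])
      moreover have "nf B x" using nf_mono[OF _ _ x] by simp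
      ultimately have "nf B x'" using nf_eqt by blast
      then show ?thesis using tp_subset[OF x'(1), of B "B \<union> set c'"] by (auto simp: nf_def)
    qed
    ultimately have x'n: "nf (B \<union> set c') x'" using x'(1) by (simp add: nf_def)
    have "{z \<in> tup ss. c @ z \<in> R} \<in> P \<longleftrightarrow> c @ x \<in> R"
      using P_iff[OF VB(1) x dfb_inst_prefix[OF R t(1)]] xt by simp
    also have "\<dots> \<longleftrightarrow> c' @ x' \<in> R" by (rule eqtD[OF x'(2) R])
    also have "\<dots> \<longleftrightarrow> {z \<in> tup ss. c' @ z \<in> R} \<in> P"
      using P_iff[OF VB(2) x'n dfb_inst_prefix[OF R t(2)]] x'(1) by simp
    finally show "{z \<in> tup ss. c @ z \<in> R} \<in> P \<longleftrightarrow> {z \<in> tup ss. c' @ z \<in> R} \<in> P" .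
  qed
  with G.gty_axioms rz show ?thesis using that[of P] unfolding V_def nf_def by blast
qed

end

section \<open>Kernels of Morley sequences\<close>

text \<open>For a Morley sequence this is the kernel, in a form in which closure under
  \<open>dcl\<close> is easily seen and initial segments can be discarded.\<close>

definition tail_dcl :: "('s, 'f, 'r) lang \<Rightarrow> ('a, 's, 'f, 'r) struc \<Rightarrow> (nat \<Rightarrow> 'a list) \<Rightarrow> 'a set" where
  "tail_dcl L M a = (\<Inter>n. dcl L M (\<Union>i\<in>{n..}. set (a i)))"

lemma seg_nth: "seg (\<lambda>i. a (xs ! i)) 0 (length xs) = concat (map a xs)"
proof -
  have "map (\<lambda>i. a (xs ! i)) [0..<length xs] = map a xs" by (rule nth_equalityI) auto
  then show ?thesis by (simp add: seg_def)
qed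

lemma finite_tail:
  assumes "set c \<subseteq> (\<Union>i\<in>{n..}. set (a i))"
  obtains N where "n \<le> N" "set c \<subseteq> set (seg a n N)"
proof -
  have "\<exists>N\<ge>n. set c \<subseteq> set (seg a n N)" using assms
  proof (induction c)
    case (Cons x c)
    then obtain N where N: "N \<ge> n" "set c \<subseteq> set (seg a n N)" by auto
    obtain i where i: "i \<ge> n" "x \<in> set (a i)" using Cons by auto
    have "set (x # c) \<subseteq> set (seg a n (N + Suc i))" using N i by (fastforce simp: set_seg)
    then show ?case using N by (intro exI[of _ "N + Suc i"]) auto
  qed auto
  then show ?thesis using that by blast
qed

context mstruc
begin

lemma dfb_eq: "dfb {} [s, s] {x \<in> tup [s, s]. x ! 0 = x ! 1}"
proof -
  have eq: "{x \<in> tup [s, s]. x ! 0 = x ! 1} = {x \<in> tup [s, s]. sat M (Eq (Var 0) (Var 1)) (x @ [])}"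
    by simp
  show ?thesis by (rule dfbI[OF eq]) (simp add: pfms_def)
qed

text \<open>Serves to define a canonical parameter from its set: the fibre at \<open>u\<close> is
  \<open>S\<close> exactly if no \<open>z\<close> lies in the symmetric difference, and this is a
  first-order condition on \<open>u\<close>.\<close>

lemma dfb_fibre:
  assumes S: "dfb A ts S" and R: "dfb A (ts @ us) R"
  shows "dfb A us {u \<in> tup us. {z \<in> tup ts. z @ u \<in> R} = S}"
proof -
  let ?C = "{y @ x | y x. y \<in> S \<and> x \<in> tup us}"
  have C: "z @ u \<in> ?C \<longleftrightarrow> z \<in> S" if "z \<in> tup ts" "u \<in> tup us" for z u
    using cylinder_iff[OF dfb_sub[OF S] tuples_length[OF that(1)]] that(2) by blast
  define D where "D = (?C - R) \<union> (R - ?C)"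
  have D: "dfb A (ts @ us) D"
    unfolding D_def using dfb_cylinder[OF S] R by (intro dfb_Un dfb_Diff)
  have Di: "z @ u \<in> D \<longleftrightarrow> (z @ u \<in> R \<longleftrightarrow> z \<notin> S)" if "z \<in> tup ts" "u \<in> tup us" for z u
    using C[OF that] by (auto simp: D_def)
  have zt: "z \<in> tup ts" if "z @ u \<in> D" "u \<in> tup us" for z u
  proof -
    have "z @ u \<in> tup (ts @ us)" using that(1) dfb_sub[OF D] by blast
    moreover from this have "length z = length ts"
      using tuples_length[OF that(2)] tuples_length by fastforce
    ultimately show ?thesis by (simp add: tuples_append_iff)
  qed
  have "u \<in> {u \<in> tup us. {z \<in> tup ts. z @ u \<in> R} = S} \<longleftrightarrow> u \<in> tup us - {u \<in> tup us. \<exists>z. z @ u \<in> D}" for u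
  proof (cases "u \<in> tup us")
    case True
    have "{z \<in> tup ts. z @ u \<in> R} = S \<longleftrightarrow> (\<forall>z\<in>tup ts. z @ u \<in> R \<longleftrightarrow> z \<in> S)"
      using dfb_sub[OF S] by blast
    also have "\<dots> \<longleftrightarrow> \<not> (\<exists>z. z @ u \<in> D)" using Di[OF _ True] zt[OF _ True] by blast
    finally show ?thesis using True by simp
  qed simp
  then have "{u \<in> tup us. {z \<in> tup ts. z @ u \<in> R} = S} = tup us - {u \<in> tup us. \<exists>z. z @ u \<in> D}"
    by (rule set_eqI)
  then show ?thesis using dfb_Compl[OF dfb_Ex_prefix[OF D]] by simp
qed

text \<open>A formula that defines \<open>d\<close> from \<open>u\<close> may have several solutions
  at another tuple. Discarding all arguments with more than one value keeps the pair of
  \<open>d\<close> and \<open>u\<close> and leaves a partial function everywhere, so that one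
  formula can be evaluated on many blocks.\<close>

lemma dcl_functional:
  assumes d: "d \<in> dcl L M (set u)" and u: "u \<in> tup us"
  obtains W where "dfb {} (sort_of M d # us) W" "d # u \<in> W"
    "\<And>z z' v. z # v \<in> W \<Longrightarrow> z' # v \<in> W \<Longrightarrow> z = z'"
proof -
  let ?s = "sort_of M d" and ?n = "length us"
  have du: "d \<in> univ M" "dfb (set u) [?s] {[d]}" using d dcl_iff by auto
  then have "dfb ({} \<union> set u) [?s] {[d]}" by simp
  then obtain R where R: "dfb {} ([?s] @ us) R" "{[d]} = {x \<in> tup [?s]. x @ u \<in> R}"
    using u by (rule dfb_abs)
  have "[d] \<in> {x \<in> tup [?s]. x @ u \<in> R}" using R(2) by blast
  then have dR: "d # u \<in> R" by simp
  have dR': "z = d" if "z # u \<in> R" for z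
  proof -
    have "z # u \<in> tup ([?s] @ us)" using that dfb_sub[OF R(1)] by blast
    then have "[z] \<in> {x \<in> tup [?s]. x @ u \<in> R}" using that by (auto simp: tuples_Cons)
    then show "z = d" using R(2) by blast
  qed
  let ?\<Delta> = "?s # ?s # us"
  define J where "J = [2..<2 + ?n]"
  let ?E1 = "{x \<in> tup ?\<Delta>. map ((!) x) (0 # J) \<in> R}"
  let ?E2 = "{x \<in> tup ?\<Delta>. map ((!) x) (1 # J) \<in> R}"
  let ?E = "{x \<in> tup ?\<Delta>. map ((!) x) [0, 1] \<in> {x \<in> tup [?s, ?s]. x ! 0 = x ! 1}}"
  have nth2: "map ((!) (y # z # v)) J = v" if "length v = ?n" for y z and v :: "'x list"
  proof -
    have "map ((!) (y # z # v)) (map (\<lambda>i. i + 2) [0..<length v]) = map ((!) v) [0..<length v]" by simp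
    then show ?thesis unfolding J_def by (simp only: that[symmetric] map_add_upt map_nth add.commute)
  qed
  have J: "i < Suc (Suc ?n)" if "i \<in> set J" for i using that unfolding J_def set_upt by simp
  have E1: "dfb {} ?\<Delta> ?E1"
    by (rule dfb_reindex[OF R(1)]) (use nth2[of us] J in auto)
  have E2: "dfb {} ?\<Delta> ?E2"
    by (rule dfb_reindex[OF R(1)]) (use nth2[of us] J in auto)
  have E3: "dfb {} ?\<Delta> ?E"
    by (rule dfb_reindex[OF dfb_eq]) auto
  \<comment> \<open>\<open>D\<close> consists of two different values followed by a common argument;
    \<open>bad\<close> contains the pairs whose argument also has another value.\<close>
  define D where "D = (?E1 \<inter> ?E2) - ?E"
  have D: "dfb {} (?s # (?s # us)) D" unfolding D_def by (intro dfb_Diff dfb_Int E1 E2 E3)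
  define bad where "bad = {x \<in> tup (?s # us). \<exists>y. y # x \<in> D}"
  have W: "dfb {} (?s # us) (R - bad)"
    unfolding bad_def using dfb_Diff[OF _ dfb_Ex_Cons[OF D]] R(1) by simp
  have Di: "y # z # v \<in> D \<longleftrightarrow> y # v \<in> R \<and> z # v \<in> R \<and> y \<noteq> z" for y z v
  proof (cases "y # v \<in> R \<and> z # v \<in> R")
    case True
    then have "y # v \<in> tup (?s # us)" "z # v \<in> tup (?s # us)" using dfb_sub[OF R(1)] by auto
    then have "v \<in> tup us" "y # z # v \<in> tup ?\<Delta>" "[y, z] \<in> tup [?s, ?s]" by (auto simp: tuples_Cons)
    moreover from this have "length v = ?n" using tuples_length by blast
    ultimately show ?thesis using True nth2[of v y z] by (simp add: D_def)
  next
    case False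
    have "y # z # v \<notin> D"
    proof
      assume "y # z # v \<in> D"
      then have yz: "y # z # v \<in> tup ?\<Delta>" "map ((!) (y # z # v)) (0 # J) \<in> R"
        "map ((!) (y # z # v)) (1 # J) \<in> R" by (simp_all add: D_def)
      then have "length v = ?n" using tuples_length[OF yz(1)] by simp
      then show False using yz(2,3) nth2[of v y z] False by simp
    qed
    then show ?thesis using False by blast
  qed
  show ?thesis
  proof (rule that[OF W])
    show "d # u \<in> R - bad" 
    proof -
      have "y # d # u \<notin> D" for y using dR'[of y] unfolding Di by blast
      then show ?thesis using dR by (simp add: bad_def)
    qed
    fix z z' v assume zz: "z # v \<in> R - bad" "z' # v \<in> R - bad"
    show "z = z'"
    proof (rule ccontr)
      assume "z \<noteq> z'"
      then have "z' # z # v \<in> D" using zz by (simp add: Di)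
      moreover have "z # v \<in> tup (?s # us)" using zz dfb_sub[OF W] by blast
      ultimately have "z # v \<in> bad" unfolding bad_def by blast
      then show False using zz(1) by blast
    qed
  qed
qed

lemma tail_dcl_univ: "tail_dcl L M a \<subseteq> univ M"
  using dcl_univ by (auto simp: tail_dcl_def)

lemma dcl_tail_dcl:
  assumes "\<And>i. set (a i) \<subseteq> univ M" shows "dcl L M (tail_dcl L M a) = tail_dcl L M a"
proof
  show "dcl L M (tail_dcl L M a) \<subseteq> tail_dcl L M a"
  proof -
    have "dcl L M (tail_dcl L M a) \<subseteq> dcl L M (\<Union>i\<in>{n..}. set (a i))" for n
    proof -
      have "dcl L M (tail_dcl L M a) \<subseteq> dcl L M (dcl L M (\<Union>i\<in>{n..}. set (a i)))"
        by (rule dcl_mono) (auto simp: tail_dcl_def)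
      moreover have "(\<Union>i\<in>{n..}. set (a i)) \<subseteq> univ M" using assms by blast
      ultimately show ?thesis using dcl_dcl by metis
    qed
    then show ?thesis unfolding tail_dcl_def by blast
  qed
qed (rule dcl_incl[OF tail_dcl_univ])

end

context gty
begin

lemma mor_indiscernible:
  assumes inv: "inv A" and A: "A \<subseteq> univ M" and a: "\<And>n. mor A n a"
    and xs: "sorted_wrt (<) xs" "sorted_wrt (<) ys" "length xs = length ys"
  shows "eqt A (rep ss (length xs)) (concat (map a xs)) (concat (map a ys))"
proof -
  have "mor A (length zs) (\<lambda>i. a (zs ! i))" if zs: "sorted_wrt (<) zs" for zs
  proof (rule mor_sub[OF a[of "Suc (Max (set zs))"]])
    fix i assume "i < length zs"
    then show "zs ! i < Suc (Max (set zs))" by (simp add: less_Suc_eq_le)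
  qed (use zs sorted_wrt_nth_less in blast)
  from mor_eqt0[OF inv A this[OF xs(1)]] this[OF xs(2)] xs(3)
  have "eqt A (rep ss (length xs)) (seg (\<lambda>i. a (xs ! i)) 0 (length xs)) (seg (\<lambda>i. a (ys ! i)) 0 (length ys))"
    by simp
  then show ?thesis unfolding seg_nth .
qed

text \<open>An element of the kernel is read off an initial segment by a functional formula; as the
  sequence is indiscernible over that element, the same formula yields it from any later segment.
  Conversely, an element definable from members beyond all indices in \<open>xs\<close> and
  \<open>ys\<close> cannot tell these apart, since the sequence is indiscernible over
  \<open>A\<close>.\<close>

lemma kernel_eq_tail_dcl:
  assumes inv: "inv A" and A: "A \<subseteq> univ M" and a: "\<And>n. mor A n a"
  shows "kernel L M a = tail_dcl L M a"
proof
  have at: "a i \<in> tup ss" for i using a[of "Suc i"] rz_tup by (auto simp: mor_def)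
  have segt: "seg a i (i + k) \<in> tup (rep ss k)" for i k by (rule mor_tup[OF a[of "i + k"]]) simp
  have tup: "concat (map a xs) \<in> tup (rep ss (length xs))" for xs
  proof -
    have "seg (\<lambda>i. a (xs ! i)) 0 (0 + length xs) \<in> tup (rep ss (length xs))"
      by (rule tup_seg) (rule at)
    then show ?thesis by (simp add: seg_nth)
  qed
  have upt: "sorted_wrt (<) [i..<j]" for i j :: nat by simp
  show "kernel L M a \<subseteq> tail_dcl L M a"
  proof
    fix d assume d: "d \<in> kernel L M a"
    have "dfb (\<Union>i. set (a i)) [sort_of M d] {[d]}" and du: "d \<in> univ M"
      using d by (auto simp: kernel_def dcl_iff)
    then obtain c where c: "set c \<subseteq> (\<Union>i. set (a i))" "dfb (set c) [sort_of M d] {[d]}"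
      using dfb_finite by metis
    from c(1) have "set c \<subseteq> (\<Union>i\<in>{0..}. set (a i))" by auto
    then obtain m where "set c \<subseteq> set (seg a 0 m)" by (rule finite_tail)
    then have "d \<in> dcl L M (set (seg a 0 m))" using c du dfb_mono by (auto simp: dcl_iff)
    then obtain W where W: "dfb {} (sort_of M d # rep ss m) W" "d # seg a 0 m \<in> W"
      "\<And>z z' v. z # v \<in> W \<Longrightarrow> z' # v \<in> W \<Longrightarrow> z = z'"
      using dcl_functional segt[of 0 m] by (metis add_0)
    have dt: "[d] \<in> tup [sort_of M d]" using du by (simp add: tuples_Cons)
    have "d \<in> dcl L M (\<Union>i\<in>{n..}. set (a i))" for n
    proof -
      have "tp L M (concat (map a [0..<m])) {d} = tp L M (concat (map a [n..<n + m])) {d}"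
        using d upt unfolding kernel_def indiscernible_def by simp
      then have "eqt {d} (rep ss m) (seg a 0 m) (seg a n (n + m))"
        using eqt_iff_tp segt[of 0 m] segt[of n m] by (simp add: seg_def)
      moreover have "dfb ({} \<union> set [d]) (rep ss m) {x \<in> tup (rep ss m). [d] @ x \<in> W}"
        by (rule dfb_inst_prefix[OF _ dt]) (use W in simp)
      ultimately have w: "d # seg a n (n + m) \<in> W" using eqtD[of "{d}"] W(2) segt[of 0 m] by auto
      have "dfb ({} \<union> set (seg a n (n + m))) [sort_of M d] {x \<in> tup [sort_of M d]. x @ seg a n (n + m) \<in> W}"
        by (rule dfb_inst[OF _ segt]) (use W in simp)
      moreover have "{x \<in> tup [sort_of M d]. x @ seg a n (n + m) \<in> W} = {[d]}"
        using w W(3) dt by (auto simp: tuples_one)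
      ultimately have "d \<in> dcl L M (set (seg a n (n + m)))" using du by (simp add: dcl_iff)
      moreover have "set (seg a n (n + m)) \<subseteq> (\<Union>i\<in>{n..}. set (a i))" by (auto simp: set_seg)
      ultimately show ?thesis using dcl_mono by blast
    qed
    then show "d \<in> tail_dcl L M a" by (simp add: tail_dcl_def)
  qed
  show "tail_dcl L M a \<subseteq> kernel L M a"
  proof
    fix d assume d: "d \<in> tail_dcl L M a"
    then have "d \<in> dcl L M (\<Union>i\<in>{0..}. set (a i))" unfolding tail_dcl_def by blast
    then have d0: "d \<in> dcl L M (\<Union>i. set (a i))" by simp
    have "eqt {d} (rep ss (length xs)) (concat (map a xs)) (concat (map a ys))"
      if xs: "sorted_wrt (<) xs" "sorted_wrt (<) ys" "length xs = length ys" for xs ys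
      unfolding eqt_def
    proof (intro conjI allI impI)
      show "concat (map a xs) \<in> tup (rep ss (length xs))" "concat (map a ys) \<in> tup (rep ss (length xs))"
        using tup[of xs] tup[of ys] xs(3) by auto
      fix S assume "dfb {d} (rep ss (length xs)) S"
      obtain n where n: "\<And>i. i \<in> set xs \<union> set ys \<Longrightarrow> i < n"
        using finite_nat_set_iff_bounded[of "set xs \<union> set ys"] by auto
      have "dfb (\<Union>i\<in>{n..}. set (a i)) (rep ss (length xs)) S"
        using dfb_dcl dfb_mono[OF \<open>dfb {d} _ S\<close>] d by (auto simp: tail_dcl_def)
      then obtain c where c: "set c \<subseteq> (\<Union>i\<in>{n..}. set (a i))" "dfb (set c) (rep ss (length xs)) S"
        using dfb_finite by metis
      obtain N where N: "n \<le> N" "set c \<subseteq> set (seg a n N)" using finite_tail[OF c(1)] .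
      define k where "k = N - n"
      have st: "seg a n N \<in> tup (rep ss k)" using segt[of n k] N by (simp add: k_def)
      have "dfb ({} \<union> set (seg a n N)) (rep ss (length xs)) S" using dfb_mono[OF c(2)] N by simp
      then obtain R where R: "dfb {} (rep ss (length xs) @ rep ss k) R"
        "S = {x \<in> tup (rep ss (length xs)). x @ seg a n N \<in> R}" using st by (rule dfb_abs)
      \<comment> \<open>Both index lists are continued by the same indices from \<open>n\<close> on,
        whose members contain the parameters defining \<open>S\<close>.\<close>
      have so: "sorted_wrt (<) (zs @ [n..<N])" if "zs = xs \<or> zs = ys" for zs
        using that xs n by (fastforce simp: sorted_wrt_append)
      have "eqt A (rep ss (length (xs @ [n..<N]))) (concat (map a (xs @ [n..<N])))
          (concat (map a (ys @ [n..<N])))"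
        by (rule mor_indiscernible[OF inv A a]) (use so xs(3) in auto)
      then have "eqt A (rep ss (length xs) @ rep ss k) (concat (map a xs) @ seg a n N)
          (concat (map a ys) @ seg a n N)"
        by (simp add: seg_def rep_add k_def)
      from eqtD[OF this] have "concat (map a xs) @ seg a n N \<in> R \<longleftrightarrow> concat (map a ys) @ seg a n N \<in> R"
        using dfb_mono[OF R(1)] by simp
      then show "concat (map a xs) \<in> S \<longleftrightarrow> concat (map a ys) \<in> S"
        using R(2) tup[of xs] tup[of ys] xs(3) by auto
    qed
    then have "indiscernible L M {d} a" unfolding indiscernible_def
      using eqt_iff_tp tup by metis
    then show "d \<in> kernel L M a" using d0 by (simp add: kernel_def)
  qed
qed

text \<open>If \<open>d'\<close> has the type of \<open>d\<close> over \<open>C\<close>, then \<open>d\<close> and \<open>d'\<close> are read off blocks \<open>u\<close> and \<open>u'\<close> of the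
  same type over \<open>C\<close>; both agree with the element read off a block which is independent from
  both of them.\<close>

lemma kernel_subset_dcl:
  assumes inv: "inv C" and C: "C \<subseteq> univ M" "small \<kappa> C" and a: "\<And>n. mor C n a"
  shows "kernel L M a \<subseteq> dcl L M C"
proof
  fix d assume d: "d \<in> kernel L M a"
  let ?s = "sort_of M d"
  have segt: "seg a i (i + k) \<in> tup (rep ss k)" for i k by (rule mor_tup[OF a[of "i + k"]]) simp
  have "dfb (\<Union>i. set (a i)) [?s] {[d]}" and du: "d \<in> univ M"
    using d by (auto simp: kernel_def dcl_iff)
  then obtain c where c: "set c \<subseteq> (\<Union>i. set (a i))" "dfb (set c) [?s] {[d]}"
    using dfb_finite by metis
  from c(1) have "set c \<subseteq> (\<Union>i\<in>{0..}. set (a i))" by auto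
  then obtain m where m: "set c \<subseteq> set (seg a 0 m)" by (rule finite_tail)
  let ?us = "rep ss m" and ?u = "seg a 0 m" and ?u2 = "seg a m (m + m)"
  have u: "?u \<in> tup ?us" "?u2 \<in> tup ?us" using segt[of 0 m] segt[of m m] by auto
  have "d \<in> dcl L M (set ?u)" using m c du dfb_mono by (auto simp: dcl_iff)
  then obtain W where W: "dfb {} (?s # ?us) W" "d # ?u \<in> W"
    "\<And>z z' v. z # v \<in> W \<Longrightarrow> z' # v \<in> W \<Longrightarrow> z = z'"
    using dcl_functional[OF _ u(1)] by metis
  have WC: "dfb C ([?s] @ ?us) W" using dfb_mono[OF W(1)] by simp
  have dt: "[d] \<in> tup [?s]" using du by (simp add: tuples_Cons)
  \<comment> \<open>Indiscernibility over \<open>d\<close> gives a second block at which the same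
    formula takes the value \<open>d\<close>.\<close>
  have w2: "d # ?u2 \<in> W"
  proof -
    have "tp L M (concat (map a [0..<m])) {d} = tp L M (concat (map a [m..<m + m])) {d}"
      using d unfolding kernel_def indiscernible_def by simp
    then have "eqt {d} ?us ?u ?u2" using eqt_iff_tp u by (simp add: seg_def)
    moreover have "dfb ({} \<union> set [d]) ?us {x \<in> tup ?us. [d] @ x \<in> W}"
      by (rule dfb_inst_prefix[OF _ dt]) (use W in simp)
    ultimately show ?thesis using eqtD[of "{d}"] W(2) u by auto
  qed
  have "dfb C [?s] {[d]}"
  proof (rule dfb_invariant[OF _ C])
    show "dfb (univ M) [?s] {[d]}" using dfb_mono[OF dfb_singleton[OF du]] du by simp
    fix x y assume xy: "eqt C [?s] x y" "x \<in> {[d]}"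
    obtain d' where y: "y = [d']" using eqt_tup(2)[OF xy(1)] by (auto simp: tuples_one)
    have dd: "eqt C [?s] [d] [d']" using xy y by simp
    have d't: "[d'] \<in> tup [?s]" using eqt_tup[OF dd] by blast
    obtain u' where u': "u' \<in> tup ?us" "eqt C ([?s] @ ?us) ([d] @ ?u) ([d'] @ u')"
      using homog[OF C dd u(1)] .
    have wd': "d' # u' \<in> W" using eqtD[OF u'(2) WC] W(2) by simp
    let ?D = "C \<union> set ?u \<union> set u'"
    have "?D \<subseteq> univ M" "small \<kappa> ?D" using C u u' tuples_set by (blast, intro small_Un small_set)
    then obtain b where b: "\<And>n. mor ?D n b" using mor_ex by blast
    let ?v = "seg b 0 m"
    have shift: "mor (C \<union> set ?u) m (\<lambda>i. a (m + i))" by (rule mor_shift[OF a])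
    have sh: "seg (\<lambda>i. a (m + i)) 0 (0 + m) = ?u2" by (rule seg_cong) simp
    have vt: "?v \<in> tup ?us" using mor_tup[OF b[of m], of 0 m] by simp
    \<comment> \<open>Over \<open>C\<close>, \<open>w\<close> followed by the generic block has the
      type of two successive blocks of the sequence, where \<open>W\<close> takes a common value. So
      the value at \<open>w\<close> is also the value at the generic block.\<close>
    have key: "z # ?v \<in> W" if w: "eqt C ?us ?u w" "z # w \<in> W" "set w \<subseteq> set ?u \<union> set u'" for w z
    proof -
      have "mor (C \<union> set w) m b" by (rule mor_mono[OF b[of m]]) (use w in auto)
      from mor_eqt[OF inv C(1) w(1) shift this]
      have e: "eqt C (?us @ ?us) (?u @ ?u2) (w @ ?v)" using sh by simp
      obtain e' where e': "e' \<in> tup [?s]" "eqt C ((?us @ ?us) @ [?s]) ((?u @ ?u2) @ [d]) ((w @ ?v) @ e')"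
        using homog[OF C e dt] .
      obtain z' where z': "e' = [z']" using e'(1) by (auto simp: tuples_one)
      have l: "length w = length ?us" "length ?u = length ?us" "length ?u2 = length ?us" "length ?v = length ?us"
        using eqt_tup(2)[OF w(1)] u vt tuples_length by blast+
      have "eqt C (?us @ [?s]) (?u @ [d]) (w @ [z'])"
        by (rule eqt_drop_middle[of C ?us ?us "[?s]" ?u ?u2 _ w ?v]) (use e'(2) z' l in auto)
      then have "eqt C ([?s] @ ?us) ([d] @ ?u) ([z'] @ w)" by (rule eqt_swap) (use l in auto)
      then have "z' # w \<in> W" using eqtD[OF _ WC] W(2) by fastforce
      then have "z' = z" using w(2) W(3) by blast
      have "eqt C (?us @ [?s]) (?u2 @ [d]) (?v @ [z'])"
        by (rule eqt_suffix[of C ?us _ ?u _ w]) (use e'(2) z' l in auto)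
      then have "eqt C ([?s] @ ?us) ([d] @ ?u2) ([z'] @ ?v)" by (rule eqt_swap) (use l in auto)
      then have "z' # ?v \<in> W" using eqtD[OF _ WC] w2 by fastforce
      then show ?thesis using \<open>z' = z\<close> by simp
    qed
    have "d # ?v \<in> W" by (rule key[OF eqt_refl[OF u(1)] W(2)]) simp
    moreover have "eqt C ?us ?u u'" by (rule eqt_suffix[OF u'(2)]) simp_all
    then have "d' # ?v \<in> W" by (rule key[OF _ wd']) simp
    ultimately have "d = d'" by (rule W(3))
    then show "y \<in> {[d]}" using y by simp
  qed
  then show "d \<in> dcl L M C" using du by (simp add: dcl_iff)
qed

end

section \<open>Canonical bases\<close>

text \<open>What the argument requires of imaginaries. \<open>codes\<close> provides canonical
  parameters, unique within their sort; \<open>small_dcl\<close> makes the kernel and every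
  competing base small, since they lie in the definable closure of \<open>B\<close>.\<close>

locale imag = stab L M \<kappa>
  for L :: "('s, 'f, 'r) lang" and M :: "('a, 's, 'f, 'r) struc" and \<kappa> :: "'k rel" +
  assumes codes: "dfb (univ M) ts S \<Longrightarrow> \<exists>e\<in>univ M. \<exists>R. dfb {} (ts @ [sort_of M e]) R \<and>
      S = {y \<in> tup ts. y @ [e] \<in> R} \<and>
      (\<forall>e'\<in>univ M. sort_of M e' = sort_of M e \<longrightarrow> S = {y \<in> tup ts. y @ [e'] \<in> R} \<longrightarrow> e' = e)"
    and small_dcl: "A \<subseteq> univ M \<Longrightarrow> small \<kappa> A \<Longrightarrow> small \<kappa> (dcl L M A)"
begin

lemma code_in_dcl:
  assumes S: "dfb A ts S" and e: "e \<in> univ M" "dfb {} (ts @ [sort_of M e]) R"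
    "S = {y \<in> tup ts. y @ [e] \<in> R}"
    "\<And>e'. e' \<in> univ M \<Longrightarrow> sort_of M e' = sort_of M e \<Longrightarrow> S = {y \<in> tup ts. y @ [e'] \<in> R} \<Longrightarrow> e' = e"
  shows "e \<in> dcl L M A"
proof -
  have "dfb A [sort_of M e] {u \<in> tup [sort_of M e]. {z \<in> tup ts. z @ u \<in> R} = S}"
    using dfb_fibre[OF S] dfb_mono[OF e(2)] by simp
  moreover have "{u \<in> tup [sort_of M e]. {z \<in> tup ts. z @ u \<in> R} = S} = {[e]}"
    using e(1,3) e(4) by (fastforce simp: tuples_one)
  ultimately show ?thesis using e(1) by (simp add: dcl_iff)
qed

text \<open>The canonical parameters of the definitions of \<open>P\<close> lie in the kernel, since they are
  definable from every tail of the Morley sequence.\<close>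

lemma inv_tail_dcl:
  assumes "gty L M \<kappa> ss P" and inv: "gty.inv L M ss P B" and B: "B \<subseteq> univ M" "small \<kappa> B"
    and a: "\<And>n. gty.mor L M ss P B n a" and sub: "tail_dcl L M a \<subseteq> dcl L M B"
  shows "gty.inv L M ss P (tail_dcl L M a)"
proof -
  interpret gty L M \<kappa> ss P by fact
  let ?K = "tail_dcl L M a"
  have au: "set (a i) \<subseteq> univ M" for i
    using a[of "Suc i"] tuples_set[OF rz_tup] unfolding mor_def by blast
  show ?thesis unfolding inv_def
  proof (intro allI impI)
    fix ts R c c' assume R: "dfb ?K (ts @ ss) R" and c: "eqt ?K ts c c'"
    let ?R = "swapset ts ss R"
    have R': "dfb ?K (ss @ ts) ?R" by (rule dfb_swap[OF R])
    have RB: "dfb B (ss @ ts) ?R" using dfb_dcl dfb_mono[OF R' sub] by blast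
    have "dfb (univ M) ts (pdef ts ?R)" by (rule dfb_mono[OF pdef_dfb[OF inv B RB] B(1)])
    from codes[OF this] obtain e R0 where e: "e \<in> univ M" "dfb {} (ts @ [sort_of M e]) R0"
      "pdef ts ?R = {y \<in> tup ts. y @ [e] \<in> R0}"
      and eu: "\<forall>e'\<in>univ M. sort_of M e' = sort_of M e \<longrightarrow>
        pdef ts ?R = {y \<in> tup ts. y @ [e'] \<in> R0} \<longrightarrow> e' = e"
      by (elim bexE exE conjE)
    \<comment> \<open>The number \<open>k\<close> serves all Morley sequences of \<open>P\<close>
      over \<open>B\<close>, in particular every tail of \<open>a\<close>.\<close>
    obtain k where k: "\<And>a. mor B k a \<Longrightarrow> dfb (?K \<union> set (seg a 0 k)) ts (pdef ts ?R)"
      using pdef_mor[OF inv B sub R'] by blast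
    have "e \<in> dcl L M (\<Union>i\<in>{n..}. set (a i))" for n
    proof -
      let ?T = "\<Union>i\<in>{n..}. set (a i)"
      have T: "?T \<subseteq> univ M" using au by blast
      have "mor B k (\<lambda>i. a (n + i))" by (rule mor_mono[OF mor_shift[OF a]]) auto
      from k[OF this] have "dfb (?K \<union> set (seg (\<lambda>i. a (n + i)) 0 k)) ts (pdef ts ?R)" .
      \<comment> \<open>The parameters of \<open>R\<close> are themselves definable from the tail,
        so the voters of the tail suffice to define the set.\<close>
      moreover have "?K \<subseteq> dcl L M ?T" by (auto simp: tail_dcl_def)
      moreover have "set (seg (\<lambda>i. a (n + i)) 0 k) \<subseteq> ?T" by (force simp: set_seg)
      ultimately have "dfb (dcl L M ?T) ts (pdef ts ?R)"
        using dfb_mono dcl_incl[OF T] by (meson Un_least order_trans)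
      then show ?thesis using code_in_dcl[OF dfb_dcl e eu[rule_format]] by blast
    qed
    then have "e \<in> ?K" by (simp add: tail_dcl_def)
    have et: "[e] \<in> tup [sort_of M e]" using e(1) by (simp add: tuples_one)
    have "dfb ({} \<union> set [e]) ts (pdef ts ?R)" using dfb_inst[OF e(2) et] e(3) by simp
    then have "dfb ?K ts (pdef ts ?R)" using dfb_mono \<open>e \<in> ?K\<close> by fastforce
    from eqtD[OF c this] have "c \<in> pdef ts ?R \<longleftrightarrow> c' \<in> pdef ts ?R" .
    moreover have "d \<in> pdef ts ?R \<longleftrightarrow> {x \<in> tup ss. d @ x \<in> R} \<in> P" if "d \<in> tup ts" for d
    proof -
      have "{x \<in> tup ss. x @ d \<in> ?R} = {x \<in> tup ss. d @ x \<in> R}"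
        using that swapset_iff[OF tuples_length[OF that]] by blast
      then show ?thesis using that by (simp add: pdef_def)
    qed
    ultimately show "{x \<in> tup ss. c @ x \<in> R} \<in> P \<longleftrightarrow> {x \<in> tup ss. c' @ x \<in> R} \<in> P"
      using eqt_tup[OF c] by simp
  qed
qed

text \<open>A formula over \<open>C\<close> defines a set that is definable over \<open>B\<close>,
  so it has the same truth value at all realisations of \<open>p\<close>.\<close>

lemma restriction_eq_tp:
  assumes p: "p \<in> complete_types L M ss B" and x: "realises M ss x p" and C: "C \<subseteq> dcl L M B"
  shows "restriction L M ss p C = tp L M x C"
proof -
  have xt: "x \<in> tup ss" using x by (simp add: realises_def)
  have p: "p = tp L M x B" by (rule complete_type_eq_tp[OF p x])
  have "(\<forall>y. realises M ss y p \<longrightarrow> holds M \<psi> y) \<longleftrightarrow> x \<in> dset ss \<psi>" if "\<psi> \<in> pfms L M ss C" for \<psi>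
  proof -
    have "dfb B ss (dset ss \<psi>)" using dfb_dcl dfb_mono[OF dfb_dset[OF that] C] by blast
    then have *: "x \<in> dset ss \<psi> \<longleftrightarrow> y \<in> dset ss \<psi>" if "eqt B ss x y" for y by (rule eqtD[OF that])
    have h: "holds M \<psi> y \<longleftrightarrow> y \<in> dset ss \<psi>" if "eqt B ss x y" for y
      using eqt_tup(2)[OF that] by (simp add: dset_def)
    show ?thesis unfolding p realises_tp_iff[OF xt]
    proof
      assume "\<forall>y. eqt B ss x y \<longrightarrow> holds M \<psi> y"
      then show "x \<in> dset ss \<psi>" using h eqt_refl[OF xt] by blast
    next
      assume "x \<in> dset ss \<psi>"
      then show "\<forall>y. eqt B ss x y \<longrightarrow> holds M \<psi> y" using h * by blast
    qed
  qed
  then show ?thesis unfolding restriction_def set_eq_iff tp_iff[OF xt] mem_Collect_eq by blast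
qed

text \<open>Both halves come from the invariant \<open>P\<close>: the type of a realisation of
  \<open>P\<close> over \<open>D\<close> does not fork, by \<open>not_forks\<close>, and
  \<open>nonforking_unique\<close> puts every formula of a nonforking extension into
  \<open>P\<close>.\<close>

lemma stationary_restriction:
  assumes "gty L M \<kappa> ss P" and inv: "gty.inv L M ss P K" and K: "K \<subseteq> univ M" "small \<kappa> K"
    and x0: "gty.rz L M ss P K x0"
  shows "stationary L M \<kappa> ss K (tp L M x0 K)"
proof -
  interpret gty L M \<kappa> ss P by fact
  have x0t: "x0 \<in> tup ss" using rz_tup[OF x0] .
  have rz_real: "realises M ss y (tp L M x D)" if "rz D x" "rz D y" "D \<subseteq> univ M" for D x y
    using realises_tp_iff[OF rz_tup[OF that(1)]] rz_eqt[OF that] by simp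
  show ?thesis unfolding stationary_def
  proof (intro conjI allI impI)
    show "tp L M x0 K \<in> complete_types L M ss K" by (rule tp_complete[OF x0t])
    fix D assume "K \<subseteq> D \<and> D \<subseteq> univ M \<and> small \<kappa> D"
    then have D: "K \<subseteq> D" "D \<subseteq> univ M" "small \<kappa> D" by auto
    obtain x where x: "rz D x" using rz_ex[OF D(2,3)] .
    have xt: "x \<in> tup ss" using rz_tup[OF x] .
    show "\<exists>!q. q \<in> complete_types L M ss D \<and> tp L M x0 K \<subseteq> q \<and> \<not> forks L M ss q K"
    proof (rule ex1I[of _ "tp L M x D"], intro conjI)
      show "tp L M x D \<in> complete_types L M ss D" by (rule tp_complete[OF xt])
      have "eqt K ss x0 x" by (rule rz_eqt[OF x0 rz_mono[OF x D(1)] K(1)])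
      then have "tp L M x0 K = tp L M x K" using eqt_iff_tp[OF x0t xt] by simp
      then show "tp L M x0 K \<subseteq> tp L M x D" using tp_subset[OF xt D(1)] by simp
      show "\<not> forks L M ss (tp L M x D) K"
        by (rule not_forks[OF inv K(1) D(2,3)]) (rule rz_real[OF x _ D(2)])
      fix q assume q: "q \<in> complete_types L M ss D \<and> tp L M x0 K \<subseteq> q \<and> \<not> forks L M ss q K"
      obtain y where y: "realises M ss y q" using complete_type_realised q D by blast
      have qy: "q = tp L M y D" using complete_type_eq_tp q y by blast
      have yt: "y \<in> tup ss" using y by (simp add: realises_def)
      have "eqt D ss y x"
      proof (rule eqtI[OF yt xt])
        fix S assume S: "dfb D ss S" "y \<in> S"
        obtain c where c: "set c \<subseteq> D" "dfb (set c) ss S" using S(1) by (rule dfb_finite)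
        have ct: "c \<in> tup (map (sort_of M) c)" using c D by (intro tuplesI) auto
        have "dfb (K \<union> set c) ss S" using dfb_mono[OF c(2)] by simp
        then obtain R where R: "dfb K (ss @ map (sort_of M) c) R" "S = {x \<in> tup ss. x @ c \<in> R}"
          using ct by (rule dfb_abs)
        have "{x \<in> tup ss. x @ c \<in> R} \<in> P"
        proof (rule nonforking_unique[OF inv K _ R(1) ct])
          show "\<not> forks L M ss q K" using q by blast
          fix z assume z: "realises M ss z q"
          have zy: "eqt D ss y z" using z qy realises_tp_iff[OF yt] by simp
          then show "z @ c \<in> R" using eqtD[OF _ S(1)] S(2) R(2) by auto
          have "realises M ss z (tp L M x0 K)" using z q by (auto simp: realises_def)
          then have "eqt K ss x0 z" using realises_tp_iff[OF x0t] by simp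
          then show "rz K z" using x0 eqtD eqt_tup unfolding rz_def by blast
        qed
        then show "x \<in> S" using R(2) x S(1) by (auto simp: rz_def)
      qed
      then show "q = tp L M x D" using qy eqt_iff_tp[OF yt xt] by simp
    qed
  qed
qed

text \<open>For minimality, a base \<open>C\<close> comes with a global extension \<open>P'\<close>
  of its own, while the sequence is known to be Morley for \<open>P\<close>; the two have to be
  identified before \<open>kernel_subset_dcl\<close> can be applied over \<open>C\<close>.\<close>

theorem kernel_is_canonical_base:
  assumes B: "B \<subseteq> univ M" "small \<kappa> B" and st: "stationary L M \<kappa> ss B p"
    and mo: "morley_sequence L M ss B p a"
  shows "is_canonical_base L M \<kappa> ss B p (kernel L M a)"
proof -
  obtain P where gP: "gty L M \<kappa> ss P" and invP: "gty.inv L M ss P B"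
    and rzP: "\<And>D x. B \<subseteq> D \<Longrightarrow> D \<subseteq> univ M \<Longrightarrow> small \<kappa> D \<Longrightarrow> gty.rz L M ss P D x \<longleftrightarrow>
       x \<in> tup ss \<and> p \<subseteq> tp L M x D \<and> \<not> forks L M ss (tp L M x D) B"
    using stationary_global_type[OF B st] by blast
  interpret G: gty L M \<kappa> ss P by (rule gP)
  have pc: "p \<in> complete_types L M ss B" using st by (simp add: stationary_def)
  have pB: "p \<subseteq> pfms L M ss B" using pc by (simp add: complete_types_def)
  have realp: "realises M ss (a i) p" for i using mo by (simp add: morley_sequence_def)
  have at: "a i \<in> tup ss" for i using realp by (simp add: realises_def)
  have p: "p = tp L M (a 0) B" by (rule complete_type_eq_tp[OF pc realp])
  have rzB: "G.rz B x \<longleftrightarrow> realises M ss x p" for x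
  proof -
    obtain y where y: "G.rz B y" using G.rz_ex[OF B] .
    have "p \<subseteq> tp L M y B" and yt: "y \<in> tup ss" using rzP[of B y] y B by auto
    then have "realises M ss y p" by (auto simp: realises_def tp_def)
    then have py: "p = tp L M y B" by (rule complete_type_eq_tp[OF pc])
    show ?thesis
    proof
      assume "G.rz B x"
      then show "realises M ss x p" unfolding py realises_tp_iff[OF yt] using G.rz_eqt[OF y _ B(1)] by blast
    next
      assume "realises M ss x p"
      then have "eqt B ss y x" unfolding py realises_tp_iff[OF yt] .
      then show "G.rz B x" using y eqtD eqt_tup unfolding G.rz_def by blast
    qed
  qed
  have mor: "G.mor B n a" for n
  proof (rule G.mor_if_independent[OF invP B])
    show "G.rz B (a i)" for i using rzB realp by simp
    show "independent L M (seg a 0 n) (a n) B" for n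
      using mo by (simp add: morley_sequence_def seg_def)
  qed
  let ?K = "kernel L M a"
  have K_tail: "?K = tail_dcl L M a" by (rule G.kernel_eq_tail_dcl[OF invP B(1) mor])
  have K_dcl: "?K \<subseteq> dcl L M B" by (rule G.kernel_subset_dcl[OF invP B mor])
  have K: "?K \<subseteq> univ M" "small \<kappa> ?K"
    using K_dcl dcl_univ small_subset[OF small_dcl[OF B]] by blast+
  have invK: "G.inv ?K" using inv_tail_dcl[OF gP invP B mor] K_dcl K_tail by simp
  have rzC: "G.rz C (a 0)" if "C \<subseteq> dcl L M B" for C
    using G.rz_dcl[OF _ that] rzB realp by blast
  have "base L M \<kappa> ss B p ?K" unfolding base_def
  proof (intro conjI K_dcl)
    show "dcl L M ?K = ?K" unfolding K_tail
      by (rule dcl_tail_dcl) (use tuples_set[OF at] in blast)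
    show "\<not> forks L M ss p ?K" by (rule G.not_forks[OF invK K(1) B]) (simp add: rzB)
    show "stationary L M \<kappa> ss ?K (restriction L M ss p ?K)"
      unfolding restriction_eq_tp[OF pc realp[of 0] K_dcl]
      by (rule stationary_restriction[OF gP invK K rzC[OF K_dcl]])
  qed
  moreover have "?K \<subseteq> C" if bC: "base L M \<kappa> ss B p C" for C
  proof -
    have C: "C \<subseteq> dcl L M B" "dcl L M C = C" "\<not> forks L M ss p C"
      "stationary L M \<kappa> ss C (tp L M (a 0) C)"
      using bC restriction_eq_tp[OF pc realp, of C 0] by (auto simp: base_def)
    have Cu: "C \<subseteq> univ M" "small \<kappa> C"
      using C(1) dcl_univ small_subset[OF small_dcl[OF B]] by blast+
    obtain P' where gP': "gty L M \<kappa> ss P'" and invP': "gty.inv L M ss P' C"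
      and rzP': "\<And>D x. C \<subseteq> D \<Longrightarrow> D \<subseteq> univ M \<Longrightarrow> small \<kappa> D \<Longrightarrow> gty.rz L M ss P' D x \<longleftrightarrow>
         x \<in> tup ss \<and> tp L M (a 0) C \<subseteq> tp L M x D \<and> \<not> forks L M ss (tp L M x D) C"
      using stationary_global_type[OF Cu C(4)] by blast
    interpret G': gty L M \<kappa> ss P' by (rule gP')
    have invB: "G'.inv B" by (rule G'.inv_mono[OF invP' C(1) B(1)])
    have BC: "B \<union> C \<subseteq> univ M" "small \<kappa> (B \<union> C)" using B Cu small_Un by auto
    have BCd: "B \<union> C \<subseteq> dcl L M B" using dcl_incl[OF B(1)] C(1) by blast
    have eqBC: "eqt (B \<union> C) ss x y \<longleftrightarrow> eqt B ss x y" for x y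
      using eqt_dcl[OF _ BCd] eqt_mono[of "B \<union> C" ss x y B] by blast
    \<comment> \<open>\<open>B \<union> C\<close> has the same definable closure as
      \<open>B\<close>, so the type of \<open>a 0\<close> over it has the same realisations as
      \<open>p\<close>, which does not fork over \<open>C\<close>.\<close>
    have rz0: "G'.rz (B \<union> C) (a 0)"
    proof -
      have "tp L M (a 0) C \<subseteq> tp L M (a 0) (B \<union> C)" by (rule tp_subset[OF at]) simp
      moreover have "\<not> forks L M ss (tp L M (a 0) (B \<union> C)) C"
      proof
        assume "forks L M ss (tp L M (a 0) (B \<union> C)) C"
        then have "forks L M ss p C"
          by (rule forks_mono) (simp add: p realises_tp_iff[OF at] eqBC)
        then show False using C(3) by blast
      qed
      ultimately show ?thesis using rzP'[of "B \<union> C" "a 0"] BC at by simp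
    qed
    \<comment> \<open>On a small set containing \<open>B\<close> and \<open>C\<close>,
      \<open>P'\<close> restricts to an extension of \<open>p\<close> that does not fork over
      \<open>B\<close>, since \<open>P'\<close> is invariant over \<open>B\<close> as well.
      Stationarity makes it agree with \<open>P\<close>.\<close>
    have "S \<in> P' \<longleftrightarrow> S \<in> P" if S: "dfb (univ M) ss S" for S
    proof -
      obtain c where c: "set c \<subseteq> univ M" "dfb (set c) ss S" using S by (rule dfb_finite)
      let ?D = "B \<union> C \<union> set c"
      have D: "?D \<subseteq> univ M" "small \<kappa> ?D" using BC c by (auto intro!: small_Un small_set)
      obtain x where x: "G'.rz ?D x" using G'.rz_ex[OF D] .
      have xt: "x \<in> tup ss" using G'.rz_tup[OF x] .
      have "eqt B ss (a 0) x"
        by (rule G'.rz_eqt[OF G'.rz_mono[OF rz0] G'.rz_mono[OF x] B(1)]) auto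
      then have "p = tp L M x B" using p eqt_iff_tp[OF at xt] by simp
      then have "p \<subseteq> tp L M x ?D" using tp_subset[OF xt, of B ?D] by auto
      moreover have "\<not> forks L M ss (tp L M x ?D) B"
      proof (rule G'.not_forks[OF invB B(1) D])
        fix y assume "G'.rz ?D y"
        then have "eqt ?D ss x y" using G'.rz_eqt[OF x _ D(1)] by blast
        then show "realises M ss y (tp L M x ?D)" using realises_tp_iff[OF xt] by simp
      qed
      ultimately have "G.rz ?D x" using rzP[of ?D x] D xt by auto
      moreover have "dfb ?D ss S" using dfb_mono[OF c(2)] by auto
      ultimately show ?thesis using G.rz_iff[of ?D x S] G'.rz_iff[OF x, of S] D by blast
    qed
    then have "P' = P" using G.P_dfb G'.P_dfb by blast
    then have invC: "G.inv C" using invP' by simp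
    have "?K \<subseteq> dcl L M C"
      by (rule G.kernel_subset_dcl[OF invC Cu]) (rule G.mor_dcl[OF mor C(1) B(1)])
    then show ?thesis using C(2) by simp
  qed
  ultimately show ?thesis by (simp add: is_canonical_base_def)
qed

end

section \<open>Formulas about imaginaries as formulas about the home sorts\<close>

lemma eval_in_univ:
  assumes "is_struc L M" "e \<in> tuples M \<Gamma>" "wf_tm L \<Gamma> t"
  shows "eval M e t \<in> univ M \<and> sort_of M (eval M e t) = tm_sort L \<Gamma> t"
  using assms(3)
proof (induction t)
  case (Var i)
  have l: "length e = length \<Gamma>" and m: "map (sort_of M) e = \<Gamma>" and u: "set e \<subseteq> univ M"
    using assms(2) by (auto simp: tuples_def)
  have i: "i < length e" using Var l by simp
  then have "sort_of M (e ! i) = \<Gamma> ! i" using m by (metis nth_map)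
  then show ?case using i u nth_mem[OF i] by auto
next
  case (Fn f ts)
  have *: "eval M e t \<in> univ M \<and> sort_of M (eval M e t) = tm_sort L \<Gamma> t" if "t \<in> set ts" for t
    using Fn that by (simp add: list_all_iff)
  have "map (sort_of M) (map (eval M e) ts) = map (tm_sort L \<Gamma>) ts" using * by simp
  also have "\<dots> = fdom L f" using Fn.prems by simp
  finally have "map (eval M e) ts \<in> tuples M (fdom L f)" using * unfolding tuples_def by auto
  then show ?case using assms(1) Fn.prems by (simp add: is_struc_def)
qed

lemma nth_concat_block:
  assumes "i < length xss"
  shows "map ((!) (concat xss))
    [length (concat (take i xss))..<length (concat (take i xss)) + length (xss ! i)] = xss ! i"
proof -
  have "concat xss = concat (take i xss) @ xss ! i @ concat (drop (Suc i) xss)"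
    using id_take_nth_drop[OF assms] by (metis concat.simps(2) concat_append)
  then show ?thesis by (intro nth_equalityI) (auto simp: nth_append)
qed

primrec hsorts :: "('s, 'f, 'r) eqsort \<Rightarrow> 's list" where
  "hsorts (Home s) = [s]"
| "hsorts (Quot ss E) = ss"

definition offset :: "('s, 'f, 'r) eqsort list \<Rightarrow> nat \<Rightarrow> nat" where
  "offset \<Gamma> i = length (concat (map hsorts (take i \<Gamma>)))"

text \<open>A term of a quotient sort is replaced by home terms denoting a representative of its
  class. So \<open>Proj\<close> disappears: its arguments are such a representative.\<close>

primrec home_tms :: "('s, 'f, 'r) eqsort list \<Rightarrow> ('s, 'f, 'r) eqfun tm \<Rightarrow> 'f tm list" where
  "home_tms \<Gamma> (Var i) = map Var [offset \<Gamma> i..<offset \<Gamma> i + length (hsorts (\<Gamma> ! i))]"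
| "home_tms \<Gamma> (Fn g ts) = (case g of Orig f \<Rightarrow> [Fn f (concat (map (home_tms \<Gamma>) ts))]
     | Proj ss E \<Rightarrow> concat (map (home_tms \<Gamma>) ts))"

locale eq_struc =
  fixes L :: "('s, 'f, 'r) lang" and T :: "('s, 'f, 'r) fm set"
    and TA :: "'a itself"
    and N :: "('a, ('s, 'f, 'r) eqsort, ('s, 'f, 'r) eqfun, 'r) struc"
  assumes wfL: "wf_lang L" and compl: "complete TA L T"
    and N: "N \<in> Mod (lang_eq TA L T) (theory_eq TA L T)"
begin

abbreviation Leq :: "(('s, 'f, 'r) eqsort, ('s, 'f, 'r) eqfun, 'r) lang" where
  "Leq \<equiv> lang_eq TA L T"

abbreviation "equivs \<equiv> def_equivs TA L T"

text \<open>The part of \<open>N\<close> on the home sorts. Its elements have the same type as those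
  of \<open>N\<close>, so it is one of the models of which completeness and stability of
  \<open>T\<close> speak.\<close>

definition H :: "('a, 's, 'f, 'r) struc" where
  "H = \<lparr>univ = {d \<in> univ N. \<exists>s. sort_of N d = Home s},
    sort_of = (\<lambda>d. case sort_of N d of Home s \<Rightarrow> s | Quot _ _ \<Rightarrow> undefined),
    fint = (\<lambda>f. fint N (Orig f)), rint = rint N\<rparr>"

definition pj :: "('s, 'f, 'r) eqsort \<Rightarrow> 'a list \<Rightarrow> 'a" where
  "pj s v = (case s of Home _ \<Rightarrow> hd v | Quot ss E \<Rightarrow> fint N (Proj ss E) v)"

abbreviation "reps \<equiv> list_all2 (\<lambda>s v. v \<in> tuples H (hsorts s))"

abbreviation "pjs \<equiv> map2 pj"

abbreviation "hctx \<Gamma> \<equiv> concat (map hsorts \<Gamma>)"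

lemma N_struc: "is_struc Leq N"
  using N by (simp add: Mod_def)

lemma Leq_simps [simp]:
  "Home s \<in> Sorts Leq \<longleftrightarrow> s \<in> Sorts L"
  "Quot ss E \<in> Sorts Leq \<longleftrightarrow> (ss, E) \<in> equivs"
  "Orig f \<in> Funs Leq \<longleftrightarrow> f \<in> Funs L"
  "Proj ss E \<in> Funs Leq \<longleftrightarrow> (ss, E) \<in> equivs"
  "Rels Leq = Rels L"
  "fdom Leq (Orig f) = map Home (fdom L f)" "fdom Leq (Proj ss E) = map Home ss"
  "fcod Leq (Orig f) = Home (fcod L f)" "fcod Leq (Proj ss E) = Quot ss E"
  "rdom Leq r = map Home (rdom L r)"
  by (auto simp: lang_eq_def)

lemma H_elem: "d \<in> univ H \<and> sort_of H d = s \<longleftrightarrow> d \<in> univ N \<and> sort_of N d = Home s"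
  by (auto simp: H_def)

lemma H_tuples: "tuples H ss = tuples N (map Home ss)"
proof (induction ss)
  case (Cons s ss)
  then show ?case using H_elem by (fastforce simp: tuples_Cons set_eq_iff)
qed simp

lemma eval_home: "eval N e (map_tm Orig t) = eval H e t"
proof (induction t)
  case (Fn f ts)
  then have "map (eval N e \<circ> map_tm Orig) ts = map (eval H e) ts" by simp
  then show ?case by (simp add: H_def del: map_eq_conv)
qed simp

lemma sat_home: "sat N (home_fm \<phi>) e \<longleftrightarrow> sat H \<phi> e"
proof (induction \<phi> arbitrary: e)
  case (Rel r ts)
  have "map (eval N e \<circ> map_tm Orig) ts = map (eval H e) ts" by (simp add: eval_home)
  then show ?case by (simp add: H_def del: map_eq_conv)
next
  case (Exists s \<phi>)
  have "sat N (home_fm (Exists s \<phi>)) e \<longleftrightarrow>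
      (\<exists>d. (d \<in> univ N \<and> sort_of N d = Home s) \<and> sat N (home_fm \<phi>) (d # e))" by auto
  also have "\<dots> \<longleftrightarrow> sat H (Exists s \<phi>) e" unfolding H_elem[symmetric] Exists.IH by auto
  finally show ?case .
qed (simp_all add: eval_home)

lemma H_struc: "is_struc L H"
  unfolding is_struc_def
proof (intro conjI ballI)
  show "sort_of H ` univ H = Sorts L"
  proof (intro set_eqI iffI)
    fix s assume "s \<in> sort_of H ` univ H"
    then obtain d where "d \<in> univ N" "sort_of N d = Home s" using H_elem by blast
    then have "Home s \<in> Sorts Leq" using N_struc unfolding is_struc_def by (metis imageI)
    then show "s \<in> Sorts L" by simp
  next
    fix s assume "s \<in> Sorts L"
    then have "Home s \<in> sort_of N ` univ N" using N_struc by (simp add: is_struc_def)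
    then obtain d where "d \<in> univ N" "sort_of N d = Home s" by (metis imageE)
    then have "d \<in> univ H \<and> sort_of H d = s" using H_elem by simp
    then show "s \<in> sort_of H ` univ H" by blast
  qed
  fix f x assume f: "f \<in> Funs L" "x \<in> tuples H (fdom L f)"
  then have "Orig f \<in> Funs Leq" "x \<in> tuples N (fdom Leq (Orig f))" by (simp_all add: H_tuples)
  then have "fint N (Orig f) x \<in> univ N \<and> sort_of N (fint N (Orig f) x) = fcod Leq (Orig f)"
    using N_struc unfolding is_struc_def by blast
  then have "fint H f x \<in> univ N \<and> sort_of N (fint H f x) = Home (fcod L f)" by (simp add: H_def)
  then show "fint H f x \<in> univ H" "sort_of H (fint H f x) = fcod L f" using H_elem by blast+
qed

lemma H_Mod: "H \<in> Mod L T"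
proof -
  have "sat H \<phi> []" if "\<phi> \<in> T" for \<phi>
    using N that sat_home by (auto simp: Mod_def theory_eq_def)
  then show ?thesis using H_struc by (simp add: Mod_def)
qed

lemma def_equiv_sorts: "(ss, E) \<in> equivs \<Longrightarrow> set ss \<subseteq> Sorts L \<and> wf_fm L (ss @ ss) E"
  by (auto simp: def_equivs_def)

lemma proj_eq_iff:
  assumes E: "(ss, E) \<in> equivs" and x: "x \<in> tuples H ss" "y \<in> tuples H ss"
  shows "fint N (Proj ss E) x = fint N (Proj ss E) y \<longleftrightarrow> sat H E (x @ y)"
proof -
  have "sat N (proj_kernel ss E) []" using N E by (auto simp: Mod_def theory_eq_def)
  moreover have "x @ y \<in> tuples N (map Home (ss @ ss))"
    using tuples_append[OF x] by (simp add: H_tuples)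
  ultimately have *: "eval N (x @ y) (Fn (Proj ss E) (map Var [0..<length ss])) =
      eval N (x @ y) (Fn (Proj ss E) (map Var [length ss..<2 * length ss])) \<longleftrightarrow> sat N (home_fm E) (x @ y)"
    unfolding proj_kernel_def Let_def sat_fold_Forall by fastforce
  have l: "length x = length ss" "length y = length ss" using x tuples_length by auto
  have "map (eval N (x @ y)) (map Var [0..<length ss]) = x"
    "map (eval N (x @ y)) (map Var [length ss..<2 * length ss]) = y"
    using l by (auto intro!: nth_equalityI simp: nth_append)
  then show ?thesis using * sat_home by simp
qed

lemma proj_onto:
  assumes d: "d \<in> univ N" "sort_of N d = Quot ss E"
  shows "\<exists>x\<in>tuples H ss. fint N (Proj ss E) x = d"
proof -
  have "Quot ss E \<in> Sorts Leq" using N_struc d unfolding is_struc_def by (metis imageI)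
  then have "sat N (proj_onto ss E) []" using N by (auto simp: Mod_def theory_eq_def)
  then obtain x where x: "x \<in> tuples N (map Home ss)"
    "eval N (x @ [d]) (Fn (Proj ss E) (map Var [0..<length ss])) = eval N (x @ [d]) (Var (length ss))"
    using d unfolding proj_onto_def Let_def by (auto simp: sat_fold_Exists)
  have l: "length x = length ss" using tuples_length[OF x(1)] by simp
  then have "map (eval N (x @ [d])) (map Var [0..<length ss]) = x"
    by (auto intro!: nth_equalityI simp: nth_append)
  then have "fint N (Proj ss E) x = d" using x(2) l by (simp add: nth_append)
  then show ?thesis using x(1) by (auto simp: H_tuples)
qed

lemma pj_in:
  assumes "s \<in> Sorts Leq" "v \<in> tuples H (hsorts s)"
  shows "pj s v \<in> univ N \<and> sort_of N (pj s v) = s"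
proof (cases s)
  case (Home s')
  then show ?thesis using assms by (auto simp: pj_def H_tuples tuples_Cons)
next
  case (Quot ss E)
  then have "Proj ss E \<in> Funs Leq" "v \<in> tuples N (fdom Leq (Proj ss E))"
    using assms by (auto simp: H_tuples)
  then have "fint N (Proj ss E) v \<in> univ N \<and> sort_of N (fint N (Proj ss E) v) = fcod Leq (Proj ss E)"
    using N_struc unfolding is_struc_def by blast
  then show ?thesis using Quot by (simp add: pj_def)
qed

lemma pj_onto:
  assumes "d \<in> univ N" shows "\<exists>v\<in>tuples H (hsorts (sort_of N d)). pj (sort_of N d) v = d"
proof (cases "sort_of N d")
  case (Home s)
  then have "[d] \<in> tuples H [s]" using assms by (simp add: H_tuples tuples_Cons)
  then show ?thesis using Home by (force simp: pj_def)
next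
  case (Quot ss E)
  then show ?thesis using proj_onto[OF assms Quot] by (simp add: pj_def)
qed

lemma pjs_in: "reps \<Gamma> vs \<Longrightarrow> set \<Gamma> \<subseteq> Sorts Leq \<Longrightarrow> pjs \<Gamma> vs \<in> tuples N \<Gamma>"
  by (induction \<Gamma> vs rule: list_all2_induct) (auto simp: tuples_Cons pj_in)

lemma pjs_onto: "x \<in> tuples N \<Gamma> \<Longrightarrow> \<exists>vs. reps \<Gamma> vs \<and> pjs \<Gamma> vs = x"
proof (induction \<Gamma> arbitrary: x)
  case (Cons s \<Gamma>)
  then obtain d y where x: "x = d # y" "d \<in> univ N" "sort_of N d = s" "y \<in> tuples N \<Gamma>"
    by (auto simp: tuples_Cons)
  then obtain v vs where "v \<in> tuples H (hsorts s)" "pj s v = d" "reps \<Gamma> vs" "pjs \<Gamma> vs = y"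
    using pj_onto[of d] Cons.IH by blast
  then show ?case using x(1) by (intro exI[of _ "v # vs"]) simp
qed simp

lemma reps_concat: "reps \<Gamma> vs \<Longrightarrow> concat vs \<in> tuples H (hctx \<Gamma>)"
  by (induction \<Gamma> vs rule: list_all2_induct) (auto simp: tuples_append)

lemma concat_reps: "w \<in> tuples H (hctx \<Gamma>) \<Longrightarrow> \<exists>vs. reps \<Gamma> vs \<and> concat vs = w"
proof (induction \<Gamma> arbitrary: w)
  case (Cons s \<Gamma>)
  then have "w \<in> tuples H (hsorts s @ hctx \<Gamma>)" by simp
  then obtain v w' where w: "w = v @ w'" "v \<in> tuples H (hsorts s)" "w' \<in> tuples H (hctx \<Gamma>)"
    by (rule tuples_appendE)
  then obtain vs where "reps \<Gamma> vs" "concat vs = w'" using Cons.IH by blast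
  then show ?case using w by (intro exI[of _ "v # vs"]) simp
qed simp

lemma reps_block:
  assumes "reps \<Gamma> vs" "i < length \<Gamma>"
  shows "map ((!) (concat vs)) [offset \<Gamma> i..<offset \<Gamma> i + length (hsorts (\<Gamma> ! i))] = vs ! i"
proof -
  have l: "length vs = length \<Gamma>" using assms(1) by (simp add: list_all2_lengthD)
  have len: "length (vs ! j) = length (hsorts (\<Gamma> ! j))" if "j < length \<Gamma>" for j
    using assms(1) that tuples_length by (metis (mono_tags, lifting) list_all2_conv_all_nth)
  have "map length (take i vs) = map length (map hsorts (take i \<Gamma>))"
    using l assms(2) len by (auto intro!: nth_equalityI)
  then have "length (concat (take i vs)) = offset \<Gamma> i"
    unfolding offset_def length_concat by simp
  then show ?thesis using nth_concat_block[of i vs] l len assms(2) by simp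
qed

lemma hctx_block:
  assumes "i < length \<Gamma>"
  shows "map ((!) (hctx \<Gamma>)) [offset \<Gamma> i..<offset \<Gamma> i + length (hsorts (\<Gamma> ! i))] = hsorts (\<Gamma> ! i)"
  using nth_concat_block[of i "map hsorts \<Gamma>"] assms by (simp add: offset_def take_map)

lemma offset_le:
  assumes "i < length \<Gamma>" shows "offset \<Gamma> i + length (hsorts (\<Gamma> ! i)) \<le> length (hctx \<Gamma>)"
proof -
  have "\<Gamma> = take i \<Gamma> @ \<Gamma> ! i # drop (Suc i) \<Gamma>" by (rule id_take_nth_drop[OF assms])
  then have "hctx \<Gamma> = hctx (take i \<Gamma>) @ hsorts (\<Gamma> ! i) @ hctx (drop (Suc i) \<Gamma>)"
    by (metis concat.simps(2) concat_append list.simps(9) map_append)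
  then show ?thesis by (simp add: offset_def)
qed

lemma home_tms:
  assumes "wf_tm Leq \<Gamma> t" "set \<Gamma> \<subseteq> Sorts Leq"
  shows "list_all (wf_tm L (hctx \<Gamma>)) (home_tms \<Gamma> t) \<and>
    map (tm_sort L (hctx \<Gamma>)) (home_tms \<Gamma> t) = hsorts (tm_sort Leq \<Gamma> t) \<and>
    tm_sort Leq \<Gamma> t \<in> Sorts Leq \<and>
    (\<forall>vs. reps \<Gamma> vs \<longrightarrow>
       pj (tm_sort Leq \<Gamma> t) (map (eval H (concat vs)) (home_tms \<Gamma> t)) = eval N (pjs \<Gamma> vs) t)"
  using assms(1)
proof (induction t)
  case (Var i)
  then have i: "i < length \<Gamma>" by simp
  have 1: "list_all (wf_tm L (hctx \<Gamma>)) (home_tms \<Gamma> (Var i))"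
    using offset_le[OF i] by (auto simp: list_all_iff)
  have 2: "map (tm_sort L (hctx \<Gamma>)) (home_tms \<Gamma> (Var i)) = hsorts (\<Gamma> ! i)"
    using hctx_block[OF i] by (simp add: comp_def)
  have "\<Gamma> ! i \<in> Sorts Leq" using assms(2) i by auto
  moreover have "pj (\<Gamma> ! i) (map (eval H (concat vs)) (home_tms \<Gamma> (Var i))) = eval N (pjs \<Gamma> vs) (Var i)"
    if "reps \<Gamma> vs" for vs
    using reps_block[OF that i] i list_all2_lengthD[OF that] by (simp add: comp_def)
  ultimately show ?case using 1 2 by simp
next
  case (Fn g ts)
  have wf: "g \<in> Funs Leq" "map (tm_sort Leq \<Gamma>) ts = fdom Leq g" using Fn.prems by auto
  obtain hs where hs: "fdom Leq g = map Home hs" by (cases g) auto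
  have IH: "list_all (wf_tm L (hctx \<Gamma>)) (home_tms \<Gamma> t)"
    "map (tm_sort L (hctx \<Gamma>)) (home_tms \<Gamma> t) = hsorts (tm_sort Leq \<Gamma> t)"
    "\<And>vs. reps \<Gamma> vs \<Longrightarrow>
       pj (tm_sort Leq \<Gamma> t) (map (eval H (concat vs)) (home_tms \<Gamma> t)) = eval N (pjs \<Gamma> vs) t"
    if "t \<in> set ts" for t
    using Fn.IH[OF that] Fn.prems that by (auto simp: list_all_iff)
  \<comment> \<open>The arguments of every function symbol have home sorts, so each contributes a
    single home term.\<close>
  have single: "\<exists>s. tm_sort Leq \<Gamma> t = Home s" if "t \<in> set ts" for t
  proof -
    have "tm_sort Leq \<Gamma> t \<in> set (map Home hs)" using that wf(2) hs by (metis image_eqI list.set_map)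
    then show ?thesis by auto
  qed
  have wf_args: "list_all (wf_tm L (hctx \<Gamma>)) (concat (map (home_tms \<Gamma>) ts))"
    using IH(1) by (auto simp: list_all_iff)
  have "map (tm_sort L (hctx \<Gamma>)) (concat (map (home_tms \<Gamma>) ts)) =
      concat (map (\<lambda>t. map (tm_sort L (hctx \<Gamma>)) (home_tms \<Gamma> t)) ts)"
    by (simp add: map_concat comp_def)
  also have "\<dots> = concat (map hsorts (map (tm_sort Leq \<Gamma>) ts))" using IH(2) by (simp cong: map_cong)
  also have "\<dots> = hs" unfolding wf(2) hs by (induction hs) auto
  finally have sort_args: "map (tm_sort L (hctx \<Gamma>)) (concat (map (home_tms \<Gamma>) ts)) = hs" .
  have eval_args: "map (eval H (concat vs)) (concat (map (home_tms \<Gamma>) ts)) = map (eval N (pjs \<Gamma> vs)) ts"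
    if vs: "reps \<Gamma> vs" for vs
  proof -
    have "map (eval H (concat vs)) (home_tms \<Gamma> t) = [eval N (pjs \<Gamma> vs) t]" if t: "t \<in> set ts" for t
    proof -
      obtain s where s: "tm_sort Leq \<Gamma> t = Home s" using single[OF t] by blast
      then have "length (home_tms \<Gamma> t) = 1" using IH(2)[OF t] by (metis hsorts.simps(1) length_map length_Cons list.size(3) One_nat_def)
      then obtain u where u: "home_tms \<Gamma> t = [u]" by (auto simp: length_Suc_conv)
      then show ?thesis using IH(3)[OF t vs] s by (simp add: pj_def)
    qed
    then have "map (\<lambda>t. map (eval H (concat vs)) (home_tms \<Gamma> t)) ts = map (\<lambda>t. [eval N (pjs \<Gamma> vs) t]) ts"
      by simp
    then show ?thesis by (simp add: map_concat comp_def del: map_eq_conv)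
  qed
  show ?case
  proof (cases g)
    case (Orig f)
    then have f: "f \<in> Funs L" "hs = fdom L f"
      using wf hs by (auto simp: inj_map_eq_map[of Home] inj_def)
    have "fcod L f \<in> Sorts L" using wfL f by (auto simp: wf_lang_def)
    moreover have "pj (Home (fcod L f)) (map (eval H (concat vs)) (home_tms \<Gamma> (Fn g ts))) =
        eval N (pjs \<Gamma> vs) (Fn g ts)" if "reps \<Gamma> vs" for vs
      using eval_args[OF that] Orig by (simp add: pj_def H_def)
    ultimately show ?thesis using Orig wf_args sort_args f by simp
  next
    case (Proj ss E)
    then have f: "(ss, E) \<in> equivs" "hs = ss"
      using wf hs by (auto simp: inj_map_eq_map[of Home] inj_def)
    have "pj (Quot ss E) (map (eval H (concat vs)) (home_tms \<Gamma> (Fn g ts))) =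
        eval N (pjs \<Gamma> vs) (Fn g ts)" if "reps \<Gamma> vs" for vs
      using eval_args[OF that] Proj by (simp add: pj_def)
    then show ?thesis using Proj wf_args sort_args f by simp
  qed
qed

text \<open>Elements are replaced by blocks of representatives: an equation between classes of
  \<open>E\<close> becomes an instance of \<open>E\<close>, and a quantifier over a quotient sort
  becomes a block of quantifiers over home sorts.\<close>

lemma home_formula:
  "wf_fm Leq \<Gamma> \<phi> \<Longrightarrow> set \<Gamma> \<subseteq> Sorts Leq \<Longrightarrow>
    \<exists>\<phi>'. wf_fm L (hctx \<Gamma>) \<phi>' \<and> (\<forall>vs. reps \<Gamma> vs \<longrightarrow> (sat H \<phi>' (concat vs) \<longleftrightarrow> sat N \<phi> (pjs \<Gamma> vs)))"
proof (induction \<phi> arbitrary: \<Gamma>)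
  case (Eq t u)
  then have wf: "wf_tm Leq \<Gamma> t" "wf_tm Leq \<Gamma> u" "tm_sort Leq \<Gamma> t = tm_sort Leq \<Gamma> u" by auto
  note t = home_tms[OF wf(1) Eq.prems(2)] and u = home_tms[OF wf(2) Eq.prems(2)]
  let ?t = "home_tms \<Gamma> t" and ?u = "home_tms \<Gamma> u"
  show ?case
  proof (cases "tm_sort Leq \<Gamma> t")
    case (Home s)
    have "length ?t = 1" "length ?u = 1"
      using t u wf(3) Home by (metis hsorts.simps(1) length_map length_Cons list.size(3) One_nat_def)+
    then obtain t' u' where tu: "?t = [t']" "?u = [u']" by (auto simp: length_Suc_conv)
    have "tm_sort Leq \<Gamma> u = Home s" using Home wf(3) by simp
    then have "wf_fm L (hctx \<Gamma>) (Eq t' u')" using t u tu by (simp add: Home)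
    moreover have "sat H (Eq t' u') (concat vs) \<longleftrightarrow> sat N (Eq t u) (pjs \<Gamma> vs)" if "reps \<Gamma> vs" for vs
    proof -
      have "eval H (concat vs) t' = eval N (pjs \<Gamma> vs) t" "eval H (concat vs) u' = eval N (pjs \<Gamma> vs) u"
        using t u tu that Home wf(3) by (auto simp: pj_def)
      then show ?thesis by simp
    qed
    ultimately show ?thesis by blast
  next
    case (Quot ss E)
    have su: "tm_sort Leq \<Gamma> u = Quot ss E" using Quot wf(3) by simp
    have E: "(ss, E) \<in> equivs" using t Quot by simp
    have wfE: "wf_fm L (ss @ ss) E" using def_equiv_sorts[OF E] by blast
    let ?\<sigma> = "\<lambda>i. (?t @ ?u) ! i"
    have so: "map (tm_sort L (hctx \<Gamma>)) (?t @ ?u) = ss @ ss" using t u by (simp add: Quot su)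
    then have len: "length (?t @ ?u) = length (ss @ ss)" by (metis length_map)
    have "wf_subst L (ss @ ss) (hctx \<Gamma>) ?\<sigma>" unfolding wf_subst_def
    proof (intro allI impI)
      fix i assume i: "i < length (ss @ ss)"
      then have "(?t @ ?u) ! i \<in> set (?t @ ?u)" using len nth_mem by metis
      then have "wf_tm L (hctx \<Gamma>) (?\<sigma> i)" using t u by (auto simp: list_all_iff)
      moreover have "tm_sort L (hctx \<Gamma>) (?\<sigma> i) = (ss @ ss) ! i"
        using so i len by (metis nth_map)
      ultimately show "wf_tm L (hctx \<Gamma>) (?\<sigma> i) \<and> tm_sort L (hctx \<Gamma>) (?\<sigma> i) = (ss @ ss) ! i" ..
    qed
    from wf_subst_fm[OF this wfE] have "wf_fm L (hctx \<Gamma>) (subst_fm ?\<sigma> E)" .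
    moreover have "sat H (subst_fm ?\<sigma> E) (concat vs) \<longleftrightarrow> sat N (Eq t u) (pjs \<Gamma> vs)" if vs: "reps \<Gamma> vs" for vs
    proof -
      let ?e = "eval H (concat vs)"
      have "subst_env H (length (ss @ ss)) ?\<sigma> (concat vs) = map ?e (?t @ ?u)"
        unfolding subst_env_def len[symmetric] by (rule nth_equalityI) (auto simp: nth_append)
      then have "sat H (subst_fm ?\<sigma> E) (concat vs) \<longleftrightarrow> sat H E (map ?e ?t @ map ?e ?u)"
        using sat_subst_fm[OF wfE, of H ?\<sigma> "concat vs"] by simp
      also have "\<dots> \<longleftrightarrow> fint N (Proj ss E) (map ?e ?t) = fint N (Proj ss E) (map ?e ?u)"
      proof (rule proj_eq_iff[OF E, symmetric])
        have in_H: "map ?e us \<in> tuples H ss"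
          if us: "list_all (wf_tm L (hctx \<Gamma>)) us" "map (tm_sort L (hctx \<Gamma>)) us = ss" for us
          using eval_in_univ[OF H_struc reps_concat[OF vs]] us unfolding tuples_def
          by (force simp: list_all_iff)
        show "map ?e ?t \<in> tuples H ss" "map ?e ?u \<in> tuples H ss"
          using in_H t u by (simp_all add: Quot su)
      qed
      also have "\<dots> \<longleftrightarrow> sat N (Eq t u) (pjs \<Gamma> vs)"
      proof -
        have "fint N (Proj ss E) (map ?e ?t) = eval N (pjs \<Gamma> vs) t"
          "fint N (Proj ss E) (map ?e ?u) = eval N (pjs \<Gamma> vs) u"
          using t u vs by (simp_all add: Quot su pj_def)
        then show ?thesis by simp
      qed
      finally show ?thesis .
    qed
    ultimately show ?thesis by blast
  qed
next
  case (Rel r ts)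
  have wf: "r \<in> Rels L" "map (tm_sort Leq \<Gamma>) ts = map Home (rdom L r)" using Rel.prems by auto
  have IH: "list_all (wf_tm L (hctx \<Gamma>)) (home_tms \<Gamma> t) \<and>
    map (tm_sort L (hctx \<Gamma>)) (home_tms \<Gamma> t) = hsorts (tm_sort Leq \<Gamma> t) \<and>
    (\<forall>vs. reps \<Gamma> vs \<longrightarrow>
       pj (tm_sort Leq \<Gamma> t) (map (eval H (concat vs)) (home_tms \<Gamma> t)) = eval N (pjs \<Gamma> vs) t)"
    if "t \<in> set ts" for t
    using home_tms[of \<Gamma> t] Rel.prems that by (auto simp: list_all_iff)
  have single: "\<exists>u s. home_tms \<Gamma> t = [u] \<and> tm_sort Leq \<Gamma> t = Home s" if t: "t \<in> set ts" for t
  proof -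
    have "tm_sort Leq \<Gamma> t \<in> set (map Home (rdom L r))" using t wf(2) by (metis image_eqI list.set_map)
    then obtain s where s: "tm_sort Leq \<Gamma> t = Home s" by auto
    then have "length (home_tms \<Gamma> t) = 1"
      using IH[OF t] by (metis hsorts.simps(1) length_map length_Cons list.size(3) One_nat_def)
    then show ?thesis using s by (auto simp: length_Suc_conv)
  qed
  let ?us = "concat (map (home_tms \<Gamma>) ts)"
  have "map (tm_sort L (hctx \<Gamma>)) ?us = concat (map (\<lambda>t. map (tm_sort L (hctx \<Gamma>)) (home_tms \<Gamma> t)) ts)"
    by (simp add: map_concat comp_def)
  also have "\<dots> = concat (map hsorts (map (tm_sort Leq \<Gamma>) ts))" using IH by (simp cong: map_cong)
  also have "\<dots> = rdom L r" unfolding wf(2) by (simp add: comp_def concat_map_singleton)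
  finally have "wf_fm L (hctx \<Gamma>) (Rel r ?us)" using wf(1) IH by (auto simp: list_all_iff)
  moreover have "sat H (Rel r ?us) (concat vs) \<longleftrightarrow> sat N (Rel r ts) (pjs \<Gamma> vs)" if vs: "reps \<Gamma> vs" for vs
  proof -
    have "map (eval H (concat vs)) (home_tms \<Gamma> t) = [eval N (pjs \<Gamma> vs) t]" if t: "t \<in> set ts" for t
      using single[OF t] IH[OF t] vs by (auto simp: pj_def)
    then have "map (\<lambda>t. map (eval H (concat vs)) (home_tms \<Gamma> t)) ts = map (\<lambda>t. [eval N (pjs \<Gamma> vs) t]) ts"
      by simp
    then have "map (eval H (concat vs)) ?us = map (eval N (pjs \<Gamma> vs)) ts"
      by (simp add: map_concat comp_def del: map_eq_conv)
    then show ?thesis by (simp add: H_def del: map_eq_conv)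
  qed
  ultimately show ?case by blast
next
  case (Neg \<phi>)
  then obtain \<phi>' where "wf_fm L (hctx \<Gamma>) \<phi>'"
    "\<And>vs. reps \<Gamma> vs \<Longrightarrow> sat H \<phi>' (concat vs) \<longleftrightarrow> sat N \<phi> (pjs \<Gamma> vs)" by fastforce
  then show ?case by (intro exI[of _ "Neg \<phi>'"]) simp
next
  case (Conj \<phi> \<psi>)
  have wf: "wf_fm Leq \<Gamma> \<phi>" "wf_fm Leq \<Gamma> \<psi>" using Conj.prems(1) by simp_all
  from Conj.IH(1)[OF wf(1) Conj.prems(2)] obtain \<phi>' where "wf_fm L (hctx \<Gamma>) \<phi>'"
    "\<And>vs. reps \<Gamma> vs \<Longrightarrow> sat H \<phi>' (concat vs) \<longleftrightarrow> sat N \<phi> (pjs \<Gamma> vs)" by blast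
  moreover from Conj.IH(2)[OF wf(2) Conj.prems(2)] obtain \<psi>' where "wf_fm L (hctx \<Gamma>) \<psi>'"
    "\<And>vs. reps \<Gamma> vs \<Longrightarrow> sat H \<psi>' (concat vs) \<longleftrightarrow> sat N \<psi> (pjs \<Gamma> vs)" by blast
  ultimately show ?case by (intro exI[of _ "Conj \<phi>' \<psi>'"]) simp
next
  case (Exists s \<phi>)
  then have s: "s \<in> Sorts Leq" "wf_fm Leq (s # \<Gamma>) \<phi>" "set (s # \<Gamma>) \<subseteq> Sorts Leq" by auto
  from Exists.IH[OF s(2,3)] obtain \<phi>' where p0: "wf_fm L (hctx (s # \<Gamma>)) \<phi>'"
    and p: "\<forall>vs. reps (s # \<Gamma>) vs \<longrightarrow> (sat H \<phi>' (concat vs) \<longleftrightarrow> sat N \<phi> (pjs (s # \<Gamma>) vs))"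
    by (elim exE conjE)
  have "set (hsorts s) \<subseteq> Sorts L" using s(1) def_equiv_sorts by (cases s) auto
  then have "wf_fm L (hctx \<Gamma>) (fold Exists (hsorts s) \<phi>')" using p0 by (intro wf_fold_Exists) simp_all
  moreover have "sat H (fold Exists (hsorts s) \<phi>') (concat vs) \<longleftrightarrow> sat N (Exists s \<phi>) (pjs \<Gamma> vs)"
    if vs: "reps \<Gamma> vs" for vs
  proof -
    have "sat H \<phi>' (v @ concat vs) \<longleftrightarrow> sat N \<phi> (pj s v # pjs \<Gamma> vs)" if "v \<in> tuples H (hsorts s)" for v
      using p[rule_format, of "v # vs"] vs that by simp
    then have "sat H (fold Exists (hsorts s) \<phi>') (concat vs) \<longleftrightarrow>
        (\<exists>v\<in>tuples H (hsorts s). sat N \<phi> (pj s v # pjs \<Gamma> vs))"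
      by (simp add: sat_fold_Exists)
    also have "\<dots> \<longleftrightarrow> (\<exists>d\<in>univ N. sort_of N d = s \<and> sat N \<phi> (d # pjs \<Gamma> vs))"
    proof
      assume "\<exists>v\<in>tuples H (hsorts s). sat N \<phi> (pj s v # pjs \<Gamma> vs)"
      then show "\<exists>d\<in>univ N. sort_of N d = s \<and> sat N \<phi> (d # pjs \<Gamma> vs)" using pj_in[OF s(1)] by blast
    next
      assume "\<exists>d\<in>univ N. sort_of N d = s \<and> sat N \<phi> (d # pjs \<Gamma> vs)"
      then obtain d where d: "d \<in> univ N" "sort_of N d = s" "sat N \<phi> (d # pjs \<Gamma> vs)" by blast
      then obtain v where "v \<in> tuples H (hsorts s)" "pj s v = d" using pj_onto[OF d(1)] by blast
      then show "\<exists>v\<in>tuples H (hsorts s). sat N \<phi> (pj s v # pjs \<Gamma> vs)" using d(3) by blast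
    qed
    also have "\<dots> \<longleftrightarrow> sat N (Exists s \<phi>) (pjs \<Gamma> vs)" by simp
    finally show ?thesis .
  qed
  ultimately show ?case by blast
qed

text \<open>Choosing representatives turns an instance of the order property in \<open>N\<close>
  into one in \<open>H\<close>.\<close>

lemma no_order_property_eq:
  assumes st: "stable TA L T" and wf: "wf_fm Leq (xs @ ys) \<phi>"
  shows "\<not> order_property N xs ys \<phi>"
proof
  assume "order_property N xs ys \<phi>"
  then obtain a b where ab: "\<And>i::nat. a i \<in> tuples N xs" "\<And>i::nat. b i \<in> tuples N ys"
    "\<And>i j. sat N \<phi> (a i @ b j) \<longleftrightarrow> i < j" unfolding order_property_def by blast
  have sorts: "set ss \<subseteq> Sorts Leq" if "x \<in> tuples N ss" for x ss
    using that N_struc unfolding is_struc_def tuples_def by fastforce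
  have "set (xs @ ys) \<subseteq> Sorts Leq" using sorts[OF ab(1)] sorts[OF ab(2)] by simp
  from home_formula[OF wf this] obtain \<phi>' where p: "wf_fm L (hctx (xs @ ys)) \<phi>'"
    "\<And>vs. reps (xs @ ys) vs \<Longrightarrow> sat H \<phi>' (concat vs) \<longleftrightarrow> sat N \<phi> (pjs (xs @ ys) vs)" by blast
  have "\<exists>vs. reps xs vs \<and> pjs xs vs = a i" for i using pjs_onto[OF ab(1)] .
  then obtain u where u: "\<And>i. reps xs (u i)" "\<And>i. pjs xs (u i) = a i" by metis
  have "\<exists>vs. reps ys vs \<and> pjs ys vs = b i" for i using pjs_onto[OF ab(2)] .
  then obtain v where v: "\<And>i. reps ys (v i)" "\<And>i. pjs ys (v i) = b i" by metis
  have "sat H \<phi>' (concat (u i) @ concat (v j)) \<longleftrightarrow> i < j" for i j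
  proof -
    have r: "reps (xs @ ys) (u i @ v j)" using u v by (simp add: list_all2_appendI)
    have "pjs (xs @ ys) (u i @ v j) = a i @ b j"
      using u v list_all2_lengthD[OF u(1)[of i]] by simp
    then show ?thesis using p(2)[OF r] ab(3) by simp
  qed
  then have "order_property H (hctx xs) (hctx ys) \<phi>'"
    unfolding order_property_def using reps_concat[OF u(1)] reps_concat[OF v(1)]
    by (intro exI[of _ "\<lambda>i. concat (u i)"] exI[of _ "\<lambda>i. concat (v i)"]) simp
  then show False using st H_Mod p(1) unfolding stable_def by simp
qed

end

section \<open>Elimination of imaginaries\<close>

lemma wf_fold_Forall:
  "set ss \<subseteq> Sorts L \<Longrightarrow> wf_fm L (ss @ \<Gamma>) \<phi> \<Longrightarrow> wf_fm L \<Gamma> (fold Forall ss \<phi>)"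
  by (induction ss arbitrary: \<phi>) (auto simp: Forall_def)

text \<open>\<open>E\<close> read in a context of three blocks of \<open>n\<close> variables, as
  transitivity demands; \<open>a\<close> and \<open>b\<close> number the blocks to which it is
  applied.\<close>

definition pair_fm :: "nat \<Rightarrow> nat \<Rightarrow> nat \<Rightarrow> ('s, 'f, 'r) fm \<Rightarrow> ('s, 'f, 'r) fm" where
  "pair_fm n a b = rename (\<lambda>i. if i < n then a * n + i else b * n + (i - n))"

lemma nth_three_blocks:
  assumes "length x = n" "length y = n" "length z = n" "a < 3" "i < n"
  shows "(x @ y @ z) ! (a * n + i) = ([x, y, z] ! a) ! i"
proof -
  consider "a = 0" | "a = 1" | "a = 2" using assms(4) by linarith
  then show ?thesis using assms by cases (auto simp: nth_append)
qed

lemma sat_pair_fm: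
  assumes wf: "wf_fm L (ss @ ss) E" and l: "length x = length ss" "length y = length ss" "length z = length ss"
    and ab: "a < 3" "b < 3"
  shows "sat M (pair_fm (length ss) a b E) (x @ y @ z) \<longleftrightarrow> sat M E ([x, y, z] ! a @ [x, y, z] ! b)"
  unfolding pair_fm_def
proof (rule sat_rename[OF wf])
  have len: "length ([x, y, z] ! c) = length ss" if "c < 3" for c
  proof -
    have "[x, y, z] ! c \<in> set [x, y, z]" using that by (intro nth_mem) simp
    then show ?thesis using l by auto
  qed
  then show "length ([x, y, z] ! a @ [x, y, z] ! b) = length (ss @ ss)" using ab by simp
  fix i assume "i < length (ss @ ss)"
  then show "(x @ y @ z) ! (if i < length ss then a * length ss + i else b * length ss + (i - length ss)) =
      ([x, y, z] ! a @ [x, y, z] ! b) ! i"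
  proof (cases "i < length ss")
    case True
    then have "([x, y, z] ! a @ [x, y, z] ! b) ! i = [x, y, z] ! a ! i"
      using len[OF ab(1)] by (simp only: nth_append if_True)
    then show ?thesis using nth_three_blocks[OF l ab(1) True] True by (simp only: if_True)
  next
    case False
    then have "([x, y, z] ! a @ [x, y, z] ! b) ! i = [x, y, z] ! b ! (i - length ss)"
      using len[OF ab(1)] by (simp only: nth_append if_False)
    moreover have "i - length ss < length ss" using \<open>i < length (ss @ ss)\<close> False by simp
    ultimately show ?thesis using nth_three_blocks[OF l ab(2)] False by (simp only: if_False)
  qed
qed

lemma wf_pair_fm:
  assumes wf: "wf_fm L (ss @ ss) E" and ab: "a < 3" "b < 3"
  shows "wf_fm L (ss @ ss @ ss) (pair_fm (length ss) a b E)"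
  unfolding pair_fm_def
proof (rule wf_rename[OF wf])
  let ?n = "length ss"
  have *: "c * ?n + j < length (ss @ ss @ ss) \<and> (ss @ ss @ ss) ! (c * ?n + j) = ss ! j"
    if "c < 3" "j < ?n" for c j
  proof -
    have "c = 0 \<or> c = 1 \<or> c = 2" using that(1) by linarith
    then have "[ss, ss, ss] ! c = ss" by auto
    moreover have "c * ?n + j < 3 * ?n"
    proof -
      have "Suc c * ?n \<le> 3 * ?n" using that(1) by (intro mult_le_mono1) simp
      then show ?thesis using that(2) unfolding mult_Suc by linarith
    qed
    ultimately show ?thesis using nth_three_blocks[OF refl refl refl that] by simp
  qed
  fix i assume "i < length (ss @ ss)"
  then show "(if i < ?n then a * ?n + i else b * ?n + (i - ?n)) < length (ss @ ss @ ss) \<and>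
      (ss @ ss @ ss) ! (if i < ?n then a * ?n + i else b * ?n + (i - ?n)) = (ss @ ss) ! i"
    using *[OF ab(1), of i] *[OF ab(2), of "i - ?n"] by (auto simp: nth_append)
qed

text \<open>\<open>def_equivs\<close> asks for an equivalence relation in every model, while only
  \<open>H\<close> is at hand. Written as a sentence, the property passes from \<open>H\<close> to
  all models by completeness.\<close>

definition equiv_fm :: "'s list \<Rightarrow> ('s, 'f, 'r) fm \<Rightarrow> ('s, 'f, 'r) fm" where
  "equiv_fm ss E = (let e = \<lambda>a b. pair_fm (length ss) a b E in
     fold Forall (ss @ ss @ ss) (Conj (e 0 0) (Conj (Neg (Conj (e 0 1) (Neg (e 1 0))))
       (Neg (Conj (e 0 1) (Conj (e 1 2) (Neg (e 0 2))))))))"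

lemma sat_equiv_fm:
  assumes wf: "wf_fm L (ss @ ss) E"
  shows "sat M (equiv_fm ss E) [] \<longleftrightarrow> (\<forall>x\<in>tuples M ss. \<forall>y\<in>tuples M ss. \<forall>z\<in>tuples M ss.
    sat M E (x @ x) \<and> (sat M E (x @ y) \<longrightarrow> sat M E (y @ x)) \<and>
    (sat M E (x @ y) \<and> sat M E (y @ z) \<longrightarrow> sat M E (x @ z)))" (is "_ \<longleftrightarrow> ?R")
proof -
  let ?e = "\<lambda>a b. pair_fm (length ss) a b E"
  let ?\<theta> = "Conj (?e 0 0) (Conj (Neg (Conj (?e 0 1) (Neg (?e 1 0))))
       (Neg (Conj (?e 0 1) (Conj (?e 1 2) (Neg (?e 0 2))))))"
  have e: "sat M ?\<theta> (x @ y @ z) \<longleftrightarrow> sat M E (x @ x) \<and> (sat M E (x @ y) \<longrightarrow> sat M E (y @ x)) \<and>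
    (sat M E (x @ y) \<and> sat M E (y @ z) \<longrightarrow> sat M E (x @ z))"
    if "x \<in> tuples M ss" "y \<in> tuples M ss" "z \<in> tuples M ss" for x y z
    using sat_pair_fm[OF wf tuples_length[OF that(1)] tuples_length[OF that(2)] tuples_length[OF that(3)], of _ _ M]
    by (simp, blast)
  have "sat M (equiv_fm ss E) [] \<longleftrightarrow> (\<forall>w\<in>tuples M (ss @ ss @ ss). sat M ?\<theta> w)"
    unfolding equiv_fm_def Let_def sat_fold_Forall by simp
  also have "\<dots> \<longleftrightarrow> (\<forall>x\<in>tuples M ss. \<forall>y\<in>tuples M ss. \<forall>z\<in>tuples M ss. sat M ?\<theta> (x @ y @ z))"
  proof (intro iffI ballI)
    fix w assume all: "\<forall>x\<in>tuples M ss. \<forall>y\<in>tuples M ss. \<forall>z\<in>tuples M ss. sat M ?\<theta> (x @ y @ z)"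
      and w: "w \<in> tuples M (ss @ ss @ ss)"
    obtain x v where v: "w = x @ v" "x \<in> tuples M ss" "v \<in> tuples M (ss @ ss)" using w by (rule tuples_appendE)
    obtain y z where "v = y @ z" "y \<in> tuples M ss" "z \<in> tuples M ss" using v(3) by (rule tuples_appendE)
    then show "sat M ?\<theta> w" using all v by blast
  next
    fix x y z assume "\<forall>w\<in>tuples M (ss @ ss @ ss). sat M ?\<theta> w"
      "x \<in> tuples M ss" "y \<in> tuples M ss" "z \<in> tuples M ss"
    then show "sat M ?\<theta> (x @ y @ z)" using tuples_append by blast
  qed
  also have "\<dots> \<longleftrightarrow> ?R" using e by (intro ball_cong refl) 
  finally show ?thesis .
qed

context eq_struc
begin

lemma equivsI:
  assumes hs: "set hs \<subseteq> Sorts L" and wf: "wf_fm L (hs @ hs) E"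
    and E: "\<And>x y. x \<in> tuples H hs \<Longrightarrow> y \<in> tuples H hs \<Longrightarrow> sat H E (x @ y) \<longleftrightarrow> g x = g y"
  shows "(hs, E) \<in> equivs"
proof -
  have "wf_fm L (hs @ hs @ hs) (pair_fm (length hs) a b E)" if "a < 3" "b < 3" for a b
    by (rule wf_pair_fm[OF wf that])
  then have wfe: "wf_fm L [] (equiv_fm hs E)"
    unfolding equiv_fm_def Let_def using hs by (intro wf_fold_Forall) simp_all
  have "sat H (equiv_fm hs E) []" unfolding sat_equiv_fm[OF wf] by (simp add: E)
  then have "\<not> (\<forall>M \<in> (Mod L T :: ('a, 's, 'f, 'r) struc set). sat M (Neg (equiv_fm hs E)) [])"
    using H_Mod by auto
  then have all: "sat M (equiv_fm hs E) []" if "M \<in> Mod L T" for M :: "('a, 's, 'f, 'r) struc"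
    using compl wfe that unfolding complete_def by blast
  have "equiv (tuples M hs) {(x, y). x \<in> tuples M hs \<and> y \<in> tuples M hs \<and> sat M E (x @ y)}"
    if "M \<in> Mod L T" for M :: "('a, 's, 'f, 'r) struc"
  proof -
    have *: "\<forall>x\<in>tuples M hs. \<forall>y\<in>tuples M hs. \<forall>z\<in>tuples M hs.
      sat M E (x @ x) \<and> (sat M E (x @ y) \<longrightarrow> sat M E (y @ x)) \<and>
      (sat M E (x @ y) \<and> sat M E (y @ z) \<longrightarrow> sat M E (x @ z))"
      using all[OF that] sat_equiv_fm[OF wf] by blast
    show ?thesis
    proof (rule equivI)
      show "refl_on (tuples M hs) {(x, y). x \<in> tuples M hs \<and> y \<in> tuples M hs \<and> sat M E (x @ y)}"
        using * by (auto simp: refl_on_def)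
      show "sym {(x, y). x \<in> tuples M hs \<and> y \<in> tuples M hs \<and> sat M E (x @ y)}"
        using * by (auto simp: sym_def)
      show "trans {(x, y). x \<in> tuples M hs \<and> y \<in> tuples M hs \<and> sat M E (x @ y)}"
        unfolding trans_def using * by blast
    qed auto
  qed
  then show ?thesis using hs wf by (simp add: def_equivs_def)
qed

text \<open>The term that recovers the \<open>j\<close>-th element from its block in the flattened
  tuple of representatives; on a home sort the block is a single variable.\<close>

definition pj_tm :: "('s, 'f, 'r) eqsort list \<Rightarrow> nat \<Rightarrow> ('s, 'f, 'r) eqfun tm" where
  "pj_tm cs j = (case cs ! j of Home _ \<Rightarrow> Var (offset cs j)
     | Quot ss E \<Rightarrow> Fn (Proj ss E) (map Var [offset cs j..<offset cs j + length ss]))"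

lemma wf_pj_tm:
  assumes "set cs \<subseteq> Sorts Leq" "j < length cs"
  shows "wf_tm Leq (map Home (hctx cs) @ \<Gamma>) (pj_tm cs j) \<and>
    tm_sort Leq (map Home (hctx cs) @ \<Gamma>) (pj_tm cs j) = cs ! j"
proof -
  let ?h = "hsorts (cs ! j)" and ?o = "offset cs j"
  have le: "?o + length ?h \<le> length (hctx cs)" by (rule offset_le[OF assms(2)])
  have nth: "(map Home (hctx cs) @ \<Gamma>) ! (?o + i) = Home (?h ! i)" if "i < length ?h" for i
  proof -
    have "hctx cs ! (?o + i) = map ((!) (hctx cs)) [?o..<?o + length ?h] ! i" using that by simp
    also have "\<dots> = ?h ! i" by (simp only: hctx_block[OF assms(2)])
    finally show ?thesis using that le by (simp add: nth_append)
  qed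
  show ?thesis
  proof (cases "cs ! j")
    case (Home s)
    then show ?thesis using nth[of 0] le by (simp add: pj_tm_def)
  next
    case (Quot ss E)
    have "cs ! j \<in> Sorts Leq" using assms by auto
    moreover have "map (tm_sort Leq (map Home (hctx cs) @ \<Gamma>)) (map Var [?o..<?o + length ss]) = map Home ss"
      using nth Quot by (auto intro!: nth_equalityI)
    ultimately show ?thesis using Quot le by (simp add: pj_tm_def list_all_iff)
  qed
qed

lemma eval_pj_tm:
  assumes vs: "reps cs vs" and j: "j < length cs"
  shows "eval N (concat vs @ e) (pj_tm cs j) = pj (cs ! j) (vs ! j)"
proof -
  let ?h = "hsorts (cs ! j)" and ?o = "offset cs j"
  have le: "?o + length ?h \<le> length (concat vs)"
    using offset_le[OF j] tuples_length[OF reps_concat[OF vs]] by simp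
  have "map ((!) (concat vs @ e)) [?o..<?o + length ?h] = map ((!) (concat vs)) [?o..<?o + length ?h]"
    using le by (auto simp: nth_append)
  also have "\<dots> = vs ! j" by (rule reps_block[OF vs j])
  finally have blk: "map ((!) (concat vs @ e)) [?o..<?o + length ?h] = vs ! j" .
  show ?thesis
  proof (cases "cs ! j")
    case (Home s)
    then show ?thesis using blk by (simp add: pj_tm_def pj_def flip: blk)
  next
    case (Quot ss E)
    then show ?thesis using blk by (simp add: pj_tm_def pj_def comp_def)
  qed
qed

text \<open>Parameter tuples are equivalent if they give the same fibre of the defining formula. The
  parameters may be imaginaries themselves, while quotient sorts exist only for formulas over the
  home sorts, so the equivalence is pulled back to representatives. The class of a representative of
  \<open>c\<close> is the canonical parameter.\<close>

lemma imaginary_codes: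
  assumes ne: "Sorts Leq \<noteq> {}" and S: "mstruc.dfb Leq N (univ N) ts S"
  shows "\<exists>e\<in>univ N. \<exists>R. mstruc.dfb Leq N {} (ts @ [sort_of N e]) R \<and>
      S = {y \<in> tuples N ts. y @ [e] \<in> R} \<and>
      (\<forall>e'\<in>univ N. sort_of N e' = sort_of N e \<longrightarrow> S = {y \<in> tuples N ts. y @ [e'] \<in> R} \<longrightarrow> e' = e)"
proof -
  interpret mstruc Leq N using N_struc ne by unfold_locales
  obtain \<phi> c where phi: "set c \<subseteq> univ N" "wf_fm Leq (ts @ map (sort_of N) c) \<phi>"
    "S = {y \<in> tup ts. sat N \<phi> (y @ c)}" using S by (rule dfbE)
  define cs where "cs = map (sort_of N) c"
  have ct: "c \<in> tup cs" using phi(1) unfolding cs_def by (rule tuplesI)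
  have wfphi: "wf_fm Leq (ts @ cs) \<phi>" using phi(2) by (simp add: cs_def)
  have csS: "set cs \<subseteq> Sorts Leq" using tup_sorts[OF ct] .
  define fib where "fib = (\<lambda>u. {y \<in> tup ts. sat N \<phi> (y @ u)})"
  have F: "dfb {} (ts @ cs) {z \<in> tup (ts @ cs). sat N \<phi> (z @ [])}" (is "dfb {} _ ?F")
    by (rule dfbI[OF refl]) (use wfphi in \<open>simp add: pfms_def\<close>)
  have Fi: "y @ u \<in> ?F \<longleftrightarrow> y \<in> fib u" if "y \<in> tup ts" "u \<in> tup cs" for y u
    using tuples_append[OF that] that by (simp add: fib_def)
  \<comment> \<open>Equality of fibres is first order: no \<open>y\<close> separates them.\<close>
  obtain \<epsilon> where eps: "wf_fm Leq (cs @ cs) \<epsilon>"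
    "\<And>u v. u \<in> tup cs \<Longrightarrow> v \<in> tup cs \<Longrightarrow> sat N \<epsilon> (u @ v) \<longleftrightarrow> fib u = fib v"
  proof -
    let ?n = "length ts" and ?m = "length cs"
    let ?G1 = "{x \<in> tup (ts @ cs @ cs). map ((!) x) [0..<?n + ?m] \<in> ?F}"
    let ?G2 = "{x \<in> tup (ts @ cs @ cs). map ((!) x) ([0..<?n] @ [?n + ?m..<?n + ?m + ?m]) \<in> ?F}"
    have n1: "map ((!) (y @ u @ v)) [0..<?n + ?m] = y @ u"
      "map ((!) (y @ u @ v)) ([0..<?n] @ [?n + ?m..<?n + ?m + ?m]) = y @ v"
      if "length y = ?n" "length u = ?m" "length v = ?m" for y u v :: "'x list"
      using that by (auto intro!: nth_equalityI simp: nth_append)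
    have G: "dfb {} (ts @ cs @ cs) ?G1"
      by (rule dfb_reindex[OF F]) (use n1(1)[of ts cs cs] in auto)
    have G': "dfb {} (ts @ cs @ cs) ?G2"
      by (rule dfb_reindex[OF F]) (use n1(2)[of ts cs cs] in auto)
    define D where "D = (?G1 - ?G2) \<union> (?G2 - ?G1)"
    have D: "dfb {} (ts @ (cs @ cs)) D" unfolding D_def by (intro dfb_Un dfb_Diff G G')
    have Di: "y @ u @ v \<in> D \<longleftrightarrow> (y \<in> fib u \<longleftrightarrow> y \<notin> fib v)"
      if "y \<in> tup ts" "u \<in> tup cs" "v \<in> tup cs" for y u v
    proof -
      have t: "y @ u @ v \<in> tup (ts @ cs @ cs)" using that tuples_append by blast
      have "y @ u @ v \<in> ?G1 \<longleftrightarrow> y \<in> fib u"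
        using n1(1)[OF that[THEN tuples_length]] Fi[OF that(1,2)] t by (simp only: mem_Collect_eq simp_thms)
      moreover have "y @ u @ v \<in> ?G2 \<longleftrightarrow> y \<in> fib v"
        using n1(2)[OF that[THEN tuples_length]] Fi[OF that(1,3)] t by (simp only: mem_Collect_eq simp_thms)
      ultimately show ?thesis unfolding D_def by blast
    qed
    let ?Q = "tup (cs @ cs) - {x \<in> tup (cs @ cs). \<exists>y. y @ x \<in> D}"
    have "dfb {} (cs @ cs) ?Q" by (rule dfb_Compl[OF dfb_Ex_prefix[OF D]])
    then obtain \<epsilon> b where e: "set b \<subseteq> {}" "wf_fm Leq ((cs @ cs) @ map (sort_of N) b) \<epsilon>"
      "?Q = {x \<in> tup (cs @ cs). sat N \<epsilon> (x @ b)}" by (rule dfbE)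
    have "sat N \<epsilon> (u @ v) \<longleftrightarrow> fib u = fib v" if uv: "u \<in> tup cs" "v \<in> tup cs" for u v
    proof -
      have t: "u @ v \<in> tup (cs @ cs)" using uv tuples_append by blast
      have yt: "y \<in> tup ts" if "y @ u @ v \<in> D" for y
      proof -
        have "y @ u @ v \<in> tup (ts @ cs @ cs)" using that dfb_sub[OF D] by blast
        moreover from tuples_length[OF this] have "length y = ?n"
          using uv[THEN tuples_length] by simp
        ultimately show ?thesis by (simp add: tuples_append_iff)
      qed
      have "sat N \<epsilon> (u @ v) \<longleftrightarrow> u @ v \<in> ?Q" using e t by simp
      also have "\<dots> \<longleftrightarrow> \<not> (\<exists>y. y @ u @ v \<in> D)" using t by simp
      also have "\<dots> \<longleftrightarrow> (\<forall>y\<in>tup ts. y \<in> fib u \<longleftrightarrow> y \<in> fib v)"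
        using Di[OF _ uv] yt by blast
      also have "\<dots> \<longleftrightarrow> fib u = fib v" by (auto simp: fib_def)
      finally show ?thesis .
    qed
    then show ?thesis using that[of \<epsilon>] e(1,2) by simp
  qed
  let ?hs = "hctx cs"
  have "set (cs @ cs) \<subseteq> Sorts Leq" using csS by simp
  from home_formula[OF eps(1) this] obtain E where wfE: "wf_fm L (hctx (cs @ cs)) E"
    and E: "\<And>vs. reps (cs @ cs) vs \<Longrightarrow> sat H E (concat vs) \<longleftrightarrow> sat N \<epsilon> (pjs (cs @ cs) vs)" by blast
  have wfE': "wf_fm L (?hs @ ?hs) E" using wfE by simp
  have satE: "sat H E (concat us @ concat vs) \<longleftrightarrow> fib (pjs cs us) = fib (pjs cs vs)"
    if "reps cs us" "reps cs vs" for us vs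
  proof -
    have r: "reps (cs @ cs) (us @ vs)" using that by (simp add: list_all2_appendI)
    have "pjs (cs @ cs) (us @ vs) = pjs cs us @ pjs cs vs"
      using list_all2_lengthD[OF that(1)] by simp
    then show ?thesis using E[OF r] eps(2) pjs_in[OF _ csS] that by simp
  qed
  \<comment> \<open>Splits a flat tuple of home elements into the blocks that represent the single
    parameters.\<close>
  define dec where "dec = (\<lambda>w. SOME vs. reps cs vs \<and> concat vs = w)"
  have dec: "reps cs (dec w)" "concat (dec w) = w" if "w \<in> tuples H ?hs" for w
    using someI_ex[OF concat_reps[OF that]] by (auto simp: dec_def)
  have satE': "sat H E (x @ y) \<longleftrightarrow> fib (pjs cs (dec x)) = fib (pjs cs (dec y))"
    if "x \<in> tuples H ?hs" "y \<in> tuples H ?hs" for x y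
    using satE[OF dec(1)[OF that(1)] dec(1)[OF that(2)]] dec(2) that by simp
  have hsS: "set ?hs \<subseteq> Sorts L"
  proof
    fix s assume "s \<in> set ?hs"
    then obtain q where q: "q \<in> set cs" "s \<in> set (hsorts q)" by auto
    then have "q \<in> Sorts Leq" using csS by blast
    then show "s \<in> Sorts L" using q(2) def_equiv_sorts by (cases q) auto
  qed
  have Eq: "(?hs, E) \<in> equivs" by (rule equivsI[OF hsS wfE' satE'])
  let ?Q = "Quot ?hs E" and ?P = "fint N (Proj ?hs E)"
  have QS: "?Q \<in> Sorts Leq" using Eq by simp
  have P_in: "?P w \<in> univ N \<and> sort_of N (?P w) = ?Q" if "w \<in> tuples H ?hs" for w
    using pj_in[OF QS] that by (simp add: pj_def)
  let ?n = "length ?hs" and ?k = "length ts"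
  let ?\<sigma> = "\<lambda>i. if i < ?k then Var (?n + i) else pj_tm cs (i - ?k)"
  let ?\<Gamma> = "map Home ?hs @ ts @ [?Q]"
  let ?\<eta> = "Eq (Fn (Proj ?hs E) (map Var [0..<?n])) (Var (?n + ?k))"
  \<comment> \<open>Some representative of the class has \<open>y\<close> in its fibre; by the
    choice of \<open>E\<close> all representatives of a class give the same fibre.\<close>
  let ?\<psi> = "fold Exists (map Home ?hs) (Conj ?\<eta> (subst_fm ?\<sigma> \<phi>))"
  have "wf_subst Leq (ts @ cs) ?\<Gamma> ?\<sigma>" unfolding wf_subst_def
  proof (intro allI impI)
    fix i assume i: "i < length (ts @ cs)"
    show "wf_tm Leq ?\<Gamma> (?\<sigma> i) \<and> tm_sort Leq ?\<Gamma> (?\<sigma> i) = (ts @ cs) ! i"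
      using wf_pj_tm[OF csS, of "i - ?k" "ts @ [?Q]"] i by (auto simp: nth_append)
  qed
  from wf_subst_fm[OF this wfphi] have "wf_fm Leq ?\<Gamma> (subst_fm ?\<sigma> \<phi>)" .
  moreover have "map (tm_sort Leq ?\<Gamma>) (map Var [0..<?n]) = map Home ?hs"
    by (auto intro!: nth_equalityI simp: nth_append)
  then have "wf_fm Leq ?\<Gamma> ?\<eta>" using Eq by (simp add: list_all_iff nth_append)
  ultimately have wfpsi: "wf_fm Leq (ts @ [?Q]) ?\<psi>" using hsS by (intro wf_fold_Exists) auto
  have satpsi: "sat N ?\<psi> (y @ [z]) \<longleftrightarrow> (\<exists>w\<in>tuples H ?hs. ?P w = z \<and> y \<in> fib (pjs cs (dec w)))"
    if y: "y \<in> tup ts" for y z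
  proof -
    have ly: "length y = ?k" using tuples_length[OF y] .
    have "sat N (Conj ?\<eta> (subst_fm ?\<sigma> \<phi>)) (w @ y @ [z]) \<longleftrightarrow> ?P w = z \<and> y \<in> fib (pjs cs (dec w))"
      if w: "w \<in> tuples H ?hs" for w
    proof -
      have lw: "length w = ?n" using tuples_length[OF w] .
      have "map (eval N (w @ y @ [z])) (map Var [0..<?n]) = w"
        using lw by (auto intro!: nth_equalityI simp: nth_append)
      moreover have "(w @ y @ [z]) ! (?n + ?k) = z" using lw ly by (simp add: nth_append)
      ultimately have eta: "sat N ?\<eta> (w @ y @ [z]) \<longleftrightarrow> ?P w = z" by simp
      note d = dec[OF w]
      have ld: "length (dec w) = length cs" using list_all2_lengthD[OF d(1)] by simp
      have "subst_env N (length (ts @ cs)) ?\<sigma> (w @ y @ [z]) = y @ pjs cs (dec w)"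
      proof (rule nth_equalityI)
        show "length (subst_env N (length (ts @ cs)) ?\<sigma> (w @ y @ [z])) = length (y @ pjs cs (dec w))"
          using ly ld by (simp add: subst_env_def)
        fix i assume "i < length (subst_env N (length (ts @ cs)) ?\<sigma> (w @ y @ [z]))"
        then have i: "i < ?k + length cs" by (simp add: subst_env_def)
        show "subst_env N (length (ts @ cs)) ?\<sigma> (w @ y @ [z]) ! i = (y @ pjs cs (dec w)) ! i"
        proof (cases "i < ?k")
          case True
          then show ?thesis using i lw ly by (simp add: subst_env_def nth_append)
        next
          case False
          then have j: "i - ?k < length cs" using i by simp
          have "eval N (w @ y @ [z]) (pj_tm cs (i - ?k)) = pj (cs ! (i - ?k)) (dec w ! (i - ?k))"
            using eval_pj_tm[OF d(1) j, of "y @ [z]"] d(2) by simp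
          then show ?thesis using False i ly ld j by (simp add: subst_env_def nth_append)
        qed
      qed
      then have "sat N (subst_fm ?\<sigma> \<phi>) (w @ y @ [z]) \<longleftrightarrow> sat N \<phi> (y @ pjs cs (dec w))"
        using sat_subst_fm[OF wfphi, of N ?\<sigma> "w @ y @ [z]"] by (simp only:)
      then show ?thesis using eta y by (simp add: fib_def)
    qed
    then show ?thesis unfolding sat_fold_Exists H_tuples by blast
  qed
  let ?R = "{x \<in> tup (ts @ [?Q]). sat N ?\<psi> (x @ [])}"
  have R: "dfb {} (ts @ [?Q]) ?R" by (rule dfbI[OF refl]) (use wfpsi in \<open>simp add: pfms_def\<close>)
  have Rfib: "{y \<in> tup ts. y @ [?P w] \<in> ?R} = fib (pjs cs (dec w))" if w: "w \<in> tuples H ?hs" for w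
  proof -
    have "y @ [?P w] \<in> ?R \<longleftrightarrow> y \<in> fib (pjs cs (dec w))" if y: "y \<in> tup ts" for y
    proof -
      have "[?P w] \<in> tup [?Q]" using P_in[OF w] by (simp add: tuples_one)
      then have "y @ [?P w] \<in> ?R \<longleftrightarrow> (\<exists>w'\<in>tuples H ?hs. ?P w' = ?P w \<and> y \<in> fib (pjs cs (dec w')))"
        using satpsi[OF y] tuples_append[OF y] by simp
      also have "\<dots> \<longleftrightarrow> y \<in> fib (pjs cs (dec w))"
        using proj_eq_iff[OF Eq _ w] satE'[OF _ w] w by blast
      finally show ?thesis .
    qed
    then show ?thesis by (auto simp: fib_def)
  qed
  obtain vs0 where vs0: "reps cs vs0" "pjs cs vs0 = c" using pjs_onto[OF ct] by blast
  let ?w0 = "concat vs0"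
  have w0: "?w0 \<in> tuples H ?hs" by (rule reps_concat[OF vs0(1)])
  have fib0: "fib (pjs cs (dec ?w0)) = S"
  proof -
    have "sat H E (?w0 @ ?w0)" using satE[OF vs0(1) vs0(1)] by simp
    then have "fib (pjs cs (dec ?w0)) = fib (pjs cs vs0)"
      using satE[OF dec(1)[OF w0] vs0(1)] dec(2)[OF w0] by simp
    then show ?thesis using vs0(2) phi(3) by (simp add: fib_def)
  qed
  have "e' = ?P ?w0" if e': "e' \<in> univ N" "sort_of N e' = ?Q" "S = {y \<in> tup ts. y @ [e'] \<in> ?R}" for e'
  proof -
    obtain w where w: "w \<in> tuples H ?hs" "?P w = e'" using proj_onto[OF e'(1,2)] by blast
    then have "fib (pjs cs (dec w)) = fib (pjs cs (dec ?w0))" using e'(3) Rfib[OF w(1)] fib0 by simp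
    then show ?thesis using satE'[OF w(1) w0] proj_eq_iff[OF Eq w(1) w0] w(2) by simp
  qed
  then have uniq: "\<forall>e'\<in>univ N. sort_of N e' = ?Q \<longrightarrow> S = {y \<in> tup ts. y @ [e'] \<in> ?R} \<longrightarrow> e' = ?P ?w0"
    by meson
  have P0: "?P ?w0 \<in> univ N" "sort_of N (?P ?w0) = ?Q" using P_in[OF w0] by auto
  have S0: "S = {y \<in> tup ts. y @ [?P ?w0] \<in> ?R}" using Rfib[OF w0] fib0 by (rule trans[THEN sym])
  show ?thesis
    by (rule bexI[OF _ P0(1)], rule exI[of _ ?R], unfold P0(2), intro conjI R S0 uniq)
qed

end

section \<open>Counting formulas\<close>

context big_card
begin

lemma small_Plus: "small \<kappa> A \<Longrightarrow> small \<kappa> C \<Longrightarrow> small \<kappa> (A <+> C)"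
  unfolding small_def by (rule card_of_Plus_ordLess_infinite_Field[OF infinite_Field card])

lemma small_Times: "small \<kappa> A \<Longrightarrow> small \<kappa> C \<Longrightarrow> small \<kappa> (A \<times> C)"
proof -
  assume A: "small \<kappa> A" and C: "small \<kappa> C"
  \<comment> \<open>Adding \<open>nat\<close> makes the bounding set infinite, so that products do
    not exceed it, whether or not \<open>A\<close> and \<open>C\<close> are finite.\<close>
  let ?Z = "(A <+> C) <+> (UNIV :: nat set)"
  have Z: "small \<kappa> ?Z"
    by (intro small_Plus A C small_nat)
  have inf: "infinite ?Z" by simp
  have "|A| \<le>o |?Z|" "|C| \<le>o |?Z|"
    using ordLeq_transitive[OF card_of_Plus1 card_of_Plus1]
      ordLeq_transitive[OF card_of_Plus2 card_of_Plus1] .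
  then have "|A \<times> C| \<le>o |?Z|" 
    by (intro card_of_Sigma_ordLeq_infinite[OF inf] ballI)
  then show "small \<kappa> (A \<times> C)" using Z ordLeq_ordLess_trans unfolding small_def by blast
qed

lemma small_lists: assumes "small \<kappa> A" shows "small \<kappa> (lists A)"
proof -
  let ?Z = "A <+> (UNIV :: nat set)"
  have Z: "small \<kappa> ?Z"
    by (intro small_Plus assms small_nat)
  have inf: "infinite ?Z" by simp
  have A: "|A| \<le>o |?Z|" "|UNIV :: nat set| \<le>o |?Z|" by (rule card_of_Plus1, rule card_of_Plus2)
  have "|{xs \<in> lists A. length xs = n}| \<le>o |?Z|" for n
  proof (induction n)
    case 0
    have "{xs \<in> lists A. length xs = 0} = {[]}" by auto
    moreover have "inj_on (\<lambda>_. Inr 0) {[]}" "(\<lambda>_. Inr 0) ` {[]} \<subseteq> ?Z" by auto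
    ultimately show ?case using card_of_ordLeq by metis
  next
    case (Suc n)
    let ?X = "{xs \<in> lists A. length xs = n}"
    have "{xs \<in> lists A. length xs = Suc n} \<subseteq> (\<lambda>(x, xs). x # xs) ` (A \<times> ?X)"
      by (auto simp: length_Suc_conv)
    then have "|{xs \<in> lists A. length xs = Suc n}| \<le>o |A \<times> ?X|"
      by (rule ordLeq_transitive[OF card_of_mono1 card_of_image])
    moreover have "|A \<times> ?X| \<le>o |?Z|" 
      by (intro card_of_Sigma_ordLeq_infinite[OF inf] ballI A(1) Suc)
    ultimately show ?case by (rule ordLeq_transitive)
  qed
  then have "|\<Union>n. {xs \<in> lists A. length xs = n}| \<le>o |?Z|"
    by (intro card_of_UNION_ordLeq_infinite[OF inf A(2)]) blast
  moreover have "lists A = (\<Union>n. {xs \<in> lists A. length xs = n})" by auto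
  ultimately show ?thesis using Z ordLeq_ordLess_trans unfolding small_def by metis
qed

lemma small_finite: "finite A \<Longrightarrow> small \<kappa> A"
proof -
  assume "finite A"
  from finite_list[OF this] obtain l where "set l = A" by (elim exE)
  then show "small \<kappa> A" using small_set[of l] by simp
qed

end

text \<open>Formulas are coded by words in postfix notation, which are decoded by a stack machine.\<close>

datatype ('s, 'f, 'r) token = TVar nat | TFn 'f nat | TEq | TRel 'r nat | TNeg | TConj | TEx 's

text \<open>The number in \<open>TFn\<close> and \<open>TRel\<close> tells how many terms to take
  from the stack, as the datatypes fix no arities. Meaningless words give unspecified results, which
  is harmless: the decoding only has to reach every well-formed formula.\<close>

primrec run_token :: "('s, 'f, 'r) token \<Rightarrow> 'f tm list \<times> ('s, 'f, 'r) fm list \<Rightarrow>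
    'f tm list \<times> ('s, 'f, 'r) fm list" where
  "run_token (TVar i) st = (Var i # fst st, snd st)"
| "run_token (TFn f n) st = (Fn f (take n (fst st)) # drop n (fst st), snd st)"
| "run_token TEq st = (drop 2 (fst st), Eq (fst st ! 0) (fst st ! 1) # snd st)"
| "run_token (TRel r n) st = (drop n (fst st), Rel r (take n (fst st)) # snd st)"
| "run_token TNeg st = (fst st, Neg (snd st ! 0) # drop 1 (snd st))"
| "run_token TConj st = (fst st, Conj (snd st ! 0) (snd st ! 1) # drop 2 (snd st))"
| "run_token (TEx s) st = (fst st, Exists s (snd st ! 0) # drop 1 (snd st))"

definition tokens :: "('s, 'f, 'r) lang \<Rightarrow> ('s, 'f, 'r) token set" where
  "tokens L = range TVar \<union> (\<lambda>(f, n). TFn f n) ` (Funs L \<times> UNIV) \<union> {TEq, TNeg, TConj} \<union>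
     (\<lambda>(r, n). TRel r n) ` (Rels L \<times> UNIV) \<union> TEx ` Sorts L"

text \<open>Later arguments are pushed first, so that the list appears on the stack in its own
  order.\<close>

lemma code_terms:
  assumes "\<And>t. t \<in> set us \<Longrightarrow> \<exists>l\<in>lists X. \<forall>st. fold run_token l st = (t # fst st, snd st)"
  shows "\<exists>l\<in>lists X. \<forall>st. fold run_token l st = (us @ fst st, snd st)"
  using assms
proof (induction us)
  case Nil
  then show ?case by (intro bexI[of _ "[]"]) auto
next
  case (Cons u us)
  then obtain l l' where "l \<in> lists X" "l' \<in> lists X" "\<And>st. fold run_token l st = (us @ fst st, snd st)"
    "\<And>st. fold run_token l' st = (u # fst st, snd st)" by (metis list.set_intros)
  then show ?case by (intro bexI[of _ "l @ l'"]) auto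
qed

lemma code_term:
  "wf_tm L \<Gamma> t \<Longrightarrow> \<exists>l\<in>lists (tokens L). \<forall>st. fold run_token l st = (t # fst st, snd st)"
proof (induction t)
  case (Var i)
  then show ?case by (intro bexI[of _ "[TVar i]"]) (auto simp: tokens_def)
next
  case (Fn f us)
  then have "\<exists>l\<in>lists (tokens L). \<forall>st. fold run_token l st = (us @ fst st, snd st)"
    by (intro code_terms) (auto simp: list_all_iff)
  then obtain l where "l \<in> lists (tokens L)" "\<And>st. fold run_token l st = (us @ fst st, snd st)" by blast
  moreover have "TFn f (length us) \<in> tokens L" using Fn.prems by (force simp: tokens_def)
  ultimately show ?case by (intro bexI[of _ "l @ [TFn f (length us)]"]) auto
qed

lemma code_formula:
  "wf_fm L \<Gamma> \<phi> \<Longrightarrow> \<exists>l\<in>lists (tokens L). \<forall>st. fold run_token l st = (fst st, \<phi> # snd st)"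
proof (induction \<phi> arbitrary: \<Gamma>)
  case (Eq t u)
  then have "\<exists>l\<in>lists (tokens L). \<forall>st. fold run_token l st = ([t, u] @ fst st, snd st)"
    by (intro code_terms) (use code_term in force)
  then obtain l where "l \<in> lists (tokens L)" "\<And>st. fold run_token l st = ([t, u] @ fst st, snd st)" by blast
  then show ?case by (intro bexI[of _ "l @ [TEq]"]) (auto simp: tokens_def)
next
  case (Rel r us)
  then have "\<exists>l\<in>lists (tokens L). \<forall>st. fold run_token l st = (us @ fst st, snd st)"
    by (intro code_terms code_term) (auto simp: list_all_iff)
  then obtain l where "l \<in> lists (tokens L)" "\<And>st. fold run_token l st = (us @ fst st, snd st)" by blast
  moreover have "TRel r (length us) \<in> tokens L" using Rel.prems by (force simp: tokens_def)
  ultimately show ?case by (intro bexI[of _ "l @ [TRel r (length us)]"]) auto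
next
  case (Neg \<phi>)
  then obtain l where "l \<in> lists (tokens L)" "\<And>st. fold run_token l st = (fst st, \<phi> # snd st)"
    by fastforce
  then show ?case by (intro bexI[of _ "l @ [TNeg]"]) (auto simp: tokens_def)
next
  case (Conj \<phi> \<psi>)
  then have wf: "wf_fm L \<Gamma> \<phi>" "wf_fm L \<Gamma> \<psi>" by simp_all
  obtain l where l: "l \<in> lists (tokens L)" "\<And>st. fold run_token l st = (fst st, \<phi> # snd st)"
    using Conj.IH(1)[OF wf(1)] by blast
  obtain l' where "l' \<in> lists (tokens L)" "\<And>st. fold run_token l' st = (fst st, \<psi> # snd st)"
    using Conj.IH(2)[OF wf(2)] by blast
  with l show ?case by (intro bexI[of _ "l' @ l @ [TConj]"]) (auto simp: tokens_def)
next
  case (Exists s \<phi>)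
  then have wf: "wf_fm L (s # \<Gamma>) \<phi>" by simp
  obtain l where "l \<in> lists (tokens L)" "\<And>st. fold run_token l st = (fst st, \<phi> # snd st)"
    using Exists.IH[OF wf] by blast
  then show ?case using Exists.prems by (intro bexI[of _ "l @ [TEx s]"]) (auto simp: tokens_def)
qed

context big_card
begin

lemma small_formulas:
  fixes L :: "('s, 'f, 'r) lang"
  assumes "small \<kappa> (Sorts L)" "small \<kappa> (Funs L)" "small \<kappa> (Rels L)"
  shows "small \<kappa> {\<phi>. \<exists>\<Gamma>. wf_fm L \<Gamma> \<phi>}"
proof -
  have "small \<kappa> (tokens L)"
    unfolding tokens_def
    by (intro small_Un small_image small_Times assms small_nat) (rule small_finite, simp)
  from small_image[OF small_lists[OF this], of "\<lambda>l. hd (snd (fold run_token l ([], [])))"]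
  show ?thesis
  proof (rule small_subset, intro subsetI)
    fix \<phi> :: "('s, 'f, 'r) fm" assume "\<phi> \<in> {\<phi>. \<exists>\<Gamma>. wf_fm L \<Gamma> \<phi>}"
    then obtain l where l: "l \<in> lists (tokens L)" "\<And>st. fold run_token l st = (fst st, \<phi> # snd st)"
      using code_formula by blast
    then show "\<phi> \<in> (\<lambda>l. hd (snd (fold run_token l ([], [])))) ` lists (tokens L)"
      by (intro image_eqI[OF _ l(1)]) simp
  qed
qed

lemma small_lang_eq:
  fixes L :: "('s, 'f, 'r) lang"
  assumes L: "small \<kappa> (Sorts L)" "small \<kappa> (Funs L)" "small \<kappa> (Rels L)"
  shows "small \<kappa> (Sorts (lang_eq TA L T))" "small \<kappa> (Funs (lang_eq TA L T))" "small \<kappa> (Rels (lang_eq TA L T))"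
proof -
  have "def_equivs TA L T \<subseteq> lists (Sorts L) \<times> {\<phi>. \<exists>\<Gamma>. wf_fm L \<Gamma> \<phi>}"
    by (auto simp: def_equivs_def)
  then have "small \<kappa> (def_equivs TA L T)"
    using small_subset small_Times[OF small_lists[OF L(1)] small_formulas[OF L]] by blast
  then show "small \<kappa> (Sorts (lang_eq TA L T))" "small \<kappa> (Funs (lang_eq TA L T))" "small \<kappa> (Rels (lang_eq TA L T))"
    unfolding lang_eq_def using L by (auto intro!: small_Un small_image)
qed

end

context sstruc
begin

text \<open>An element of the definable closure is determined by its sort and a formula with
  parameters, and the set of these data is small.\<close>

lemma small_dcl:
  assumes L: "small \<kappa> (Sorts L)" "small \<kappa> (Funs L)" "small \<kappa> (Rels L)" and A: "small \<kappa> A"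
  shows "small \<kappa> (dcl L M A)"
proof -
  let ?X = "Sorts L \<times> {\<phi>. \<exists>\<Gamma>. wf_fm L \<Gamma> \<phi>} \<times> lists A"
  let ?g = "\<lambda>(s, \<psi>). THE d. dset [s] \<psi> = {[d]}"
  have "small \<kappa> (?g ` ?X)"
    using small_Times[OF L(1) small_Times[OF small_formulas[OF L] small_lists[OF A]]] by (rule small_image)
  then show ?thesis
  proof (rule small_subset, intro subsetI)
    fix d assume "d \<in> dcl L M A"
    then obtain \<psi> where psi: "d \<in> univ M" "\<psi> \<in> pfms L M [sort_of M d] A" "{[d]} = dset [sort_of M d] \<psi>"
      by (auto simp: dcl_iff dfb_def)
    then have "(sort_of M d, \<psi>) \<in> ?X" using sort_in by (auto simp: pfms_def)
    moreover have "d = ?g (sort_of M d, \<psi>)" using psi(3)[symmetric] by simp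
    ultimately show "d \<in> ?g ` ?X" by blast
  qed
qed

end

section \<open>The canonical base as a kernel\<close>

text \<open>If there are no sorts at all, there need not be any formula, so this case is separate.\<close>

lemma canonical_base_empty_univ:
  assumes M: "univ M = {}" and B: "B \<subseteq> univ M" and \<kappa>: "small \<kappa> B"
    and st: "stationary L M \<kappa> ss B p" and x: "realises M ss x p"
  shows "is_canonical_base L M \<kappa> ss B p {}"
proof -
  have B: "B = {}" using B M by blast
  \<comment> \<open>All definable closures are empty, so \<open>{}\<close> is the only candidate for
    a base.\<close>
  have dcl: "dcl L M C = {}" for C using M by (auto simp: dcl_def)
  have pc: "p \<in> complete_types L M ss {}" using st B by (simp add: stationary_def)
  have eq: "q = p" if q: "q \<in> complete_types L M ss {}" "p \<subseteq> q" for q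
  proof (rule antisym[OF subsetI q(2)], rule ccontr)
    fix \<psi> assume psi: "\<psi> \<in> q" "\<psi> \<notin> p"
    obtain \<phi> b where pb: "\<psi> = (\<phi>, b)" by (cases \<psi>)
    have "(\<phi>, b) \<in> pfms L M ss {}" using q(1) psi pb by (auto simp: complete_types_def)
    then have "(Neg \<phi>, b) \<in> q" using pc psi pb q(2) by (auto simp: complete_types_def)
    then have "finite {(\<phi>, b), (Neg \<phi>, b)} \<and> {(\<phi>, b), (Neg \<phi>, b)} \<subseteq> q" using psi pb by simp
    moreover have "fin_sat M ss q" using q(1) by (simp add: complete_types_def)
    ultimately obtain y where "realises M ss y {(\<phi>, b), (Neg \<phi>, b)}" unfolding fin_sat_def by blast
    then show False by (simp add: realises_def holds_def)
  qed
  have "\<exists>!q. q \<in> complete_types L M ss {} \<and> p \<subseteq> q \<and> \<not> forks L M ss q {}"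
    using st \<kappa> unfolding stationary_def B by blast
  then have nf: "\<not> forks L M ss p {}" using eq by blast
  have "restriction L M ss p {} = p"
  proof (intro set_eqI iffI)
    fix \<psi> assume psi: "\<psi> \<in> restriction L M ss p {}"
    obtain \<phi> b where pb: "\<psi> = (\<phi>, b)" by (cases \<psi>)
    have "(\<phi>, b) \<in> p \<or> (Neg \<phi>, b) \<in> p" using psi pb pc by (auto simp: restriction_def complete_types_def)
    moreover have "holds M \<psi> x" using psi x by (simp add: restriction_def)
    then have "(Neg \<phi>, b) \<notin> p" using x pb by (auto simp: realises_def holds_def)
    ultimately show "\<psi> \<in> p" using pb by blast
  next
    fix \<psi> assume "\<psi> \<in> p"
    then show "\<psi> \<in> restriction L M ss p {}"
      using pc by (auto simp: restriction_def complete_types_def realises_def)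
  qed
  then have "base L M \<kappa> ss B p {}" using st B nf by (simp add: base_def dcl)
  then show ?thesis by (simp add: is_canonical_base_def)
qed

lemma cb_eqI: "is_canonical_base L M \<kappa> ss B p C \<Longrightarrow> cb L M \<kappa> ss B p = C"
  unfolding cb_def by (rule the_equality) (auto simp: is_canonical_base_def)

theorem corollary3p28:
  fixes L :: "('s, 'f, 'r) lang"
    and T :: "('s, 'f, 'r) fm set"
    and Leq :: "(('s, 'f, 'r) eqsort, ('s, 'f, 'r) eqfun, 'r) lang"
    and N :: "('a, ('s, 'f, 'r) eqsort, ('s, 'f, 'r) eqfun, 'r) struc"
    and \<kappa> :: "'k rel"
    and ss :: "('s, 'f, 'r) eqsort list"
    and B :: "'a set"
    and p :: "('a, ('s, 'f, 'r) eqsort, ('s, 'f, 'r) eqfun, 'r) pfm set"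
    and a :: "nat \<Rightarrow> 'a list"
  assumes "wf_lang L" and "is_theory L T"
    and "consistent TYPE('a) L T" and "complete TYPE('a) L T"
    and "stable TYPE('a) L T"
    and "Leq = lang_eq TYPE('a) L T"
    and "N \<in> Mod Leq (theory_eq TYPE('a) L T)"
    and "Card_order \<kappa>" and "small \<kappa> (UNIV :: nat set)"
    and "small \<kappa> (Sorts L)" and "small \<kappa> (Funs L)" and "small \<kappa> (Rels L)"
    and "saturated Leq N \<kappa>"
    and "B \<subseteq> univ N" and "small \<kappa> B"
    and "stationary Leq N \<kappa> ss B p"
    and "morley_sequence Leq N ss B p a"
  shows "is_canonical_base Leq N \<kappa> ss B p (cb Leq N \<kappa> ss B p) \<and>
         cb Leq N \<kappa> ss B p = kernel Leq N a"
proof -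
  note Leq = \<open>Leq = lang_eq TYPE('a) L T\<close>
  interpret E: eq_struc L T "TYPE('a)" N
    using assms by unfold_locales simp_all
  interpret big_card \<kappa> using assms by unfold_locales
  have "is_canonical_base Leq N \<kappa> ss B p (kernel Leq N a)"
  proof (cases "Sorts Leq = {}")
    case True
    then have univ: "univ N = {}" using E.N_struc Leq by (auto simp: is_struc_def)
    moreover have "kernel Leq N a = {}" using univ by (auto simp: kernel_def dcl_def)
    moreover have "realises N ss (a 0) p" using assms by (simp add: morley_sequence_def)
    ultimately show ?thesis using canonical_base_empty_univ assms by metis
  next
    case False
    interpret S: stab Leq N \<kappa>
      using False assms E.N_struc E.no_order_property_eq by unfold_locales (simp_all add: Leq)
    have small: "small \<kappa> (Sorts Leq)" "small \<kappa> (Funs Leq)" "small \<kappa> (Rels Leq)"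
      unfolding Leq using assms small_lang_eq by blast+
    interpret imag Leq N \<kappa>
    proof
      fix ts S assume "S.dfb (univ N) ts S"
      then show "\<exists>e\<in>univ N. \<exists>R. S.dfb {} (ts @ [sort_of N e]) R \<and>
        S = {y \<in> tuples N ts. y @ [e] \<in> R} \<and>
        (\<forall>e'\<in>univ N. sort_of N e' = sort_of N e \<longrightarrow> S = {y \<in> tuples N ts. y @ [e'] \<in> R} \<longrightarrow> e' = e)"
        using E.imaginary_codes False unfolding Leq by blast
    next
      show "small \<kappa> (dcl Leq N A)" if "A \<subseteq> univ N" "small \<kappa> A" for A
        by (rule S.small_dcl[OF small that(2)])
    qed
    show ?thesis using kernel_is_canonical_base assms by blast
  qed
  then show ?thesis using cb_eqI by metis
qed

end
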